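(* The following statements hold: (a) For all partitions $\mu$ and $\nu$, the product $\mathbb{F}_{\nu}\,\mathbb{F}_{\mu} = \sum_{\lambda} c^{\lambda}_{\mu,\nu}\,\mathbb{F}_{\lambda}$ is a finite expansion. Equivalently, for fixed $\mu$ and $\nu$ there exist only finitely many partitions $\lambda$ such that $c^{\lambda}_{\mu,\nu}\neq 0$. (b) The functions $\mathbb{F}_{\lambda}(x_1,x_2,\dots)$ form a basis of the commutative ring $\Gamma^{q} := \bigoplus_{\lambda}\mathbb{R}(q)\,\mathbb{F}_{\lambda}(x_1,x_2,\dots)$. (c) For any partitions $\mu\subseteq\lambda$, the skew inhomogeneous $q$-Whittaker polynomials $\mathbb{F}_{\lambda/\mu}$ belong to the ring $\Gamma^{q}$. Moreover, $\Gamma^{q}$ can be made a commutative and cocommutative bialgebra with the product $\mathbb{F}_{\nu}\,\mathbb{F}_{\mu} = \sum_{\lambda} c^{\lambda}_{\mu,\nu}\,\mathbb{F}_{\lambda}$ from (a) and the coproduct $\Delta:\Gamma^{q}\to\Gamma^{q}\otimes\Gamma^{q}$ given by $\Delta(\mathbb{F}_{\lambda}) = \sum_{\mu}\mathbb{F}_{\lambda/\mu}\otimes\mathbb{F}_{\mu}$.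
   Context: For partitions $\lambda,\mu$, the one-variable skew inhomogeneous $q$-Whittaker polynomial is $\mathbb{F}_{\lambda/\mu}(x) := \mathbf{1}_{\mu\prec\lambda}\, x^{|\lambda|-|\mu|}\prod_{r=1}^{\ell(\lambda)}(x;q)_{\mu_r-\lambda_{r+1}}\frac{(q;q)_{\lambda_r-\lambda_{r+1}}}{(q;q)_{\lambda_r-\mu_r}(q;q)_{\mu_r-\lambda_{r+1}}}$, where $\mu\prec\lambda$ means $\lambda/\mu$ is a horizontal strip and $(x;q)_k=\prod_{i=0}^{k-1}(1-xq^i)$. The $n$-variable versions are defined by the branching rule $\mathbb{F}_{\lambda/\mu}(x_1,\dots,x_n)=\sum_{\mu\subseteq\nu\prec\lambda}\mathbb{F}_{\nu/\mu}(x_1,\dots,x_{n-1})\,\mathbb{F}_{\lambda/\nu}(x_n)$, and $\mathbb{F}_\lambda=\mathbb{F}_{\lambda/\varnothing}$. They are stable under setting the last variable to $0$, so they define elements $\mathbb{F}_{\lambda}(x_1,x_2,\dots)$ of the completion (by degree) of the ring of symmetric functions in countably many variables; these are inhomogeneous with lowest-degree component equal to the $q$-Whittaker function $W_\lambda$, and their degree grows with the number of variables. The coefficients $c^{\lambda}_{\mu,\nu}\in\mathbb{R}(q)$ are those of the (a priori possibly infinite) expansion of $\mathbb{F}_\nu\mathbb{F}_\mu$ in the family $\{\mathbb{F}_\lambda\}$. *)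

theory Defs
  imports
    "HOL-Library.Poly_Mapping"
    "HOL-Library.Product_Plus"
    "HOL-Computational_Algebra.Polynomial"
    "HOL-Computational_Algebra.Fraction_Field"
begin

section \<open>Formal power series with exponents in a commutative monoid\<close>

class fin_decomp = comm_monoid_add +
  assumes finite_decomp: "finite {(a, b). a + b = m}"

instance nat :: fin_decomp
proof
  fix m :: nat
  have "{(a, b). a + b = m} \<subseteq> {..m} \<times> {..m}" by auto
  then show "finite {(a, b). a + b = m}" by (rule finite_subset) simp
qed

instance prod :: (fin_decomp, fin_decomp) fin_decomp
proof
  fix m :: "'a \<times> 'b"
  let ?A = "{(a, b). a + b = fst m}" and ?B = "{(a, b). a + b = snd m}"
  have "{(a, b). a + b = m} \<subseteq> (\<lambda>((a, b), (c, d)). ((a, c), (b, d))) ` (?A \<times> ?B)"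
    by (force simp: image_iff)
  then show "finite {(a, b). a + b = m}"
    by (rule finite_subset) (intro finite_imageI finite_cartesian_product finite_decomp)
qed

instance poly_mapping :: (type, "{fin_decomp, canonically_ordered_monoid_add}") fin_decomp
proof
  fix m :: "'a \<Rightarrow>\<^sub>0 'b"
  let ?D = "{(a, b). a + b = m}"
  let ?g = "\<lambda>(a, b) k. (Poly_Mapping.lookup a k, Poly_Mapping.lookup b k)"
  let ?T = "\<Union>k\<in>Poly_Mapping.keys m. {(a, b). a + b = Poly_Mapping.lookup m k}"
  let ?S = "{f. \<forall>x. (x \<in> Poly_Mapping.keys m \<longrightarrow> f x \<in> ?T) \<and>
                    (x \<notin> Poly_Mapping.keys m \<longrightarrow> f x = (0, 0))}"
  have "finite ?S"
    by (intro finite_set_of_finite_funs finite_UN_I finite_keys finite_decomp)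
  moreover have "?g ` ?D \<subseteq> ?S"
  proof clarify
    fix a b :: "'a \<Rightarrow>\<^sub>0 'b" and x
    show "(x \<in> Poly_Mapping.keys (a + b) \<longrightarrow>
            (Poly_Mapping.lookup a x, Poly_Mapping.lookup b x) \<in>
            (\<Union>k\<in>Poly_Mapping.keys (a + b). {(c, d). c + d = Poly_Mapping.lookup (a + b) k})) \<and>
          (x \<notin> Poly_Mapping.keys (a + b) \<longrightarrow>
            (Poly_Mapping.lookup a x, Poly_Mapping.lookup b x) = (0, 0))"
      by (auto simp: in_keys_iff lookup_add)
  qed
  ultimately have "finite (?g ` ?D)"
    by (rule finite_subset[rotated])
  then show "finite ?D"
    by (rule finite_imageD) (auto simp: inj_on_def fun_eq_iff intro!: poly_mapping_eqI)
qed

typedef ('m, 'k) pseries = "UNIV :: ('m \<Rightarrow> 'k) set"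
  morphisms pcoeff PSeries ..

setup_lifting type_definition_pseries

lemma pseries_eqI: "(\<And>m. pcoeff f m = pcoeff g m) \<Longrightarrow> f = g"
  by transfer auto

instantiation pseries :: (type, ab_group_add) ab_group_add
begin
lift_definition zero_pseries :: "('a, 'b) pseries" is "\<lambda>_. 0" .
lift_definition plus_pseries :: "('a, 'b) pseries \<Rightarrow> ('a, 'b) pseries \<Rightarrow> ('a, 'b) pseries"
  is "\<lambda>f g m. f m + g m" .
lift_definition minus_pseries :: "('a, 'b) pseries \<Rightarrow> ('a, 'b) pseries \<Rightarrow> ('a, 'b) pseries"
  is "\<lambda>f g m. f m - g m" .
lift_definition uminus_pseries :: "('a, 'b) pseries \<Rightarrow> ('a, 'b) pseries"
  is "\<lambda>f m. - f m" .
instance by standard (transfer; simp add: fun_eq_iff algebra_simps)+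
end

instantiation pseries :: (fin_decomp, comm_ring_1) comm_ring_1
begin
lift_definition one_pseries :: "('a, 'b) pseries" is "\<lambda>m. if m = 0 then 1 else 0" .
lift_definition times_pseries :: "('a, 'b) pseries \<Rightarrow> ('a, 'b) pseries \<Rightarrow> ('a, 'b) pseries"
  is "\<lambda>f g m. \<Sum>(a, b) | a + b = m. f a * g b" .
instance
proof
  fix f g h :: "('a, 'b) pseries"
  show "f * g * h = f * (g * h)"
  proof (transfer, rule ext)
    fix f g h :: "'a \<Rightarrow> 'b" and m :: 'a
    let ?L = "SIGMA p : {(d, c). d + c = m}. {(a, b). a + b = fst p}"
    let ?R = "SIGMA p : {(a, d). a + d = m}. {(b, c). b + c = snd p}"
    have "(\<Sum>(d, c) | d + c = m. (\<Sum>(a, b) | a + b = d. f a * g b) * h c)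
        = (\<Sum>p | (case p of (d, c) \<Rightarrow> d + c = m).
             \<Sum>r | (case r of (a, b) \<Rightarrow> a + b = fst p). f (fst r) * g (snd r) * h (snd p))"
      by (auto simp: sum_distrib_right case_prod_unfold intro!: sum.cong)
    also have "\<dots> = (\<Sum>(p, r) \<in> ?L. f (fst r) * g (snd r) * h (snd p))"
      by (subst sum.Sigma) (auto simp: finite_decomp)
    also have "\<dots> = (\<Sum>(p, r) \<in> ?R. f (fst p) * g (fst r) * h (snd r))"
      by (rule sum.reindex_bij_witness[of _ "\<lambda>((a, d), (b, c)). ((a + b, c), (a, b))"
              "\<lambda>((d, c), (a, b)). ((a, b + c), (b, c))"])
         (auto simp: add.assoc)
    also have "\<dots> = (\<Sum>p | (case p of (a, d) \<Rightarrow> a + d = m).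
             \<Sum>r | (case r of (b, c) \<Rightarrow> b + c = snd p). f (fst p) * g (fst r) * h (snd r))"
      by (subst sum.Sigma) (auto simp: finite_decomp)
    also have "\<dots> = (\<Sum>(a, d) | a + d = m. f a * (\<Sum>(b, c) | b + c = d. g b * h c))"
      by (auto simp: sum_distrib_left case_prod_unfold mult.assoc intro!: sum.cong)
    finally show "(\<Sum>(d, c) | d + c = m. (\<Sum>(a, b) | a + b = d. f a * g b) * h c)
        = (\<Sum>(a, d) | a + d = m. f a * (\<Sum>(b, c) | b + c = d. g b * h c))" .
  qed
  show "f * g = g * f"
  proof (transfer, rule ext)
    fix f g :: "'a \<Rightarrow> 'b" and m :: 'a
    show "(\<Sum>(a, b) | a + b = m. f a * g b) = (\<Sum>(a, b) | a + b = m. g a * f b)"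
      by (rule sum.reindex_bij_witness[of _ prod.swap prod.swap])
         (auto simp: add.commute mult.commute)
  qed
  show "1 * f = f"
  proof (transfer, rule ext)
    fix f :: "'a \<Rightarrow> 'b" and m :: 'a
    have "(\<Sum>(a, b) | a + b = m. (if a = 0 then 1 else 0) * f b)
        = (\<Sum>(a, b) \<in> {(0 :: 'a, m)}. (if a = 0 then 1 else 0) * f b)"
      by (rule sum.mono_neutral_right) (auto simp: finite_decomp split: if_splits)
    then show "(\<Sum>(a, b) | a + b = m. (if a = 0 then 1 else 0) * f b) = f m"
      by simp
  qed
  show "(f + g) * h = f * h + g * h"
    by (transfer, rule ext) (simp add: case_prod_unfold algebra_simps sum.distrib)
  show "(0::('a, 'b) pseries) \<noteq> 1"
    by transfer (metis zero_neq_one)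
qed
end

lift_definition pscale :: "'k::comm_ring_1 \<Rightarrow> ('m, 'k) pseries \<Rightarrow> ('m, 'k) pseries"
  is "\<lambda>c f m. c * f m" .

lift_definition pvar :: "'v \<Rightarrow> ('v \<Rightarrow>\<^sub>0 nat, 'k::comm_ring_1) pseries"
  is "\<lambda>i m. if m = Poly_Mapping.single i 1 then 1 else 0" .

definition pconst :: "'k::comm_ring_1 \<Rightarrow> ('m::fin_decomp, 'k) pseries"
  where "pconst c = pscale c 1"

interpretation pseries: vector_space "pscale :: 'k::field \<Rightarrow> ('m, 'k) pseries \<Rightarrow> ('m, 'k) pseries"
  by unfold_locales (transfer; simp add: fun_eq_iff algebra_simps)+

lemma pcoeff_zero [simp]: "pcoeff 0 m = 0"
  and pcoeff_one: "pcoeff 1 m' = (if m' = 0 then 1 else 0)"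
  and pcoeff_add [simp]: "pcoeff (f + g) m = pcoeff f m + pcoeff g m"
  and pcoeff_minus [simp]: "pcoeff (f - g) m = pcoeff f m - pcoeff g m"
  and pcoeff_scale [simp]: "pcoeff (pscale c h) m = c * pcoeff h m"
  and pcoeff_mult: "pcoeff (x * y) n = (\<Sum>(a, b) | a + b = n. pcoeff x a * pcoeff y b)"
  by (transfer; simp)+

lemma pcoeff_sum [simp]: "pcoeff (sum f A) m = (\<Sum>i\<in>A. pcoeff (f i) m)"
  by (induction A rule: infinite_finite_induct) auto


section \<open>Tensor products, coalgebras and bialgebras\<close>

lift_definition tensor :: "('m, 'k::comm_ring_1) pseries \<Rightarrow> ('n, 'k) pseries \<Rightarrow> ('m \<times> 'n, 'k) pseries"
    (infixr "\<otimes>" 75)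
  is "\<lambda>f g (a, b). f a * g b" .

text \<open>
  The tensor product over a field \<open>k\<close> of subspaces \<open>V\<close>, \<open>W\<close> of spaces of \<open>k\<close>-valued functions is
  realised inside the functions of two arguments.  The universal property is proved below
  (\<open>tensor_universal\<close>, \<open>tensor_space_ext\<close>).
\<close>
definition tensor_space :: "('m, 'k::field) pseries set \<Rightarrow> ('n, 'k) pseries set \<Rightarrow> ('m \<times> 'n, 'k) pseries set"
  where "tensor_space V W = pseries.span {f \<otimes> g | f g. f \<in> V \<and> g \<in> W}"

definition linear_on ::
    "('k \<Rightarrow> 'a \<Rightarrow> 'a) \<Rightarrow> ('k \<Rightarrow> 'b \<Rightarrow> 'b) \<Rightarrow> 'a::ab_group_add set \<Rightarrow> ('a \<Rightarrow> 'b::ab_group_add) \<Rightarrow> bool"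
  where "linear_on s1 s2 V f \<longleftrightarrow>
    (\<forall>x\<in>V. \<forall>y\<in>V. f (x + y) = f x + f y) \<and> (\<forall>c. \<forall>x\<in>V. f (s1 c x) = s2 c (f x))"

definition tensor_lift ::
    "('k \<Rightarrow> 'z \<Rightarrow> 'z) \<Rightarrow> ('m, 'k::field) pseries set \<Rightarrow> ('n, 'k) pseries set \<Rightarrow>
     (('m, 'k) pseries \<Rightarrow> ('n, 'k) pseries \<Rightarrow> 'z::ab_group_add) \<Rightarrow> ('m \<times> 'n, 'k) pseries \<Rightarrow> 'z"
  where "tensor_lift s V W B = (SOME L. linear_on pscale s (tensor_space V W) L \<and>
    (\<forall>f\<in>V. \<forall>g\<in>W. L (f \<otimes> g) = B f g))"

definition tensor_map ::
    "('m, 'k::field) pseries set \<Rightarrow> ('n, 'k) pseries set \<Rightarrow>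
     (('m, 'k) pseries \<Rightarrow> ('m2, 'k) pseries) \<Rightarrow> (('n, 'k) pseries \<Rightarrow> ('n2, 'k) pseries) \<Rightarrow>
     ('m \<times> 'n, 'k) pseries \<Rightarrow> ('m2 \<times> 'n2, 'k) pseries"
  where "tensor_map V W \<phi> \<psi> = tensor_lift pscale V W (\<lambda>f g. \<phi> f \<otimes> \<psi> g)"

lift_definition tensor_assoc :: "(('m \<times> 'n) \<times> 'p, 'k) pseries \<Rightarrow> ('m \<times> 'n \<times> 'p, 'k) pseries"
  is "\<lambda>f (a, b, c). f ((a, b), c)" .

lift_definition tensor_swap :: "('m \<times> 'n, 'k) pseries \<Rightarrow> ('n \<times> 'm, 'k) pseries"
  is "\<lambda>f (b, a). f (a, b)" .

lemma pcoeff_tensor [simp]: "pcoeff (f \<otimes> g) (a, b) = pcoeff f a * pcoeff g b"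
  by transfer simp

lemma tensor_assoc_tensor: "tensor_assoc ((f \<otimes> g) \<otimes> h) = f \<otimes> (g \<otimes> h)"
  by transfer (auto simp: fun_eq_iff mult.assoc)

lemma tensor_swap_tensor: "tensor_swap (f \<otimes> g) = g \<otimes> f"
  by transfer (auto simp: fun_eq_iff mult.commute)

lemma tensor_add_left: "(f + f') \<otimes> g = f \<otimes> g + f' \<otimes> g"
  and tensor_add_right: "f \<otimes> (h + h') = f \<otimes> h + f \<otimes> h'"
  and tensor_scale_left: "pscale c f \<otimes> g = pscale c (f \<otimes> g)"
  and tensor_scale_right: "f \<otimes> pscale c g = pscale c (f \<otimes> g)"
  by (transfer; auto simp: fun_eq_iff algebra_simps)+

lemma tensor_one: "(1 :: ('m::fin_decomp, 'k::comm_ring_1) pseries) \<otimes> (1 :: ('n::fin_decomp, 'k) pseries) = 1"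
  by transfer (auto simp: fun_eq_iff zero_prod_def)

lemma tensor_mult_tensor:
  fixes f f' :: "('m::fin_decomp, 'k::comm_ring_1) pseries" and g g' :: "('n::fin_decomp, 'k) pseries"
  shows "(f \<otimes> g) * (f' \<otimes> g') = (f * f') \<otimes> (g * g')"
proof (rule pseries_eqI)
  fix m :: "'m \<times> 'n"
  obtain a b where m: "m = (a, b)" by (cases m)
  have "pcoeff ((f \<otimes> g) * (f' \<otimes> g')) m =
      (\<Sum>(p, r) | p + r = (a, b). pcoeff (f \<otimes> g) p * pcoeff (f' \<otimes> g') r)"
    by (simp add: pcoeff_mult m)
  also have "\<dots> = (\<Sum>(p, r) \<in> {(a1, a2). a1 + a2 = a} \<times> {(b1, b2). b1 + b2 = b}.
      (pcoeff f (fst p) * pcoeff f' (snd p)) * (pcoeff g (fst r) * pcoeff g' (snd r)))"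
    by (rule sum.reindex_bij_witness[of _ "\<lambda>((a1, a2), (b1, b2)). ((a1, b1), (a2, b2))"
          "\<lambda>((a1, b1), (a2, b2)). ((a1, a2), (b1, b2))"]) (auto simp: algebra_simps)
  also have "\<dots> = pcoeff ((f * f') \<otimes> (g * g')) m"
    by (simp add: m pcoeff_mult sum_product case_prod_unfold sum.cartesian_product)
  finally show "pcoeff ((f \<otimes> g) * (f' \<otimes> g')) m = pcoeff ((f * f') \<otimes> (g * g')) m" .
qed

lemma tensor_independent:
  fixes A :: "('m, 'k::field) pseries set" and B :: "('n, 'k) pseries set"
  assumes A: "pseries.independent A" and B: "pseries.independent B"
    and S: "finite S" "finite T" "S \<subseteq> A" "T \<subseteq> B"
    and 0: "(\<Sum>f\<in>S. \<Sum>g\<in>T. pscale (c f g) (f \<otimes> g)) = 0"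
    and fg: "f \<in> S" "g \<in> T"
  shows "c f g = 0"
proof -
  have "(\<Sum>g\<in>T. c f g * pcoeff g b) = 0" for b
  proof -
    have "(\<Sum>f\<in>S. pscale (\<Sum>g\<in>T. c f g * pcoeff g b) f) = 0"
    proof (rule pseries_eqI)
      fix a
      have "pcoeff (\<Sum>f\<in>S. \<Sum>g\<in>T. pscale (c f g) (f \<otimes> g)) (a, b) = 0"
        by (simp only: 0 pcoeff_zero)
      then show "pcoeff (\<Sum>f\<in>S. pscale (\<Sum>g\<in>T. c f g * pcoeff g b) f) a = pcoeff 0 a"
        by (simp add: sum_distrib_left sum_distrib_right mult_ac)
    qed
    then show ?thesis
      using pseries.independentD[OF A S(1,3), of "\<lambda>f. \<Sum>g\<in>T. c f g * pcoeff g b" f] fg by simp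
  qed
  then have "(\<Sum>g\<in>T. pscale (c f g) g) = 0"
    by (intro pseries_eqI) simp
  then show ?thesis
    using pseries.independentD[OF B S(2,4), of "c f" g] fg by simp
qed

theorem tensor_universal:
  fixes V :: "('m, 'k::field) pseries set" and W :: "('n, 'k) pseries set"
    and s :: "'k \<Rightarrow> 'z \<Rightarrow> 'z::ab_group_add"
  assumes s: "vector_space s"
    and V: "pseries.subspace V" and W: "pseries.subspace W"
    and B1: "\<And>g. g \<in> W \<Longrightarrow> linear_on pscale s V (\<lambda>f. B f g)"
    and B2: "\<And>f. f \<in> V \<Longrightarrow> linear_on pscale s W (B f)"
  shows "linear_on pscale s (tensor_space V W) (tensor_lift s V W B)"
    and "\<And>f g. f \<in> V \<Longrightarrow> g \<in> W \<Longrightarrow> tensor_lift s V W B (f \<otimes> g) = B f g"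
proof -
  interpret s: vector_space s by fact
  obtain X where X: "X \<subseteq> V" "pseries.independent X" "V \<subseteq> pseries.span X"
    by (rule pseries.maximal_independent_subset)
  obtain Y where Y: "Y \<subseteq> W" "pseries.independent Y" "W \<subseteq> pseries.span Y"
    by (rule pseries.maximal_independent_subset)
  have sV: "pseries.span X = V" and sW: "pseries.span Y = W"
    using X Y V W by (auto simp: pseries.span_minimal subset_antisym)
  let ?P = "(\<lambda>(f, g). f \<otimes> g) ` (X \<times> Y)"
  have inj: "inj_on (\<lambda>(f, g). f \<otimes> g) (X \<times> Y)"
  proof (rule inj_onI, clarify)
    fix f g f' g' assume H: "f \<in> X" "g \<in> Y" "f' \<in> X" "g' \<in> Y" "f \<otimes> g = f' \<otimes> g'"
    show "f = f' \<and> g = g'"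
    proof (rule ccontr)
      assume ne: "\<not> (f = f' \<and> g = g')"
      let ?c = "\<lambda>u v. (if u = f \<and> v = g then 1 else 0) - (if u = f' \<and> v = g' then 1 else (0::'k))"
      have d: "(\<Sum>u\<in>{f, f'}. \<Sum>v\<in>{g, g'}. pscale (if u = h \<and> v = k then 1 else 0) (u \<otimes> v)) = h \<otimes> k"
        if "h \<in> {f, f'}" "k \<in> {g, g'}" for h k
      proof -
        have "(\<Sum>u\<in>{f, f'}. \<Sum>v\<in>{g, g'}. pscale (if u = h \<and> v = k then 1 else 0) (u \<otimes> v))
          = (\<Sum>u\<in>{f, f'}. if u = h then (\<Sum>v\<in>{g, g'}. if v = k then u \<otimes> v else 0) else 0)"
          by (intro sum.cong refl) (auto intro!: sum.cong simp: if_distrib[of "\<lambda>c. pscale c _"] cong: if_cong)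
        also have "\<dots> = h \<otimes> k" using that by (simp add: sum.delta)
        finally show ?thesis .
      qed
      have "(\<Sum>u\<in>{f, f'}. \<Sum>v\<in>{g, g'}. pscale (?c u v) (u \<otimes> v)) = f \<otimes> g - f' \<otimes> g'"
        unfolding pseries.scale_left_diff_distrib sum_subtractf by (subst (1 2) d) auto
      then have "?c f g = 0"
        using H by (intro tensor_independent[OF X(2) Y(2), of "{f, f'}" "{g, g'}" ?c]) auto
      then show False using ne by (auto split: if_splits)
    qed
  qed
  have ind: "pseries.independent ?P"
    unfolding pseries.independent_explicit_module
  proof (intro allI impI)
    fix t u v assume t: "finite t" "t \<subseteq> ?P" "(\<Sum>v\<in>t. pscale (u v) v) = 0" "v \<in> t"
    obtain Q where Q: "Q \<subseteq> X \<times> Y" "finite Q" "t = (\<lambda>(f, g). f \<otimes> g) ` Q"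
      using t(1,2) by (meson finite_subset_image)
    let ?S = "fst ` Q" and ?T = "snd ` Q"
    let ?c = "\<lambda>f g. if (f, g) \<in> Q then u (f \<otimes> g) else 0"
    have "(\<Sum>f\<in>?S. \<Sum>g\<in>?T. pscale (?c f g) (f \<otimes> g))
        = (\<Sum>p\<in>?S \<times> ?T. if p \<in> Q then pscale (u (fst p \<otimes> snd p)) (fst p \<otimes> snd p) else 0)"
      unfolding sum.cartesian_product by (intro sum.cong) auto
    also have "\<dots> = (\<Sum>p\<in>Q. pscale (u (fst p \<otimes> snd p)) (fst p \<otimes> snd p))"
      using Q(2) by (subst sum.inter_restrict[symmetric]) (auto intro!: sum.cong simp: rev_image_eqI)
    also have "\<dots> = (\<Sum>v\<in>t. pscale (u v) v)"
      unfolding Q(3) using inj_on_subset[OF inj Q(1)]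
      by (subst sum.reindex) (auto simp: case_prod_unfold)
    finally have z: "(\<Sum>f\<in>?S. \<Sum>g\<in>?T. pscale (?c f g) (f \<otimes> g)) = 0" using t(3) by simp
    from t(4) obtain f g where fg: "(f, g) \<in> Q" "v = f \<otimes> g" using Q(3) by auto
    have "?c f g = 0"
      by (rule tensor_independent[OF X(2) Y(2) _ _ _ _ z]) (use Q fg in force)+
    then show "u v = 0" using fg by simp
  qed
  interpret vp: vector_space_pair "pscale :: 'k \<Rightarrow> ('m \<times> 'n, 'k) pseries \<Rightarrow> _" s ..
  define \<beta> where "\<beta> x = (let p = inv_into (X \<times> Y) (\<lambda>(f, g). f \<otimes> g) x in B (fst p) (snd p))" for x
  have \<beta>: "\<beta> (f \<otimes> g) = B f g" if "f \<in> X" "g \<in> Y" for f g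
    using inv_into_f_f[OF inj, of "(f, g)"] that by (simp add: \<beta>_def)
  obtain L where L: "Vector_Spaces.linear pscale s L" "\<forall>x\<in>?P. L x = \<beta> x"
    using vp.linear_independent_extend[OF ind, of \<beta>] by blast
  interpret L: Vector_Spaces.linear pscale s L by fact
  have B0: "B 0 g = 0" if "g \<in> W" for g
    using B1[OF that] pseries.subspace_0[OF V]
    unfolding linear_on_def by (metis add_0 add_cancel_right_left)
  have B0': "B f 0 = 0" if "f \<in> V" for f
    using B2[OF that] pseries.subspace_0[OF W]
    unfolding linear_on_def by (metis add_0 add_cancel_right_left)
  have zero: "(0 \<otimes> g) = 0" "(f \<otimes> 0) = 0" for f :: "('m, 'k) pseries" and g :: "('n, 'k) pseries"
    by (transfer; auto simp: fun_eq_iff)+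
  have step1: "g \<in> W \<and> L (f \<otimes> g) = B f g" if f: "f \<in> X" and g: "g \<in> pseries.span Y" for f g
    using g
  proof (induction rule: pseries.span_induct_alt)
    case base
    show ?case using f X pseries.subspace_0[OF W] by (auto simp: zero B0' L.zero)
  next
    case (step c x y)
    have "y \<in> W" "x \<in> W" "f \<in> V" "pscale c x \<in> W"
      using step f X Y W by (auto intro: pseries.subspace_scale)
    then show ?case
      using step B2[of f] L(2) \<beta>[OF f] f pseries.subspace_add[OF W]
      by (auto simp: tensor_add_right tensor_scale_right L.add L.scale linear_on_def image_iff)
  qed
  have step2: "f \<in> V \<and> L (f \<otimes> g) = B f g" if f: "f \<in> pseries.span X" and g: "g \<in> W" for f g
    using f
  proof (induction rule: pseries.span_induct_alt)
    case base
    show ?case using g pseries.subspace_0[OF V] by (auto simp: zero B0 L.zero)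
  next
    case (step c x y)
    have "y \<in> V" "x \<in> V" "pscale c x \<in> V"
      using step X V by (auto intro: pseries.subspace_scale)
    then show ?case
      using step B1[OF g] step1[of x g] g sW pseries.subspace_add[OF V]
      by (auto simp: tensor_add_left tensor_scale_left L.add L.scale linear_on_def)
  qed
  have "\<exists>L. linear_on pscale s (tensor_space V W) L \<and> (\<forall>f\<in>V. \<forall>g\<in>W. L (f \<otimes> g) = B f g)"
    by (rule exI[of _ L]) (use step2 sV in \<open>auto simp: linear_on_def L.add L.scale\<close>)
  then have *: "linear_on pscale s (tensor_space V W) (tensor_lift s V W B) \<and>
      (\<forall>f\<in>V. \<forall>g\<in>W. tensor_lift s V W B (f \<otimes> g) = B f g)"
    unfolding tensor_lift_def by (rule someI_ex)
  then show "linear_on pscale s (tensor_space V W) (tensor_lift s V W B)"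
    and "\<And>f g. f \<in> V \<Longrightarrow> g \<in> W \<Longrightarrow> tensor_lift s V W B (f \<otimes> g) = B f g"
    by auto
qed

theorem tensor_space_ext:
  fixes V :: "('m, 'k::field) pseries set" and W :: "('n, 'k) pseries set"
  assumes "linear_on pscale s (tensor_space V W) L" "linear_on pscale s (tensor_space V W) L'"
    and s: "vector_space s"
    and eq: "\<And>f g. f \<in> V \<Longrightarrow> g \<in> W \<Longrightarrow> L (f \<otimes> g) = L' (f \<otimes> g)"
    and t: "t \<in> tensor_space V W"
  shows "L t = L' t"
proof -
  interpret s: vector_space s by fact
  have z: "0 \<in> tensor_space V W" by (simp add: tensor_space_def pseries.span_zero)
  have "t \<in> tensor_space V W \<and> L t = L' t" using t[unfolded tensor_space_def]
  proof (induction rule: pseries.span_induct_alt)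
    case base
    have "L (pscale 0 0) = s 0 (L 0)" "L' (pscale 0 0) = s 0 (L' 0)"
      using assms(1,2) z unfolding linear_on_def by blast+
    then show ?case using z by simp
  next
    case (step c x y)
    have y: "y \<in> tensor_space V W" using step by simp
    have x: "x \<in> tensor_space V W" using step by (auto simp: tensor_space_def intro: pseries.span_base)
    have "pscale c x \<in> tensor_space V W" "pscale c x + y \<in> tensor_space V W"
      using x y by (auto simp: tensor_space_def intro: pseries.span_scale pseries.span_add)
    note this x y
    then show ?case
      using assms(1,2) step eq unfolding linear_on_def by auto
  qed
  then show ?thesis ..
qed

corollary tensor_map_tensor:
  fixes V :: "('m, 'k::field) pseries set" and W :: "('n, 'k) pseries set"
    and \<phi> :: "('m, 'k) pseries \<Rightarrow> ('m2, 'k) pseries" and \<psi> :: "('n, 'k) pseries \<Rightarrow> ('n2, 'k) pseries"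
  assumes "pseries.subspace V" "pseries.subspace W"
    and "linear_on pscale pscale V \<phi>" "linear_on pscale pscale W \<psi>"
  shows "linear_on pscale pscale (tensor_space V W) (tensor_map V W \<phi> \<psi>)"
    and "f \<in> V \<Longrightarrow> g \<in> W \<Longrightarrow> tensor_map V W \<phi> \<psi> (f \<otimes> g) = \<phi> f \<otimes> \<psi> g"
proof -
  have 1: "linear_on pscale pscale V (\<lambda>f. \<phi> f \<otimes> \<psi> g)" "linear_on pscale pscale W (\<lambda>g. \<phi> f \<otimes> \<psi> g)" for f g
    using assms(3,4) by (auto simp: linear_on_def tensor_add_left tensor_add_right
        tensor_scale_left tensor_scale_right)
  note * = tensor_universal[OF pseries.vector_space_axioms assms(1,2), of "\<lambda>f g. \<phi> f \<otimes> \<psi> g"]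
  show "linear_on pscale pscale (tensor_space V W) (tensor_map V W \<phi> \<psi>)"
    unfolding tensor_map_def by (rule *(1)) (rule 1)+
  show "f \<in> V \<Longrightarrow> g \<in> W \<Longrightarrow> tensor_map V W \<phi> \<psi> (f \<otimes> g) = \<phi> f \<otimes> \<psi> g"
    unfolding tensor_map_def by (rule *(2)) (rule 1 | assumption)+
qed

definition commutative_subalgebra :: "('m::fin_decomp, 'k::field) pseries set \<Rightarrow> bool"
  where "commutative_subalgebra A \<longleftrightarrow> pseries.subspace A \<and> 1 \<in> A \<and>
    (\<forall>f\<in>A. \<forall>g\<in>A. f * g \<in> A \<and> f * g = g * f)"

definition coalgebra_on ::
    "('m, 'k::field) pseries set \<Rightarrow> (('m, 'k) pseries \<Rightarrow> ('m \<times> 'm, 'k) pseries) \<Rightarrow>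
     (('m, 'k) pseries \<Rightarrow> 'k) \<Rightarrow> bool"
  where "coalgebra_on A \<Delta> \<epsilon> \<longleftrightarrow>
    pseries.subspace A \<and>
    linear_on pscale pscale A \<Delta> \<and> \<Delta> ` A \<subseteq> tensor_space A A \<and>
    linear_on pscale (*) A \<epsilon> \<and>
    (\<forall>f\<in>A. tensor_assoc (tensor_map A A \<Delta> id (\<Delta> f)) = tensor_map A A id \<Delta> (\<Delta> f)) \<and>
    (\<forall>f\<in>A. tensor_lift pscale A A (\<lambda>g h. pscale (\<epsilon> g) h) (\<Delta> f) = f) \<and>
    (\<forall>f\<in>A. tensor_lift pscale A A (\<lambda>g h. pscale (\<epsilon> h) g) (\<Delta> f) = f)"

text \<open>
  By \<open>tensor_mult_tensor\<close> and \<open>tensor_one\<close>, the product and unit of series in the two groups of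
  variables restrict to the usual algebra structure of \<open>A \<otimes> A\<close>.
\<close>
definition commutative_bialgebra_on ::
    "('m::fin_decomp, 'k::field) pseries set \<Rightarrow> (('m, 'k) pseries \<Rightarrow> ('m \<times> 'm, 'k) pseries) \<Rightarrow>
     (('m, 'k) pseries \<Rightarrow> 'k) \<Rightarrow> bool"
  where "commutative_bialgebra_on A \<Delta> \<epsilon> \<longleftrightarrow>
    commutative_subalgebra A \<and> coalgebra_on A \<Delta> \<epsilon> \<and>
    \<Delta> 1 = 1 \<and> (\<forall>f\<in>A. \<forall>g\<in>A. \<Delta> (f * g) = \<Delta> f * \<Delta> g) \<and>
    \<epsilon> 1 = 1 \<and> (\<forall>f\<in>A. \<forall>g\<in>A. \<epsilon> (f * g) = \<epsilon> f * \<epsilon> g)"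

definition cocommutative_on ::
    "('m, 'k) pseries set \<Rightarrow> (('m, 'k) pseries \<Rightarrow> ('m \<times> 'm, 'k) pseries) \<Rightarrow> bool"
  where "cocommutative_on A \<Delta> \<longleftrightarrow> (\<forall>f\<in>A. tensor_swap (\<Delta> f) = \<Delta> f)"


section \<open>Partitions\<close>

text \<open>The parts of a partition are indexed from \<open>0\<close>.\<close>
typedef partition = "{f :: nat \<Rightarrow> nat. antimono f \<and> finite {i. f i \<noteq> 0}}"
  morphisms part Partition
  by (rule exI[of _ "\<lambda>_. 0"]) (auto simp: antimono_def)

setup_lifting type_definition_partition

lift_definition empty_partition :: partition is "\<lambda>_. 0"
  by (auto simp: antimono_def)

definition psize :: "partition \<Rightarrow> nat"
  where "psize \<kappa> = (\<Sum>i | part \<kappa> i \<noteq> 0. part \<kappa> i)"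

definition plength :: "partition \<Rightarrow> nat"
  where "plength \<kappa> = card {i. part \<kappa> i \<noteq> 0}"

definition cells :: "partition \<Rightarrow> (nat \<times> nat) set"
  where "cells \<kappa> = {(r, c). c < part \<kappa> r}"

definition contained :: "partition \<Rightarrow> partition \<Rightarrow> bool"  (infix "\<subseteq>\<^sub>p" 50)
  where "\<mu> \<subseteq>\<^sub>p \<kappa> \<longleftrightarrow> cells \<mu> \<subseteq> cells \<kappa>"

definition horizontal_strip :: "partition \<Rightarrow> partition \<Rightarrow> bool"  (infix "\<prec>\<^sub>h" 50)
  where "\<mu> \<prec>\<^sub>h \<kappa> \<longleftrightarrow> \<mu> \<subseteq>\<^sub>p \<kappa> \<and>
    (\<forall>r r' c. (r, c) \<in> cells \<kappa> - cells \<mu> \<and> (r', c) \<in> cells \<kappa> - cells \<mu> \<longrightarrow> r = r')"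

lemma part_antimono: "i \<le> j \<Longrightarrow> part \<kappa> j \<le> part \<kappa> i"
  using part[of \<kappa>] by (auto simp: antimono_def)

lemma contained_iff: "\<mu> \<subseteq>\<^sub>p \<kappa> \<longleftrightarrow> (\<forall>i. part \<mu> i \<le> part \<kappa> i)"
  by (auto simp: contained_def cells_def subset_iff not_less[symmetric]) (meson less_le_trans not_less)

lemma horizontal_strip_iff:
  "\<mu> \<prec>\<^sub>h \<kappa> \<longleftrightarrow> (\<forall>r. part \<kappa> (Suc r) \<le> part \<mu> r \<and> part \<mu> r \<le> part \<kappa> r)"
proof
  assume *: "\<mu> \<prec>\<^sub>h \<kappa>"
  show "\<forall>r. part \<kappa> (Suc r) \<le> part \<mu> r \<and> part \<mu> r \<le> part \<kappa> r"
  proof (rule ccontr)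
    assume "\<not> ?thesis"
    then obtain r where "part \<mu> r < part \<kappa> (Suc r)"
      using * unfolding horizontal_strip_def contained_iff by (meson not_le)
    then have "(r, part \<mu> r) \<in> cells \<kappa> - cells \<mu>" "(Suc r, part \<mu> r) \<in> cells \<kappa> - cells \<mu>"
      using part_antimono[of r "Suc r" \<kappa>] part_antimono[of r "Suc r" \<mu>] by (auto simp: cells_def)
    then show False using * unfolding horizontal_strip_def by (metis n_not_Suc_n)
  qed
next
  assume *: "\<forall>r. part \<kappa> (Suc r) \<le> part \<mu> r \<and> part \<mu> r \<le> part \<kappa> r"
  have False if "(r, c) \<in> cells \<kappa> - cells \<mu>" "(r', c) \<in> cells \<kappa> - cells \<mu>" "r < r'" for r r' c
  proof -
    have "part \<kappa> r' \<le> part \<kappa> (Suc r)" using that by (intro part_antimono) auto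
    also have "\<dots> \<le> part \<mu> r" using * by auto
    finally show False using that by (auto simp: cells_def)
  qed
  then show "\<mu> \<prec>\<^sub>h \<kappa>"
    using * unfolding horizontal_strip_def contained_iff by (metis linorder_neqE_nat)
qed

lemma finite_contained: "finite {\<mu>. \<mu> \<subseteq>\<^sub>p \<kappa>}"
proof -
  let ?S = "{f. \<forall>x. (x \<in> {i. part \<kappa> i \<noteq> 0} \<longrightarrow> f x \<in> {..part \<kappa> 0}) \<and>
                    (x \<notin> {i. part \<kappa> i \<noteq> 0} \<longrightarrow> f x = 0)}"
  have "finite ?S"
    using part[of \<kappa>] by (intro finite_set_of_finite_funs) auto
  moreover have "part ` {\<mu>. \<mu> \<subseteq>\<^sub>p \<kappa>} \<subseteq> ?S"
    by (auto simp: contained_iff) (metis le_trans part_antimono zero_le, metis le_zero_eq)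
  ultimately have "finite (part ` {\<mu>. \<mu> \<subseteq>\<^sub>p \<kappa>})" by (rule finite_subset[rotated])
  then show ?thesis by (rule finite_imageD) (auto simp: inj_on_def part_inject)
qed


section \<open>Inhomogeneous q-Whittaker functions\<close>

type_synonym Rq = "real poly fract"

definition q_ind :: Rq
  where "q_ind = Fract [:0, 1:] 1"

definition qpoch :: "'a::comm_ring_1 \<Rightarrow> 'a \<Rightarrow> nat \<Rightarrow> 'a"
  where "qpoch x q k = (\<Prod>i<k. 1 - x * q ^ i)"

text \<open>Series in the variables \<open>x\<^sub>0, x\<^sub>1, \<dots>\<close> with coefficients in \<open>\<real>(q)\<close>.\<close>
type_synonym series = "(nat \<Rightarrow>\<^sub>0 nat, Rq) pseries"

definition FF_one :: "partition \<Rightarrow> partition \<Rightarrow> series \<Rightarrow> series"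
  where "FF_one \<kappa> \<mu> x = (if \<mu> \<prec>\<^sub>h \<kappa> then
    x ^ (psize \<kappa> - psize \<mu>) *
    (\<Prod>r<plength \<kappa>.
       qpoch x (pconst q_ind) (part \<mu> r - part \<kappa> (Suc r)) *
       pconst (qpoch q_ind q_ind (part \<kappa> r - part \<kappa> (Suc r)) /
               (qpoch q_ind q_ind (part \<kappa> r - part \<mu> r) *
                qpoch q_ind q_ind (part \<mu> r - part \<kappa> (Suc r)))))
    else 0)"

text \<open>
  \<open>FF_n n \<kappa> \<mu>\<close> is the polynomial indexed by \<open>\<kappa>/\<mu>\<close> in \<open>x\<^sub>0, \<dots>, x\<^sub>n\<^sub>-\<^sub>1\<close>.  Starting the branching
  rule at \<open>n = 0\<close> gives the one-variable polynomial for \<open>n = 1\<close>; see \<open>FF_n_1\<close>.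
\<close>
fun FF_n :: "nat \<Rightarrow> partition \<Rightarrow> partition \<Rightarrow> series" where
  "FF_n 0 \<kappa> \<mu> = (if \<kappa> = \<mu> then 1 else 0)"
| "FF_n (Suc n) \<kappa> \<mu> = (\<Sum>\<nu> | \<mu> \<subseteq>\<^sub>p \<nu> \<and> \<nu> \<prec>\<^sub>h \<kappa>. FF_n n \<nu> \<mu> * FF_one \<kappa> \<nu> (pvar n))"

text \<open>
  The stable limit: the coefficient of a monomial is read off in any number of variables that
  contains those of the monomial; see \<open>pcoeff_FF_skew\<close>.
\<close>
definition FF_skew :: "partition \<Rightarrow> partition \<Rightarrow> series"
  where "FF_skew \<kappa> \<mu> =
    PSeries (\<lambda>m. pcoeff (FF_n (LEAST n. Poly_Mapping.keys m \<subseteq> {..<n}) \<kappa> \<mu>) m)"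

definition FF :: "partition \<Rightarrow> series"
  where "FF \<kappa> = FF_skew \<kappa> empty_partition"

lemma finite_branching: "finite {\<nu>. \<mu> \<subseteq>\<^sub>p \<nu> \<and> \<nu> \<prec>\<^sub>h \<kappa>}"
  by (rule finite_subset[OF _ finite_contained[of \<kappa>]]) (auto simp: horizontal_strip_def)

lemma FF_one_not_strip: "\<not> \<mu> \<prec>\<^sub>h \<kappa> \<Longrightarrow> FF_one \<kappa> \<mu> x = 0"
  by (simp add: FF_one_def)

lemma FF_n_1: "FF_n 1 \<kappa> \<mu> = FF_one \<kappa> \<mu> (pvar 0)"
proof -
  have "FF_n 1 \<kappa> \<mu> = (\<Sum>\<nu> | \<mu> \<subseteq>\<^sub>p \<nu> \<and> \<nu> \<prec>\<^sub>h \<kappa>. if \<nu> = \<mu> then FF_one \<kappa> \<mu> (pvar 0) else 0)"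
    by (auto intro!: sum.cong)
  also have "\<dots> = FF_one \<kappa> \<mu> (pvar 0)"
    using finite_branching by (subst sum.delta) (auto simp: FF_one_not_strip contained_def)
  finally show ?thesis .
qed

lemma FF_n_not_contained: "\<not> \<mu> \<subseteq>\<^sub>p \<kappa> \<Longrightarrow> FF_n n \<kappa> \<mu> = 0"
proof (cases n)
  case (Suc k)
  assume "\<not> \<mu> \<subseteq>\<^sub>p \<kappa>"
  then have "{\<nu>. \<mu> \<subseteq>\<^sub>p \<nu> \<and> \<nu> \<prec>\<^sub>h \<kappa>} = {}"
    by (auto simp: horizontal_strip_def contained_def)
  then show ?thesis by (simp only: Suc FF_n.simps sum.empty)
qed (auto simp: contained_def)

lemma FF_skew_not_contained: "\<not> \<mu> \<subseteq>\<^sub>p \<kappa> \<Longrightarrow> FF_skew \<kappa> \<mu> = 0"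
  by (intro pseries_eqI) (simp add: FF_skew_def FF_n_not_contained PSeries_inverse)

text \<open>Setting the variable \<open>x\<^sub>i\<close> to \<open>0\<close>.\<close>
lift_definition pkill :: "'v \<Rightarrow> ('v \<Rightarrow>\<^sub>0 nat, 'k::comm_ring_1) pseries \<Rightarrow> ('v \<Rightarrow>\<^sub>0 nat, 'k) pseries"
  is "\<lambda>i f m. if i \<in> Poly_Mapping.keys m then 0 else f m" .

lemma keys_add_nat: "Poly_Mapping.keys (a + b) = Poly_Mapping.keys a \<union> Poly_Mapping.keys b"
  for a b :: "'v \<Rightarrow>\<^sub>0 nat"
  by (auto simp: in_keys_iff lookup_add)

lemma pkill_simps [simp]:
  fixes f g :: "('v \<Rightarrow>\<^sub>0 nat, 'k::comm_ring_1) pseries"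
  shows "pkill i 0 = (0 :: ('v \<Rightarrow>\<^sub>0 nat, 'k) pseries)"
    and "pkill i 1 = (1 :: ('v \<Rightarrow>\<^sub>0 nat, 'k) pseries)"
    and "pkill i (f + g) = pkill i f + pkill i g"
    and "pkill i (f - g) = pkill i f - pkill i g"
    and "pkill i (pconst c) = (pconst c :: ('v \<Rightarrow>\<^sub>0 nat, 'k) pseries)"
    and "pkill i (pvar j) = (if i = j then 0 else pvar j :: ('v \<Rightarrow>\<^sub>0 nat, 'k) pseries)"
  unfolding pconst_def by (transfer; auto simp: fun_eq_iff)+

lemma pkill_mult [simp]: "pkill i (f * g) = pkill i f * pkill i g"
proof (transfer, rule ext)
  fix i :: 'v and f g :: "('v \<Rightarrow>\<^sub>0 nat) \<Rightarrow> 'k::comm_ring_1" and m :: "'v \<Rightarrow>\<^sub>0 nat"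
  show "(if i \<in> Poly_Mapping.keys m then 0 else \<Sum>(a, b) | a + b = m. f a * g b) =
    (\<Sum>(a, b) | a + b = m. (if i \<in> Poly_Mapping.keys a then 0 else f a) *
                          (if i \<in> Poly_Mapping.keys b then 0 else g b))"
  proof (cases "i \<in> Poly_Mapping.keys m")
    case True
    then have "(if i \<in> Poly_Mapping.keys a then 0 else f a) *
        (if i \<in> Poly_Mapping.keys b then 0 else g b) = 0" if "a + b = m" for a b
      using that keys_add_nat[of a b] by auto
    then show ?thesis using True by (subst sum.neutral) auto
  next
    case False
    then show ?thesis by (auto simp: keys_add_nat intro!: sum.cong)
  qed
qed

lemma pkill_sum [simp]: "pkill i (sum f A) = (\<Sum>x\<in>A. pkill i (f x))"
  by (induction A rule: infinite_finite_induct) auto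

lemma pkill_prod [simp]: "pkill i (prod f A) = (\<Prod>x\<in>A. pkill i (f x))"
  by (induction A rule: infinite_finite_induct) auto

lemma pkill_power [simp]: "pkill i (f ^ n) = pkill i f ^ n"
  by (induction n) auto

lemma pkill_FF_one: "pkill i (FF_one \<kappa> \<mu> x) = FF_one \<kappa> \<mu> (pkill i x)"
  by (simp add: FF_one_def qpoch_def)

lemma qpoch_q_nonzero: "qpoch q_ind q_ind k \<noteq> 0"
proof -
  have "1 - q_ind * q_ind ^ i \<noteq> 0" for i
  proof
    have pw: "q_ind ^ n = Fract (monom 1 n) 1" for n
      by (induction n) (auto simp: q_ind_def One_fract_def monom_Suc)
    assume "1 - q_ind * q_ind ^ i = 0"
    then have "Fract (monom 1 (Suc i)) 1 = (Fract 1 1 :: Rq)"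
      using pw[of "Suc i"] by (simp add: One_fract_def)
    then have "monom 1 (Suc i) = (1 :: real poly)" by (simp add: eq_fract)
    then have "degree (monom (1::real) (Suc i)) = degree (1 :: real poly)" by simp
    then show False by (simp add: degree_monom_eq)
  qed
  then show ?thesis by (simp add: qpoch_def)
qed

lemma pconst_one [simp]: "pconst 1 = 1"
  unfolding pconst_def by transfer auto

lemma psize_mono_eq:
  assumes "\<mu> \<subseteq>\<^sub>p \<kappa>" "psize \<kappa> \<le> psize \<mu>"
  shows "\<mu> = \<kappa>"
proof (rule ccontr)
  assume ne: "\<mu> \<noteq> \<kappa>"
  let ?S = "{i. part \<kappa> i \<noteq> 0}"
  have f: "finite ?S" using part[of \<kappa>] by auto
  have le: "part \<mu> i \<le> part \<kappa> i" for i using assms(1) by (auto simp: contained_iff)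
  have nz: "part \<kappa> i \<noteq> 0" if "part \<mu> i \<noteq> 0" for i using le[of i] that by simp
  have m: "psize \<mu> = (\<Sum>i\<in>?S. part \<mu> i)"
    unfolding psize_def using f nz by (intro sum.mono_neutral_left) auto
  obtain i where i: "part \<mu> i \<noteq> part \<kappa> i" using ne by (metis ext part_inject)
  have "(\<Sum>i\<in>?S. part \<mu> i) < (\<Sum>i\<in>?S. part \<kappa> i)"
  proof (rule sum_strict_mono_ex1)
    have "part \<mu> i < part \<kappa> i" using i le[of i] by simp
    then show "\<exists>i\<in>?S. part \<mu> i < part \<kappa> i" by (intro bexI[of _ i]) auto
  qed (use f le in auto)
  then show False using assms(2) m by (simp add: psize_def)
qed

lemma FF_one_zero: "FF_one \<kappa> \<mu> 0 = (if \<mu> = \<kappa> then 1 else 0)"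
proof (cases "\<mu> = \<kappa>")
  case True
  have "\<kappa> \<prec>\<^sub>h \<kappa>" by (simp add: horizontal_strip_iff part_antimono)
  moreover have "qpoch 0 x k = 1" for x :: series and k by (simp add: qpoch_def)
  moreover have "qpoch q_ind q_ind 0 = 1" by (simp add: qpoch_def)
  ultimately show ?thesis using True qpoch_q_nonzero by (simp add: FF_one_def)
next
  case False
  then have "psize \<mu> < psize \<kappa>" if "\<mu> \<prec>\<^sub>h \<kappa>"
    using that psize_mono_eq[of \<mu> \<kappa>] by (auto simp: horizontal_strip_def not_le[symmetric])
  then show ?thesis using False by (auto simp: FF_one_def power_0_left)
qed

lemma pkill_FF_n: "n \<le> i \<Longrightarrow> pkill i (FF_n n \<kappa> \<mu>) = FF_n n \<kappa> \<mu>"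
  by (induction n arbitrary: \<kappa>) (auto simp: pkill_FF_one intro!: sum.cong)

lemma FF_n_stable: "pkill n (FF_n (Suc n) \<kappa> \<mu>) = FF_n n \<kappa> \<mu>"
proof -
  have "pkill n (FF_n (Suc n) \<kappa> \<mu>)
      = (\<Sum>\<nu> | \<mu> \<subseteq>\<^sub>p \<nu> \<and> \<nu> \<prec>\<^sub>h \<kappa>. if \<nu> = \<kappa> then FF_n n \<kappa> \<mu> else 0)"
    by (auto simp: pkill_FF_one pkill_FF_n FF_one_zero intro!: sum.cong)
  also have "\<dots> = FF_n n \<kappa> \<mu>"
    using finite_branching FF_n_not_contained[of \<mu> \<kappa> n]
    by (subst sum.delta) (auto simp: horizontal_strip_iff part_antimono)
  finally show ?thesis .
qed

lemma pcoeff_pkill: "i \<notin> Poly_Mapping.keys m \<Longrightarrow> pcoeff (pkill i f) m = pcoeff f m"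
  by transfer simp

theorem pcoeff_FF_skew:
  assumes "Poly_Mapping.keys m \<subseteq> {..<n}"
  shows "pcoeff (FF_skew \<kappa> \<mu>) m = pcoeff (FF_n n \<kappa> \<mu>) m"
proof -
  let ?k = "LEAST n. Poly_Mapping.keys m \<subseteq> {..<n}"
  have k: "Poly_Mapping.keys m \<subseteq> {..<?k}" using assms by (rule LeastI)
  have "?k \<le> n" using assms by (rule Least_le)
  then have "pcoeff (FF_n n \<kappa> \<mu>) m = pcoeff (FF_n ?k \<kappa> \<mu>) m"
  proof (induction n rule: dec_induct)
    case (step n)
    then have "n \<notin> Poly_Mapping.keys m" using k by auto
    then show ?case using step pcoeff_pkill[of n m "FF_n (Suc n) \<kappa> \<mu>"] by (simp add: FF_n_stable del: FF_n.simps)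
  qed simp
  then show ?thesis by (simp add: FF_skew_def PSeries_inverse)
qed

text \<open>
  \<open>f = \<Sum>\<^sub>\<kappa> c\<^sub>\<kappa> F\<^sub>\<kappa>\<close> as a possibly infinite sum: each coefficient receives finitely many
  contributions.
\<close>
definition FF_expansion :: "series \<Rightarrow> (partition \<Rightarrow> Rq) \<Rightarrow> bool"
  where "FF_expansion f c \<longleftrightarrow> (\<forall>m.
    finite {\<kappa>. c \<kappa> * pcoeff (FF \<kappa>) m \<noteq> 0} \<and>
    pcoeff f m = (\<Sum>\<kappa> | c \<kappa> * pcoeff (FF \<kappa>) m \<noteq> 0. c \<kappa> * pcoeff (FF \<kappa>) m))"

definition struct_coeff :: "partition \<Rightarrow> partition \<Rightarrow> partition \<Rightarrow> Rq"
  where "struct_coeff \<mu> \<nu> = (THE c. FF_expansion (FF \<nu> * FF \<mu>) c)"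

definition Gamma_q :: "series set"
  where "Gamma_q = pseries.span (range FF)"

end

theory Submission
  imports Defs "HOL-Computational_Algebra.Formal_Power_Series"
begin

text \<open>
  Let \<open>T(x)\<close> be the operator with kernel \<open>F\<^bsub>\<kappa>/\<mu>\<^esub>(x)\<close> on functions of partitions, so that
  \<open>F\<^bsub>\<kappa>/\<mu>\<^esub>(x\<^sub>0, \<dots>, x\<^sub>n)\<close> is a matrix entry of \<open>T(x\<^sub>n) \<cdots> T(x\<^sub>0)\<close>.  With \<open>v = x / (1 - x)\<close> there is
  an explicit operator \<open>U(v)\<close>, which removes vertical strips, such that \<open>T(q x) = U(v) T(x)\<close>; its
  kernel is a product of local weights and a polynomial in \<open>v\<close> of degree at most the length of
  \<open>\<kappa>\<close>.  The operators \<open>U(v)\<close> commute by a Yang-Baxter argument, and the coefficients of \<open>T\<close> are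
  polynomials in those of \<open>U\<close>, so the operators \<open>T(x)\<close> commute and the functions are symmetric.

  Inserting a variable \<open>x\<close> into a symmetric series is a ring homomorphism that acts on
  the \<open>F\<^sub>\<kappa>\<close> by \<open>T(x)\<close>; the quotient of the insertions of \<open>q x\<close> and \<open>x\<close> is one that acts
  by \<open>U(v)\<close>.  The degree in \<open>x\<close> of the first detects the first part of \<open>\<kappa>\<close>, the degree in \<open>v\<close>
  of the second detects its length.  Both degrees are subadditive on products, which bounds both
  the first part and the length of the partitions occurring in \<open>F\<^sub>\<nu> F\<^sub>\<mu>\<close>.

  The coproduct splits the variables into two alphabets, hence is multiplicative, and is
  cocommutative by symmetry.
\<close>

section \<open>Row-by-row transfer sums\<close>

text \<open>The obstacle to finiteness is that no F has a top degree: in infinitely many variables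
  its monomials have unbounded degree, so the grading bounds the partitions in a product only from
  below. Two statistics independent of the degree are needed. The relation T(q x) = U(v) T(x) is
  useful because U(v) changes each row by at most one cell. Two layers of U then leave at most two
  intermediate values per row, and commutation becomes a two-dimensional check. At order
  \<open>v^k\<close> the operator T_k appears on both sides, with the factors \<open>q^k\<close> and
  1. Since q is not a root of unity, dividing by \<open>q^k - 1\<close> expresses T_k by the U_j and
  the T_i with i < k. Both degree bounds are attained: T_k with k the first part reaches the
  partition without its first row, and U_k with k the length reaches the one without its first
  column. These nonzero extreme entries isolate a single coefficient of an expansion that may still
  be infinite. T_k and U_k may be applied to such an expansion term by term, because they lower the
  size of a partition by at most k.\<close>

primrec transfer :: "(nat \<Rightarrow> nat \<Rightarrow> nat \<Rightarrow> 'a::comm_semiring_1) \<Rightarrow> (nat \<Rightarrow> nat) \<Rightarrow> nat \<Rightarrow> nat \<Rightarrow> 'a" where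
  "transfer \<phi> g 0 a = 1"
| "transfer \<phi> g (Suc r) a = (\<Sum>b\<le>g r. \<phi> r b a * transfer \<phi> g r b)"

text \<open>Row vectors without monotonicity, so that the rows can be summed independently; the
  values from \<open>N\<close> on are fixed to keep the set finite.\<close>

definition box :: "nat \<Rightarrow> (nat \<Rightarrow> nat) \<Rightarrow> (nat \<Rightarrow> nat) set"
  where "box N g = {h. (\<forall>r<N. h r \<le> g r) \<and> (\<forall>r\<ge>N. h r = 0)}"

lemma box_0: "box 0 g = {\<lambda>_. 0}"
  by (auto simp: box_def)

lemma box_Suc: "box (Suc N) g = (\<lambda>(b, h). h(N := b)) ` ({..g N} \<times> box N g)"
proof (intro equalityI subsetI)
  fix h assume h: "h \<in> box (Suc N) g"
  then have "h = (\<lambda>(b, h). h(N := b)) (h N, h(N := 0))" "(h N, h(N := 0)) \<in> {..g N} \<times> box N g"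
    by (auto simp: box_def)
  then show "h \<in> (\<lambda>(b, h). h(N := b)) ` ({..g N} \<times> box N g)" by (rule image_eqI)
qed (auto simp: box_def less_Suc_eq)

lemma inj_on_box: "inj_on (\<lambda>(b, h). h(N := b)) (A \<times> box N g)"
proof (rule inj_onI, clarify)
  fix b h b' h' assume H: "h \<in> box N g" "h' \<in> box N g" "h(N := b) = h'(N := b')"
  then have "b = b'" by (metis fun_upd_same)
  moreover have "h r = h' r" for r
    using H(1,2) fun_cong[OF H(3), of r] by (cases "r = N") (auto simp: box_def)
  ultimately show "b = b' \<and> h = h'" by auto
qed

lemma finite_box: "finite (box N g)"
  by (induction N) (auto simp: box_0 box_Suc)

text \<open>Distributivity, one row at a time: \<open>transfer \<phi> g N a\<close> is the partition
  function of the rows before \<open>N\<close> with boundary value \<open>a\<close> in row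
  \<open>N\<close>. The update \<open>h(N := a)\<close> supplies that value to the factor of row
  \<open>N - 1\<close>.\<close>

lemma sum_box_transfer:
  "(\<Sum>h\<in>box N g. \<Prod>r<N. \<phi> r (h r) ((h(N := a)) (Suc r))) = transfer \<phi> g N a"
proof (induction N arbitrary: a)
  case 0
  then show ?case by (simp add: box_0)
next
  case (Suc N)
  have "(\<Sum>h\<in>box (Suc N) g. \<Prod>r<Suc N. \<phi> r (h r) ((h(Suc N := a)) (Suc r)))
    = (\<Sum>(b, h)\<in>{..g N} \<times> box N g.
        \<Prod>r<Suc N. \<phi> r ((h(N := b)) r) ((h(N := b, Suc N := a)) (Suc r)))"
    unfolding box_Suc by (subst sum.reindex[OF inj_on_box]) (simp add: case_prod_unfold)
  also have "\<dots> = (\<Sum>(b, h)\<in>{..g N} \<times> box N g.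
        \<phi> N b a * (\<Prod>r<N. \<phi> r (h r) ((h(N := b)) (Suc r))))"
    by (intro sum.cong refl) (auto simp: mult.commute intro!: prod.cong)
  also have "\<dots> = (\<Sum>b\<le>g N. \<phi> N b a * transfer \<phi> g N b)"
    by (simp only: sum.cartesian_product[symmetric] sum_distrib_left[symmetric] Suc.IH)
  finally show ?case by (simp only: transfer.simps)
qed

section \<open>Lengths and sizes of partitions\<close>

lemma antimono_part: "antimono (part \<kappa>)"
  using part[of \<kappa>] by simp

lemma part_nonzero_initial: "\<exists>N. {i. part \<kappa> i \<noteq> 0} = {..<N}"
proof -
  have f: "finite {i. part \<kappa> i \<noteq> 0}" using part[of \<kappa>] by simp
  define N where "N = (LEAST i. part \<kappa> i = 0)"
  have ex: "\<exists>i. part \<kappa> i = 0" using f ex_new_if_finite[of "{i. part \<kappa> i \<noteq> 0}"] by auto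
  have "part \<kappa> N = 0" unfolding N_def using ex by (rule LeastI_ex)
  then have "part \<kappa> i = 0" if "N \<le> i" for i using part_antimono[OF that, of \<kappa>] by simp
  moreover have "part \<kappa> i \<noteq> 0" if "i < N" for i using not_less_Least that N_def by blast
  ultimately have "{i. part \<kappa> i \<noteq> 0} = {..<N}" by (metis (mono_tags) Collect_cong lessThan_def not_le)
  then show ?thesis ..
qed

lemma part_eq_0_iff: "part \<kappa> i = 0 \<longleftrightarrow> plength \<kappa> \<le> i"
proof -
  obtain N where N: "{i. part \<kappa> i \<noteq> 0} = {..<N}" using part_nonzero_initial by blast
  then have "plength \<kappa> = N" by (simp add: plength_def)
  then show ?thesis using N by (metis (mono_tags, lifting) lessThan_iff mem_Collect_eq not_le)
qed

lemma psize_eq_sum: "plength \<kappa> \<le> N \<Longrightarrow> psize \<kappa> = (\<Sum>i<N. part \<kappa> i)"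
  unfolding psize_def by (rule sum.mono_neutral_left) (auto simp: part_eq_0_iff)

lemma contained_plength: "\<mu> \<subseteq>\<^sub>p \<kappa> \<Longrightarrow> plength \<mu> \<le> plength \<kappa>"
  using part_eq_0_iff[of \<kappa> "plength \<kappa>"] part_eq_0_iff[of \<mu> "plength \<kappa>"]
  by (metis contained_iff le_refl le_zero_eq)

lemma contained_refl [simp]: "\<kappa> \<subseteq>\<^sub>p \<kappa>"
  by (simp add: contained_iff)

lemma contained_trans: "\<mu> \<subseteq>\<^sub>p \<nu> \<Longrightarrow> \<nu> \<subseteq>\<^sub>p \<kappa> \<Longrightarrow> \<mu> \<subseteq>\<^sub>p \<kappa>"
  by (auto simp: contained_def)

text \<open>Passes from partitions, whose rows constrain each other, to vectors with free rows. The
  hypothesis \<open>0\<close> says that the weights themselves enforce monotonicity.\<close>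

lemma sum_contained_eq_sum_box:
  assumes N: "plength \<kappa> \<le> N"
    and 0: "\<And>h. h \<in> box N (part \<kappa>) \<Longrightarrow> \<not> antimono h \<Longrightarrow> \<Phi> h = 0"
  shows "(\<Sum>\<nu> | \<nu> \<subseteq>\<^sub>p \<kappa>. \<Phi> (part \<nu>)) = (\<Sum>h\<in>box N (part \<kappa>). \<Phi> h)"
proof -
  have "(\<Sum>\<nu> | \<nu> \<subseteq>\<^sub>p \<kappa>. \<Phi> (part \<nu>)) = (\<Sum>h\<in>part ` {\<nu>. \<nu> \<subseteq>\<^sub>p \<kappa>}. \<Phi> h)"
    by (subst sum.reindex) (auto simp: inj_on_def part_inject)
  also have "\<dots> = (\<Sum>h\<in>box N (part \<kappa>). \<Phi> h)"
  proof (rule sum.mono_neutral_left[OF finite_box])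
    show "part ` {\<nu>. \<nu> \<subseteq>\<^sub>p \<kappa>} \<subseteq> box N (part \<kappa>)"
      using N by (auto simp: box_def contained_iff) (metis le_zero_eq order_trans part_eq_0_iff)
    show "\<forall>h\<in>box N (part \<kappa>) - part ` {\<nu>. \<nu> \<subseteq>\<^sub>p \<kappa>}. \<Phi> h = 0"
    proof
      fix h assume h: "h \<in> box N (part \<kappa>) - part ` {\<nu>. \<nu> \<subseteq>\<^sub>p \<kappa>}"
      have "\<not> antimono h"
      proof
        assume a: "antimono h"
        have hb: "\<forall>r<N. h r \<le> part \<kappa> r" "\<forall>r\<ge>N. h r = 0" using h by (simp_all add: box_def)
        have "i < N" if "h i \<noteq> 0" for i using hb(2) that by (rule_tac ccontr) simp
        then have "{i. h i \<noteq> 0} \<subseteq> {..<N}" by auto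
        then have "finite {i. h i \<noteq> 0}" by (rule finite_subset) simp
        then have p: "part (Partition h) = h" using a by (simp add: Partition_inverse)
        have "h i \<le> part \<kappa> i" for i using hb by (cases "i < N") simp_all
        then have "Partition h \<in> {\<nu>. \<nu> \<subseteq>\<^sub>p \<kappa>}" using p by (simp add: contained_iff)
        then have "part (Partition h) \<in> part ` {\<nu>. \<nu> \<subseteq>\<^sub>p \<kappa>}" by (rule imageI)
        then show False using h p by simp
      qed
      then show "\<Phi> h = 0" using h 0[of h] by simp
    qed
  qed
  finally show ?thesis .
qed

section \<open>Vertical strip operators\<close>

text \<open>
  Row \<open>r\<close> goes from \<open>l\<close> to \<open>n\<close> and row \<open>r + 1\<close> from \<open>l'\<close> to \<open>n'\<close>; each row loses at most one cell.
  Like the kernel of \<open>T(x)\<close>, the weights sum to \<open>1\<close> over \<open>n\<close>.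
\<close>
definition site_U :: "'a::comm_ring_1 \<Rightarrow> 'a \<Rightarrow> nat \<Rightarrow> nat \<Rightarrow> nat \<Rightarrow> nat \<Rightarrow> 'a"
  where "site_U q v l l' n n' =
    (if n' = l' then
       (if n = l then 1 + v * (1 - q ^ (l - l'))
        else if Suc n = l then - (v * (1 - q ^ (l - l'))) else 0)
     else if Suc n' = l' then (if n = l then 1 + v else if Suc n = l then - v else 0)
     else 0)"

definition ker_U :: "nat \<Rightarrow> 'a::comm_ring_1 \<Rightarrow> 'a \<Rightarrow> (nat \<Rightarrow> nat) \<Rightarrow> (nat \<Rightarrow> nat) \<Rightarrow> 'a"
  where "ker_U N q v g h = (\<Prod>r<N. site_U q v (g r) (g (Suc r)) (h r) (h (Suc r)))"

text \<open>Unless one of the first two cases applies, the third forces \<open>l = l'\<close> with a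
  cell lost in the upper row and none in the lower one, and there the weight carries the factor 1 -
  \<open>q^0\<close>. This is how the weights reject vectors that are not partitions.\<close>

lemma site_U_eq_0:
  assumes "n \<noteq> l \<and> Suc n \<noteq> l \<or> n' \<noteq> l' \<and> Suc n' \<noteq> l' \<or> n < n' \<and> l' \<le> l"
  shows "site_U q v l l' n n' = 0"
  using assms by (auto simp: site_U_def)

lemma not_antimonoD: "\<not> antimono (h :: nat \<Rightarrow> nat) \<Longrightarrow> \<exists>r. h r < h (Suc r)"
  by (auto simp: antimono_iff_le_Suc not_le)

lemma ker_U_not_antimono:
  assumes g: "antimono g" and h: "h \<in> box N g" "\<not> antimono h"
  shows "ker_U N q v g h = 0"
proof -
  obtain r where r: "h r < h (Suc r)" using not_antimonoD h(2) by blast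
  then have "Suc r < N" using h(1) by (auto simp: box_def) (metis leI not_less0)
  moreover have "g (Suc r) \<le> g r" using g by (simp add: antimono_iff_le_Suc)
  ultimately show ?thesis
    unfolding ker_U_def using r site_U_eq_0[of "h r" "g r" "h (Suc r)" "g (Suc r)" q v]
    by (intro prod_zero) (auto intro!: bexI[of _ r])
qed

lemma site_U_sum:
  assumes "\<And>b. b \<noteq> l \<Longrightarrow> Suc b \<noteq> l \<Longrightarrow> f b = (0 :: 'a::comm_ring_1)"
  shows "(\<Sum>b\<le>l. f b) = f l + (case l of 0 \<Rightarrow> 0 | Suc k \<Rightarrow> f k)"
proof (cases l)
  case (Suc k)
  have "(\<Sum>b\<le>l. f b) = (\<Sum>b\<in>{k, l}. f b)"
    using assms Suc by (intro sum.mono_neutral_right) auto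
  then show ?thesis using Suc by (simp add: add.commute)
qed simp


text \<open>
  The Yang-Baxter relation for two layers with parameters \<open>v\<close> and \<open>w\<close>: \<open>X\<close> and \<open>Y\<close> are the sums over
  the rows above, as functions of the intermediate row, for the two orders of the layers.  When the
  row loses one cell in total, there are two intermediate states and two linear relations.
\<close>
definition layers_rel :: "'a::comm_ring_1 \<Rightarrow> 'a \<Rightarrow> 'a \<Rightarrow> nat \<Rightarrow> nat \<Rightarrow> (nat \<Rightarrow> 'a) \<Rightarrow> (nat \<Rightarrow> 'a) \<Rightarrow> bool"
  where "layers_rel q v w l k X Y \<longleftrightarrow>
    (k = l \<longrightarrow> X l = Y l) \<and>
    (Suc k = l \<longrightarrow> X k + q * X l = Y k + q * Y l \<and>
      v * (1 + w) * X k + w * (1 + v) * X l = w * (1 + v) * Y k + v * (1 + w) * Y l) \<and>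
    (Suc (Suc k) = l \<longrightarrow> X (Suc k) = Y (Suc k))"

lemma site_U_simps:
  "site_U q v l l' l l' = 1 + v * (1 - q ^ (l - l'))"
  "site_U q v (Suc n) l' n l' = - (v * (1 - q ^ (Suc n - l')))"
  "site_U q v l (Suc a) l a = 1 + v"
  "site_U q v (Suc n) (Suc a) n a = - v"
  by (simp_all add: site_U_def)

text \<open>Adds one row to the commutation relation; the cases follow the number of cells that the
  two rows lose in both layers together. The relation propagates because every outgoing quantity is
  a combination of the incoming invariants with coefficients symmetric in \<open>v\<close> and
  \<open>w\<close>.\<close>

lemma layers_rel_step:
  fixes q v w :: "'a::comm_ring_1"
  assumes l: "l' \<le> l" and XY: "layers_rel q v w l k X Y"
  shows "layers_rel q v w l' k'
    (\<lambda>a. \<Sum>b\<le>l. site_U q v l l' b a * site_U q w b a k k' * X b)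
    (\<lambda>a. \<Sum>b\<le>l. site_U q w l l' b a * site_U q v b a k k' * Y b)"
proof -
  have S: "(\<Sum>b\<le>l. site_U q v l l' b a * site_U q w b a k k' * X b) =
      site_U q v l l' l a * site_U q w l a k k' * X l +
      (case l of 0 \<Rightarrow> 0 | Suc j \<Rightarrow> site_U q v l l' j a * site_U q w j a k k' * X j)" for a v w X
    by (rule site_U_sum) (simp add: site_U_eq_0)
  consider "k = l" | "l = Suc k" | "l = Suc (Suc k)" | "k \<noteq> l" "Suc k \<noteq> l" "Suc (Suc k) \<noteq> l"
    by blast
  then show ?thesis
  proof cases
    case 1
    then have H: "X l = Y l" using XY by (simp add: layers_rel_def)
    have S0: "(\<Sum>b\<le>l. site_U q v l l' b a * site_U q w b a k k' * X b) =
      site_U q v l l' l a * site_U q w l a l k' * X l" for a v w X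
      unfolding S unfolding 1 by (simp add: site_U_eq_0 split: nat.split)
    consider "k' = l'" | "l' = Suc k'" | "l' = Suc (Suc k')" | "k' \<noteq> l'" "Suc k' \<noteq> l'" "Suc (Suc k') \<noteq> l'"
      by blast
    then show ?thesis
    proof cases
      case 2
      then obtain n where n: "l = Suc n" "k' \<le> n" using l by (cases l) auto
      show ?thesis unfolding layers_rel_def S0 H unfolding 2
        by (simp add: site_U_simps n Suc_diff_le algebra_simps)
    next
      case 1
      show ?thesis unfolding layers_rel_def S0 H unfolding 1 by (simp add: site_U_simps algebra_simps)
    next
      case 3
      show ?thesis unfolding layers_rel_def S0 H unfolding 3 by (simp add: site_U_simps algebra_simps)
    qed (simp add: layers_rel_def)
  next
    case 2
    then have H: "X k + q * X (Suc k) = Y k + q * Y (Suc k)"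
      "v * (1 + w) * X k + w * (1 + v) * X (Suc k) = w * (1 + v) * Y k + v * (1 + w) * Y (Suc k)"
      using XY by (simp_all add: layers_rel_def)
    have S1: "(\<Sum>b\<le>l. site_U q v l l' b a * site_U q w b a k k' * X b) =
      site_U q v (Suc k) l' (Suc k) a * site_U q w (Suc k) a k k' * X (Suc k) +
      site_U q v (Suc k) l' k a * site_U q w k a k k' * X k" for a v w X
      unfolding S unfolding 2 by simp
    consider "k' = l'" | "l' = Suc k'" | "l' = Suc (Suc k')" | "k' \<noteq> l'" "Suc k' \<noteq> l'" "Suc (Suc k') \<noteq> l'"
      by blast
    then show ?thesis
    proof cases
      case 1
      show ?thesis
      \<comment> \<open>For \<open>l' = Suc k\<close> truncated subtraction gives
        \<open>k - l' = 0\<close>, and the exponent rule behind \<open>e\<close> fails. In that case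
        both sums vanish through the factor 1 - \<open>q^0\<close>.\<close>
      proof (cases "l' = Suc k")
        case True
        with 1 show ?thesis unfolding layers_rel_def S1 by (simp add: site_U_simps)
      next
        case False
        then have "q ^ (Suc k - l') = q * q ^ (k - l')" using l 2 by (simp add: Suc_diff_le)
        \<comment> \<open>The sum is a combination of the two invariants of
          \<open>layers_rel\<close>, with coefficients that involve \<open>v\<close> and
          \<open>w\<close> only through \<open>v * w\<close>. Hence the order of the layers does not
          matter.\<close>
        then have e: "site_U q v (Suc k) l' (Suc k) l' * site_U q w (Suc k) l' k l' * X (Suc k) +
            site_U q v (Suc k) l' k l' * site_U q w k l' k l' * X k =
          - (1 - q * q ^ (k - l')) * ((v * (1 + w) * X k + w * (1 + v) * X (Suc k)) -
            v * w * q ^ (k - l') * (X k + q * X (Suc k)))" for v w X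
          unfolding site_U_simps by (simp only:) (simp add: algebra_simps)
        show ?thesis unfolding layers_rel_def S1 unfolding 1
          by (intro conjI impI; (simp; fail)?) (simp add: e H mult.commute[of v w])
      qed
    next
      case 2
      then have k: "k' \<le> k" using l \<open>l = Suc k\<close> by simp
      define Q where "Q = q ^ (k - k')"
      have Q: "q ^ (Suc k - Suc k') = Q" "q ^ (Suc k - k') = q * Q" "q ^ (k - k') = Q"
        using k by (simp_all add: Q_def Suc_diff_le)
      have a: "site_U q v (Suc k) (Suc k') (Suc k) k' * site_U q w (Suc k) k' k k' * X (Suc k) +
          site_U q v (Suc k) (Suc k') k k' * site_U q w k k' k k' * X k =
        - ((1 + v) * w * (1 - q * Q) * X (Suc k) + v * (1 + w * (1 - Q)) * X k)" for v w X
        unfolding site_U_simps Q by (simp add: algebra_simps)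
      have b: "site_U q v (Suc k) (Suc k') (Suc k) (Suc k') * site_U q w (Suc k) (Suc k') k k' * X (Suc k) +
          site_U q v (Suc k) (Suc k') k (Suc k') * site_U q w k (Suc k') k k' * X k =
        - ((1 + v * (1 - Q)) * w * X (Suc k) + v * (1 - Q) * (1 + w) * X k)" for v w X
        unfolding site_U_simps Q by (simp add: algebra_simps)
      \<comment> \<open>\<open>i1\<close> and \<open>i2\<close> compute the two outgoing invariants.
        Both are combinations of the two incoming ones, and all four coefficients are symmetric in
        \<open>v\<close> and \<open>w\<close>; the hypotheses \<open>H\<close> then transfer the
        relation to the next row.\<close>
      have i1: "- ((1 + v) * w * (1 - q * Q) * x1 + v * (1 + w * (1 - Q)) * x0) +
          q * (- ((1 + v * (1 - Q)) * w * x1 + v * (1 - Q) * (1 + w) * x0)) =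
        - ((1 + q - q * Q) * (v * (1 + w) * x0 + w * (1 + v) * x1) - Q * (v * w) * (x0 + q * x1))"
        for v w x0 x1 :: 'a
        by (simp add: algebra_simps)
      have i2: "v * (1 + w) * (- ((1 + v) * w * (1 - q * Q) * x1 + v * (1 + w * (1 - Q)) * x0)) +
          w * (1 + v) * (- ((1 + v * (1 - Q)) * w * x1 + v * (1 - Q) * (1 + w) * x0)) =
        - ((v * (1 + w) + w * (1 + v) - Q * (v * w)) * (v * (1 + w) * x0 + w * (1 + v) * x1) -
           Q * (v * (1 + w) * (w * (1 + v))) * (x0 + q * x1))"
        for v w x0 x1 :: 'a
        by (simp add: algebra_simps)
      have i1': "- ((1 + v) * w * (1 - q * Q) * X (Suc k) + v * (1 + w * (1 - Q)) * X k) +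
          q * (- ((1 + v * (1 - Q)) * w * X (Suc k) + v * (1 - Q) * (1 + w) * X k)) =
        - ((1 + w) * v * (1 - q * Q) * Y (Suc k) + w * (1 + v * (1 - Q)) * Y k) +
          q * (- ((1 + w * (1 - Q)) * v * Y (Suc k) + w * (1 - Q) * (1 + v) * Y k))"
        unfolding i1 H by (simp add: mult.commute)
      have i2': "v * (1 + w) * (- ((1 + v) * w * (1 - q * Q) * X (Suc k) + v * (1 + w * (1 - Q)) * X k)) +
          w * (1 + v) * (- ((1 + v * (1 - Q)) * w * X (Suc k) + v * (1 - Q) * (1 + w) * X k)) =
        w * (1 + v) * (- ((1 + w) * v * (1 - q * Q) * Y (Suc k) + w * (1 + v * (1 - Q)) * Y k)) +
          v * (1 + w) * (- ((1 + w * (1 - Q)) * v * Y (Suc k) + w * (1 - Q) * (1 + v) * Y k))"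
        unfolding i2 H by (simp add: mult.commute add.commute)
      show ?thesis unfolding layers_rel_def S1 unfolding 2 a b using i1' i2' by simp
    next
      case 3
      have "(1 + v) * - w * X (Suc k) + - v * (1 + w) * X k = (1 + w) * - v * Y (Suc k) + - w * (1 + v) * Y k"
        using H(2) by (simp add: algebra_simps)
      then show ?thesis unfolding layers_rel_def S1 unfolding 3 by (simp add: site_U_simps)
    qed (simp add: layers_rel_def)
  next
    case 3
    then have H: "X (Suc k) = Y (Suc k)" using XY by (simp add: layers_rel_def)
    have S2: "(\<Sum>b\<le>l. site_U q v l l' b a * site_U q w b a k k' * X b) =
      site_U q v (Suc (Suc k)) l' (Suc k) a * site_U q w (Suc k) a k k' * X (Suc k)" for a v w X
      unfolding S unfolding 3 by (simp add: site_U_eq_0)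
    consider "k' = l'" | "l' = Suc k'" | "l' = Suc (Suc k')" | "k' \<noteq> l'" "Suc k' \<noteq> l'" "Suc (Suc k') \<noteq> l'"
      by blast
    then show ?thesis
    proof cases
      case 1
      show ?thesis unfolding layers_rel_def S2 H unfolding 1 by (simp add: site_U_simps algebra_simps)
    next
      case 2
      show ?thesis unfolding layers_rel_def S2 H unfolding 2 by (simp add: site_U_simps algebra_simps)
    next
      case 3
      show ?thesis unfolding layers_rel_def S2 H unfolding 3 by (simp add: site_U_simps algebra_simps)
    qed (simp add: layers_rel_def)
  next
    case 4
    have "site_U q v l l' b a * site_U q w b a k k' = 0" for a b v w
      using 4 by (metis mult_zero_left mult_zero_right site_U_eq_0)
    then have "site_U q v l l' b a * site_U q w b a k k' * X b = 0" for a b v w X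
      by (simp only: mult_zero_left)
    then show ?thesis unfolding layers_rel_def by (simp only: sum.neutral_const) simp
  qed
qed


lemma transfer_U_U:
  fixes q v w :: "'a::comm_ring_1"
  assumes g: "antimono g"
  shows "layers_rel q v w (g r) (m r)
    (transfer (\<lambda>r b a. site_U q v (g r) (g (Suc r)) b a * site_U q w b a (m r) (m (Suc r))) g r)
    (transfer (\<lambda>r b a. site_U q w (g r) (g (Suc r)) b a * site_U q v b a (m r) (m (Suc r))) g r)"
proof (induction r)
  case 0
  show ?case by (simp add: layers_rel_def algebra_simps)
next
  case (Suc r)
  have "g (Suc r) \<le> g r" using g by (simp add: antimono_iff_le_Suc)
  from layers_rel_step[OF this Suc.IH, of "m (Suc r)"] show ?case
    unfolding transfer.simps by simp
qed

text \<open>Row \<open>N\<close> of \<kappa> is empty. If row \<open>N\<close> of \<mu> is empty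
  too, the clause \<open>k = l\<close> of \<open>layers_rel\<close> at row \<open>N\<close> equates
  the full sums. Otherwise both sides agree trivially: the products are empty for
  \<open>N = 0\<close>, and for positive \<open>N\<close> the second kernel vanishes.\<close>

lemma ker_U_commute:
  fixes q v w :: "'a::comm_ring_1"
  assumes N: "plength \<kappa> \<le> N"
  shows "(\<Sum>\<nu> | \<nu> \<subseteq>\<^sub>p \<kappa>. ker_U N q v (part \<kappa>) (part \<nu>) * ker_U N q w (part \<nu>) (part \<mu>)) =
    (\<Sum>\<nu> | \<nu> \<subseteq>\<^sub>p \<kappa>. ker_U N q w (part \<kappa>) (part \<nu>) * ker_U N q v (part \<nu>) (part \<mu>))"
proof -
  let ?g = "part \<kappa>" and ?m = "part \<mu>"
  have *: "(\<Sum>\<nu> | \<nu> \<subseteq>\<^sub>p \<kappa>. ker_U N q v ?g (part \<nu>) * ker_U N q w (part \<nu>) ?m) =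
    transfer (\<lambda>r b a. site_U q v (?g r) (?g (Suc r)) b a * site_U q w b a (?m r) (?m (Suc r))) ?g N 0"
    for v w
  proof -
    have "(\<Sum>\<nu> | \<nu> \<subseteq>\<^sub>p \<kappa>. ker_U N q v ?g (part \<nu>) * ker_U N q w (part \<nu>) ?m) =
      (\<Sum>h\<in>box N ?g. ker_U N q v ?g h * ker_U N q w h ?m)"
      by (rule sum_contained_eq_sum_box[OF N]) (simp add: ker_U_not_antimono antimono_part)
    also have "\<dots> = (\<Sum>h\<in>box N ?g. \<Prod>r<N. site_U q v (?g r) (?g (Suc r)) (h r) ((h(N := 0)) (Suc r)) *
        site_U q w (h r) ((h(N := 0)) (Suc r)) (?m r) (?m (Suc r)))"
    proof (intro sum.cong refl)
      fix h assume "h \<in> box N ?g"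
      then have "h(N := 0) = h" by (auto simp: box_def)
      then show "ker_U N q v ?g h * ker_U N q w h ?m =
        (\<Prod>r<N. site_U q v (?g r) (?g (Suc r)) (h r) ((h(N := 0)) (Suc r)) *
          site_U q w (h r) ((h(N := 0)) (Suc r)) (?m r) (?m (Suc r)))"
        by (simp only: ker_U_def prod.distrib)
    qed
    finally show ?thesis
      by (simp only: sum_box_transfer[where \<phi> = "\<lambda>r b a. site_U q v (?g r) (?g (Suc r)) b a * site_U q w b a (?m r) (?m (Suc r))"])
  qed
  have g: "?g N = 0" using N by (simp add: part_eq_0_iff)
  show ?thesis
  proof (cases "?m N = 0")
    case True
    then show ?thesis unfolding *
      using transfer_U_U[OF antimono_part, of q v w \<kappa> N ?m] g by (simp add: layers_rel_def)
  next
    case False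
    show ?thesis
    proof (cases N)
      case 0
      then show ?thesis by (simp add: ker_U_def)
    next
      case (Suc r)
      have "ker_U N q v (part \<nu>) ?m = 0" if "\<nu> \<subseteq>\<^sub>p \<kappa>" for \<nu> v
      proof -
        have "part \<nu> N = 0" using that g by (metis contained_iff le_zero_eq)
        then have "site_U q v (part \<nu> r) (part \<nu> (Suc r)) (?m r) (?m (Suc r)) = 0"
          using False Suc by (simp add: site_U_eq_0)
        then show ?thesis unfolding ker_U_def Suc by (intro prod_zero) auto
      qed
      then show ?thesis by simp
    qed
  qed
qed

section \<open>Horizontal strip operators\<close>

text \<open>The Gaussian binomial coefficient for \<open>c \<le> n\<close>. Beyond that range
  truncated subtraction gives a junk value, which is still nonzero.\<close>

definition gauss :: "nat \<Rightarrow> nat \<Rightarrow> Rq"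
  where "gauss n c = qpoch q_ind q_ind n / (qpoch q_ind q_ind c * qpoch q_ind q_ind (n - c))"

lemma qpoch_Suc: "qpoch x q (Suc n) = (1 - x * q ^ n) * qpoch x q n"
  by (simp add: qpoch_def mult.commute)

lemma qpoch_0 [simp]: "qpoch x q 0 = 1"
  by (simp add: qpoch_def)

lemma qpoch_shift: "(1 - x) * qpoch (q * x) q n = qpoch x q (Suc n)"
proof -
  have "(\<Prod>i<Suc n. 1 - x * q ^ i) = (1 - x) * (\<Prod>i<n. 1 - q * x * q ^ i)"
    by (subst prod.lessThan_Suc_shift) (simp add: mult_ac)
  then show ?thesis by (simp add: qpoch_def)
qed

lemma gauss_nonzero: "gauss n c \<noteq> 0"
  using qpoch_q_nonzero by (simp add: gauss_def)

lemma gauss_0 [simp]: "gauss n 0 = 1" and gauss_self [simp]: "gauss n n = 1"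
  using qpoch_q_nonzero by (simp_all add: gauss_def)

lemma one_minus_q_power_nonzero: "1 - q_ind * q_ind ^ n \<noteq> 0"
  using qpoch_q_nonzero[of "Suc n"] by (simp add: qpoch_Suc)

lemma gauss_absorb: "(1 - q_ind ^ Suc n) * gauss n c = (1 - q_ind ^ Suc c) * gauss (Suc n) (Suc c)"
proof -
  note nz = qpoch_q_nonzero[of c] qpoch_q_nonzero[of "n - c"] one_minus_q_power_nonzero[of c]
  then show ?thesis by (simp add: gauss_def qpoch_Suc divide_simps)
qed

lemma gauss_pascal:
  assumes "Suc c \<le> n"
  shows "gauss (Suc n) (Suc c) = gauss n c + q_ind ^ Suc c * gauss n (Suc c)"
proof -
  obtain d where n: "n = Suc (c + d)" using assms by (metis add_Suc_shift le_Suc_ex add_Suc)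
  define A where "A = qpoch q_ind q_ind n"
  define C where "C = qpoch q_ind q_ind c"
  define D where "D = qpoch q_ind q_ind d"
  define x where "x = 1 - q_ind * q_ind ^ c"
  define y where "y = 1 - q_ind * q_ind ^ d"
  have nz: "C \<noteq> 0" "D \<noteq> 0" "x \<noteq> 0" "y \<noteq> 0"
    unfolding C_def D_def x_def y_def using qpoch_q_nonzero one_minus_q_power_nonzero by blast+
  have e: "gauss (Suc n) (Suc c) = (1 - q_ind * q_ind ^ n) * A / (x * C * (y * D))"
    "gauss n c = A / (C * (y * D))" "gauss n (Suc c) = A / (x * C * D)"
    unfolding gauss_def A_def C_def D_def x_def y_def using n by (simp_all add: qpoch_Suc)
  have "1 - q_ind * q_ind ^ n = x + q_ind ^ Suc c * y"
    unfolding x_def y_def n by (simp add: algebra_simps power_add)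
  then show ?thesis unfolding e using nz by (simp add: divide_simps) (simp add: algebra_simps)
qed

text \<open>Unlike \<open>site_U\<close>, the weight does not look at the next row of the smaller
  partition: interlacing is a condition on \<open>l\<close>, \<open>l'\<close> and \<open>m\<close>
  alone.\<close>

definition site_T :: "(Rq \<Rightarrow> 'a::comm_ring_1) \<Rightarrow> 'a \<Rightarrow> nat \<Rightarrow> nat \<Rightarrow> nat \<Rightarrow> 'a"
  where "site_T \<iota> x l l' m =
    (if l' \<le> m \<and> m \<le> l then x ^ (l - m) * qpoch x (\<iota> q_ind) (m - l') * \<iota> (gauss (l - l') (l - m)) else 0)"

definition ker_T :: "nat \<Rightarrow> (Rq \<Rightarrow> 'a::comm_ring_1) \<Rightarrow> 'a \<Rightarrow> (nat \<Rightarrow> nat) \<Rightarrow> (nat \<Rightarrow> nat) \<Rightarrow> 'a"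
  where "ker_T N \<iota> x g h = (\<Prod>r<N. site_T \<iota> x (g r) (g (Suc r)) (h r))"

text \<open>The same kernels are evaluated in several rings: scalars for the commutation of U, power
  series in v for the relation between U and T, and series in the variables for the functions
  themselves. The homomorphism transports identities of coefficients between them.\<close>

locale Rq_hom =
  fixes \<iota> :: "Rq \<Rightarrow> 'a::comm_ring_1"
  assumes hom_add: "\<iota> (a + b) = \<iota> a + \<iota> b"
    and hom_mult: "\<iota> (a * b) = \<iota> a * \<iota> b"
    and hom_one: "\<iota> 1 = 1"
begin

lemma hom_zero: "\<iota> 0 = 0"
  using hom_add[of 0 0] by simp

lemma hom_diff: "\<iota> (a - b) = \<iota> a - \<iota> b"
  using hom_add[of "a - b" b] by (simp add: algebra_simps)

lemma hom_power: "\<iota> (a ^ n) = \<iota> a ^ n"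
  by (induction n) (simp_all add: hom_mult hom_one)

lemma hom_sum: "\<iota> (sum f A) = (\<Sum>x\<in>A. \<iota> (f x))"
  by (induction A rule: infinite_finite_induct) (simp_all add: hom_add hom_zero)

abbreviation "q \<equiv> \<iota> q_ind"

text \<open>The next row keeps its length. The two possible intermediate rows involve different
  Gaussian binomials, which the absorption identity brings together; the common factor is the one
  that turns (x;q)_d into (q x;q)_d.\<close>

lemma site_U_site_T_same:
  assumes v: "(1 + v) * (1 - x) = 1"
  shows "(\<Sum>b\<le>l. site_U q v l l' b l' * site_T \<iota> x b l' m) = site_T \<iota> (q * x) l l' m"
proof -
  have v': "v = (1 + v) * x" using v by (simp add: algebra_simps)
  \<comment> \<open>From (1 - x) (q x;q)_d = (x;q)_(d+1), multiplied by 1 + v, together with (1 + v)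
    x = v.\<close>
  have shift: "qpoch (q * x) q d = (1 + v - v * q ^ d) * qpoch x q d" for d
  proof -
    have "qpoch (q * x) q d = (1 + v) * ((1 - x) * qpoch (q * x) q d)"
      using v by (simp add: mult.assoc[symmetric])
    also have "\<dots> = (1 + v) * (1 - x * q ^ d) * qpoch x q d"
      by (simp only: qpoch_shift qpoch_Suc mult.assoc)
    also have "(1 + v) * (1 - x * q ^ d) = 1 + v - ((1 + v) * x) * q ^ d" by (simp add: algebra_simps)
    finally show ?thesis by (simp only: v'[symmetric])
  qed
  have S: "(\<Sum>b\<le>l. site_U q v l l' b l' * site_T \<iota> x b l' m) =
      site_U q v l l' l l' * site_T \<iota> x l l' m +
      (case l of 0 \<Rightarrow> 0 | Suc j \<Rightarrow> site_U q v l l' j l' * site_T \<iota> x j l' m)"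
    by (rule site_U_sum) (simp add: site_U_eq_0)
  show ?thesis
  proof (cases "l' \<le> m \<and> m \<le> l")
    case False
    then show ?thesis unfolding S by (auto simp: site_T_def split: nat.split)
  next
    case True
    then obtain d c where d: "m = l' + d" and c: "l = l' + d + c"
      by (metis le_Suc_ex)
    show ?thesis
    proof (cases c)
      case 0
      have "(case l of 0 \<Rightarrow> 0 | Suc j \<Rightarrow> site_U q v l l' j l' * site_T \<iota> x j l' m) = 0"
        using 0 c d by (auto simp: site_T_def split: nat.split)
      then show ?thesis unfolding S using 0 c d
        by (simp add: site_T_def site_U_simps shift hom_one) (simp add: algebra_simps)
    next
      case (Suc e)
      let ?n = "d + e" and ?P = "qpoch x q d"
      have l: "l = Suc (l' + ?n)" using c Suc by simp
      have g: "(1 - q ^ Suc ?n) * \<iota> (gauss ?n e) = (1 - q ^ Suc e) * \<iota> (gauss (Suc ?n) (Suc e))"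
        using arg_cong[OF gauss_absorb[of ?n e], of \<iota>] by (simp only: hom_mult hom_diff hom_power hom_one)
      have "(\<Sum>b\<le>l. site_U q v l l' b l' * site_T \<iota> x b l' m) =
          (1 + v * (1 - q ^ Suc ?n)) * (x ^ Suc e * ?P * \<iota> (gauss (Suc ?n) (Suc e))) -
          v * x ^ e * ?P * ((1 - q ^ Suc ?n) * \<iota> (gauss ?n e))"
        unfolding S unfolding l d by (simp add: site_T_def site_U_simps Suc_diff_le algebra_simps)
      also have "\<dots> = (1 + v * (1 - q ^ Suc ?n)) * (x ^ Suc e * ?P * \<iota> (gauss (Suc ?n) (Suc e))) -
          ((1 + v) * x) * x ^ e * ?P * ((1 - q ^ Suc e) * \<iota> (gauss (Suc ?n) (Suc e)))"
        by (simp only: g v'[symmetric])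
      also have "\<dots> = q ^ Suc e * x ^ Suc e * \<iota> (gauss (Suc ?n) (Suc e)) * ((1 + v - v * q ^ d) * ?P)"
        by (simp add: algebra_simps power_add)
      also have "\<dots> = site_T \<iota> (q * x) l l' m"
        unfolding shift[symmetric] unfolding l d by (simp add: site_T_def Suc_diff_le power_mult_distrib)
      finally show ?thesis .
    qed
  qed
qed

text \<open>The next row has lost a cell. Now the q-Pascal rule merges the two Gaussian binomials,
  and the result is the same weight as without that loss.\<close>

lemma site_U_site_T_shifted:
  assumes v: "(1 + v) * (1 - x) = 1" and l: "Suc a \<le> l"
  shows "(\<Sum>b\<le>l. site_U q v l (Suc a) b a * site_T \<iota> x b a m) = site_T \<iota> (q * x) l (Suc a) m"
proof -
  have v': "v = (1 + v) * x" using v by (simp add: algebra_simps)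
  have shift: "(1 + v) * qpoch x q (Suc d) = qpoch (q * x) q d" for d
    using v by (simp add: qpoch_shift[symmetric] mult.assoc[symmetric])
  have S: "(\<Sum>b\<le>l. site_U q v l (Suc a) b a * site_T \<iota> x b a m) =
      site_U q v l (Suc a) l a * site_T \<iota> x l a m +
      (case l of 0 \<Rightarrow> 0 | Suc j \<Rightarrow> site_U q v l (Suc a) j a * site_T \<iota> x j a m)"
    by (rule site_U_sum) (simp add: site_U_eq_0)
  obtain j where j: "l = Suc j" "a \<le> j" using l by (cases l) auto
  consider "m < a \<or> l < m" | "m = a" | "Suc a \<le> m" "m = l" | "Suc a \<le> m" "m < l" by linarith
  then show ?thesis
  proof cases
    case 1
    then show ?thesis unfolding S using j by (auto simp: site_T_def)
  next
    case 2
    \<comment> \<open>Here \<open>m\<close> is below \<open>Suc a\<close>, so interlacing fails on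
      the right-hand side and the two terms on the left have to cancel.\<close>
    have "(1 + v) * x ^ (Suc j - a) - v * x ^ (j - a) = ((1 + v) * x - v) * x ^ (j - a)"
      using j by (simp add: Suc_diff_le algebra_simps)
    then have "(1 + v) * x ^ (Suc j - a) - v * x ^ (j - a) = 0" using v' by simp
    then show ?thesis unfolding S using 2 j by (simp add: site_T_def site_U_simps hom_one)
  next
    case 3
    then show ?thesis unfolding S using j
      by (simp add: site_T_def site_U_simps Suc_diff_le shift hom_one)
  next
    case 4
    define d where "d = m - Suc a"
    define e where "e = j - m"
    have m: "m = Suc (a + d)" and j': "j = Suc (a + d + e)" using 4 j by (simp_all add: d_def e_def)
    let ?n = "Suc (d + e)" and ?P = "qpoch x q (Suc d)"
    have "gauss (Suc ?n) (Suc e) = gauss ?n e + q_ind ^ Suc e * gauss ?n (Suc e)"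
      by (rule gauss_pascal) simp
    then have g: "\<iota> (gauss (Suc ?n) (Suc e)) - \<iota> (gauss ?n e) = q ^ Suc e * \<iota> (gauss ?n (Suc e))"
      by (simp only: hom_add hom_mult hom_power) simp
    have "(\<Sum>b\<le>l. site_U q v l (Suc a) b a * site_T \<iota> x b a m) =
        (1 + v) * (x ^ Suc e * ?P * \<iota> (gauss (Suc ?n) (Suc e))) - v * (x ^ e * ?P * \<iota> (gauss ?n e))"
      unfolding S unfolding j(1) j' m by (simp add: site_T_def site_U_simps Suc_diff_le)
    also have "\<dots> = (1 + v) * (x ^ Suc e * ?P * \<iota> (gauss (Suc ?n) (Suc e))) -
        ((1 + v) * x) * (x ^ e * ?P * \<iota> (gauss ?n e))"
      by (simp only: v'[symmetric])
    also have "\<dots> = x ^ Suc e * ((1 + v) * ?P) * (\<iota> (gauss (Suc ?n) (Suc e)) - \<iota> (gauss ?n e))"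
      by (simp add: algebra_simps)
    also have "\<dots> = site_T \<iota> (q * x) l (Suc a) m"
      unfolding shift g unfolding j(1) j' m by (simp add: site_T_def Suc_diff_le power_mult_distrib)
    finally show ?thesis .
  qed
qed

text \<open>The sum over an intermediate row has the same value for both admissible boundary values
  \<open>a\<close>, by the two preceding lemmas. It can therefore be pulled out row by row, and the
  transfer sum collapses to a product.\<close>

lemma transfer_U_T:
  assumes v: "(1 + v) * (1 - x) = 1" and g: "antimono g"
  shows "a = g r \<or> Suc a = g r \<Longrightarrow>
    transfer (\<lambda>r b a. site_U q v (g r) (g (Suc r)) b a * site_T \<iota> x b a (m r)) g r a =
    (\<Prod>s<r. site_T \<iota> (q * x) (g s) (g (Suc s)) (m s))"
proof (induction r arbitrary: a)
  case (Suc r)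
  let ?W = "\<lambda>b. site_U q v (g r) (g (Suc r)) b a * site_T \<iota> x b a (m r)"
  let ?P = "\<Prod>s<r. site_T \<iota> (q * x) (g s) (g (Suc s)) (m s)"
  have le: "g (Suc r) \<le> g r" using g by (simp add: antimono_iff_le_Suc)
  have "transfer (\<lambda>r b a. site_U q v (g r) (g (Suc r)) b a * site_T \<iota> x b a (m r)) g (Suc r) a =
      (\<Sum>b\<le>g r. ?W b * ?P)"
    unfolding transfer.simps
  proof (intro sum.cong refl)
    fix b
    show "?W b * transfer (\<lambda>r b a. site_U q v (g r) (g (Suc r)) b a * site_T \<iota> x b a (m r)) g r b = ?W b * ?P"
      using Suc.IH[of b] site_U_eq_0[of b "g r" a "g (Suc r)" q v]
      by (cases "b = g r \<or> Suc b = g r") auto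
  qed
  also have "\<dots> = (\<Sum>b\<le>g r. ?W b) * ?P" by (simp add: sum_distrib_right)
  also have "(\<Sum>b\<le>g r. ?W b) = site_T \<iota> (q * x) (g r) (g (Suc r)) (m r)"
  proof (cases "a = g (Suc r)")
    case True
    then show ?thesis using site_U_site_T_same[OF v, of "g r" a "m r"] by simp
  next
    case False
    then have a: "Suc a = g (Suc r)" using Suc.prems by simp
    then show ?thesis using site_U_site_T_shifted[OF v, of a "g r" "m r"] le by simp
  qed
  finally show ?case by (simp add: mult.commute)
qed simp

lemma ker_U_ker_T:
  assumes v: "(1 + v) * (1 - x) = 1" and N: "plength \<kappa> \<le> N"
  shows "(\<Sum>\<nu> | \<nu> \<subseteq>\<^sub>p \<kappa>. ker_U N q v (part \<kappa>) (part \<nu>) * ker_T N \<iota> x (part \<nu>) (part \<mu>)) =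
    ker_T N \<iota> (q * x) (part \<kappa>) (part \<mu>)"
proof -
  let ?g = "part \<kappa>" and ?m = "part \<mu>"
  have g: "?g N = 0" using N by (simp add: part_eq_0_iff)
  have "(\<Sum>\<nu> | \<nu> \<subseteq>\<^sub>p \<kappa>. ker_U N q v ?g (part \<nu>) * ker_T N \<iota> x (part \<nu>) ?m) =
    (\<Sum>h\<in>box N ?g. ker_U N q v ?g h * ker_T N \<iota> x h ?m)"
    by (rule sum_contained_eq_sum_box[OF N]) (simp add: ker_U_not_antimono antimono_part)
  also have "\<dots> = (\<Sum>h\<in>box N ?g. \<Prod>r<N. site_U q v (?g r) (?g (Suc r)) (h r) ((h(N := 0)) (Suc r)) *
      site_T \<iota> x (h r) ((h(N := 0)) (Suc r)) (?m r))"
  proof (intro sum.cong refl)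
    fix h assume "h \<in> box N ?g"
    then have "h(N := 0) = h" by (auto simp: box_def)
    then show "ker_U N q v ?g h * ker_T N \<iota> x h ?m =
      (\<Prod>r<N. site_U q v (?g r) (?g (Suc r)) (h r) ((h(N := 0)) (Suc r)) *
        site_T \<iota> x (h r) ((h(N := 0)) (Suc r)) (?m r))"
      by (simp only: ker_U_def ker_T_def prod.distrib)
  qed
  also have "\<dots> = transfer (\<lambda>r b a. site_U q v (?g r) (?g (Suc r)) b a * site_T \<iota> x b a (?m r)) ?g N 0"
    by (simp only: sum_box_transfer[where \<phi> = "\<lambda>r b a. site_U q v (?g r) (?g (Suc r)) b a * site_T \<iota> x b a (?m r)"])
  also have "\<dots> = ker_T N \<iota> (q * x) ?g ?m"
    using transfer_U_T[OF v antimono_part, of 0 \<kappa> N ?m] g by (simp add: ker_T_def)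
  finally show ?thesis .
qed

section \<open>Kernels as polynomials in x and v\<close>

definition peval :: "'a \<Rightarrow> Rq poly \<Rightarrow> 'a"
  where "peval x p = poly (map_poly \<iota> p) x"

lemma peval_one [simp]: "peval x 1 = 1"
  by (simp add: peval_def hom_one)

lemma peval_add: "peval x (p + r) = peval x p + peval x r"
proof -
  have "map_poly \<iota> (p + r) = map_poly \<iota> p + map_poly \<iota> r"
    by (rule poly_eqI) (simp add: coeff_map_poly hom_add hom_zero)
  then show ?thesis by (simp add: peval_def)
qed

lemma peval_mult: "peval x (p * r) = peval x p * peval x r"
proof -
  have "map_poly \<iota> (p * r) = map_poly \<iota> p * map_poly \<iota> r"
    by (rule poly_eqI) (simp add: coeff_map_poly coeff_mult hom_sum hom_mult hom_zero)
  then show ?thesis by (simp add: peval_def)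
qed

lemma peval_const [simp]: "peval x [:c:] = \<iota> c" and peval_X [simp]: "peval x [:0, 1:] = x"
  by (simp_all add: peval_def map_poly_pCons hom_zero hom_one)

lemma peval_diff: "peval x (p - r) = peval x p - peval x r"
  using peval_add[of x "p - r" r] by (simp add: algebra_simps)

lemma peval_zero [simp]: "peval x 0 = 0"
  by (simp add: peval_def hom_one)

lemma peval_uminus: "peval x (- p) = - peval x p"
  using peval_diff[of x 0 p] by simp

lemma peval_power: "peval x (p ^ n) = peval x p ^ n"
  by (induction n) (simp_all add: peval_mult)

lemma peval_prod: "peval x (prod f A) = (\<Prod>i\<in>A. peval x (f i))"
  by (induction A rule: infinite_finite_induct) (simp_all add: peval_mult)

lemma peval_eq_sum:
  assumes "degree p \<le> n"
  shows "peval x p = (\<Sum>i\<le>n. \<iota> (coeff p i) * x ^ i)"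
proof -
  have "degree (map_poly \<iota> p) \<le> n" using assms map_poly_degree_leq[of \<iota> p] by linarith
  then have "poly (map_poly \<iota> p) x = (\<Sum>i\<le>n. coeff (map_poly \<iota> p) i * x ^ i)"
    unfolding poly_altdef by (intro sum.mono_neutral_left) (auto simp: coeff_eq_0)
  then show ?thesis by (simp add: peval_def coeff_map_poly hom_zero)
qed

lemma peval_ker_T: "peval x (ker_T N (\<lambda>c. [:c:]) [:0, 1:] g h) = ker_T N \<iota> x g h"
  by (simp only: ker_T_def site_T_def qpoch_def peval_prod if_distrib[of "peval x"] peval_mult
      peval_power peval_diff peval_one peval_const peval_X peval_zero)

lemma peval_ker_U: "peval x (ker_U N [:q_ind:] [:0, 1:] g h) = ker_U N q x g h"
  by (simp only: ker_U_def site_U_def peval_prod if_distrib[of "peval x"] peval_mult peval_add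
      peval_uminus peval_power peval_diff peval_one peval_const peval_X peval_zero)

end

text \<open>The containment test catches a \<mu> longer than \<kappa>: the product over the rows of
  \<kappa> does not see the remaining rows of \<mu>.\<close>

definition T_poly :: "partition \<Rightarrow> partition \<Rightarrow> Rq poly"
  where "T_poly \<kappa> \<mu> = (if \<mu> \<subseteq>\<^sub>p \<kappa> then ker_T (plength \<kappa>) (\<lambda>c. [:c:]) [:0, 1:] (part \<kappa>) (part \<mu>) else 0)"

definition U_poly :: "partition \<Rightarrow> partition \<Rightarrow> Rq poly"
  where "U_poly \<kappa> \<mu> = (if \<mu> \<subseteq>\<^sub>p \<kappa> then ker_U (plength \<kappa>) [:q_ind:] [:0, 1:] (part \<kappa>) (part \<mu>) else 0)"

definition T_coeff :: "nat \<Rightarrow> partition \<Rightarrow> partition \<Rightarrow> Rq"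
  where "T_coeff k \<kappa> \<mu> = coeff (T_poly \<kappa> \<mu>) k"

definition U_coeff :: "nat \<Rightarrow> partition \<Rightarrow> partition \<Rightarrow> Rq"
  where "U_coeff k \<kappa> \<mu> = coeff (U_poly \<kappa> \<mu>) k"

lemma ker_T_extend:
  assumes "\<iota> 1 = 1" "\<mu> \<subseteq>\<^sub>p \<kappa>" "plength \<kappa> \<le> N"
  shows "ker_T N \<iota> x (part \<kappa>) (part \<mu>) = ker_T (plength \<kappa>) \<iota> x (part \<kappa>) (part \<mu>)"
proof -
  have "site_T \<iota> x (part \<kappa> r) (part \<kappa> (Suc r)) (part \<mu> r) = 1" if "plength \<kappa> \<le> r" for r
  proof -
    have "part \<kappa> r = 0" "part \<kappa> (Suc r) = 0" using that by (simp_all add: part_eq_0_iff)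
    moreover have "part \<mu> r = 0" using assms(2) \<open>part \<kappa> r = 0\<close> by (metis contained_iff le_zero_eq)
    ultimately show ?thesis using assms(1) by (simp add: site_T_def)
  qed
  then show ?thesis unfolding ker_T_def using assms(3)
    by (intro prod.mono_neutral_right) (auto simp: not_less)
qed

lemma ker_U_extend:
  assumes "\<mu> \<subseteq>\<^sub>p \<kappa>" "plength \<kappa> \<le> N"
  shows "ker_U N q v (part \<kappa>) (part \<mu>) = ker_U (plength \<kappa>) q v (part \<kappa>) (part \<mu>)"
proof -
  have "site_U q v (part \<kappa> r) (part \<kappa> (Suc r)) (part \<mu> r) (part \<mu> (Suc r)) = 1" if "plength \<kappa> \<le> r" for r
  proof -
    have "part \<kappa> r = 0" "part \<kappa> (Suc r) = 0" using that by (simp_all add: part_eq_0_iff)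
    moreover have "part \<mu> r = 0" "part \<mu> (Suc r) = 0"
      using assms(1) \<open>part \<kappa> r = 0\<close> \<open>part \<kappa> (Suc r) = 0\<close> by (metis contained_iff le_zero_eq)+
    ultimately show ?thesis by (simp add: site_U_def)
  qed
  then show ?thesis unfolding ker_U_def using assms(2)
    by (intro prod.mono_neutral_right) (auto simp: not_less)
qed

lemma ker_T_not_contained:
  assumes "\<not> \<mu> \<subseteq>\<^sub>p \<kappa>" "plength \<mu> \<le> N"
  shows "ker_T N \<iota> x (part \<kappa>) (part \<mu>) = 0"
proof -
  obtain r where r: "\<not> part \<mu> r \<le> part \<kappa> r" using assms(1) by (auto simp: contained_iff)
  then have "part \<mu> r \<noteq> 0" by simp
  then have "r < N" using assms(2) by (simp add: part_eq_0_iff)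
  then show ?thesis unfolding ker_T_def using r by (intro prod_zero) (auto simp: site_T_def)
qed

lemma ker_U_not_contained:
  assumes "\<not> \<mu> \<subseteq>\<^sub>p \<kappa>" "plength \<mu> \<le> N"
  shows "ker_U N q v (part \<kappa>) (part \<mu>) = 0"
proof -
  obtain r where r: "\<not> part \<mu> r \<le> part \<kappa> r" using assms(1) by (auto simp: contained_iff)
  then have "part \<mu> r \<noteq> 0" by simp
  then have "r < N" using assms(2) by (simp add: part_eq_0_iff)
  moreover have "site_U q v (part \<kappa> r) (part \<kappa> (Suc r)) (part \<mu> r) (part \<mu> (Suc r)) = 0"
    using r by (intro site_U_eq_0) auto
  ultimately show ?thesis unfolding ker_U_def by (intro prod_zero) auto
qed

lemma (in Rq_hom) peval_T_poly:
  assumes "plength \<kappa> \<le> N" "plength \<mu> \<le> N"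
  shows "peval x (T_poly \<kappa> \<mu>) = ker_T N \<iota> x (part \<kappa>) (part \<mu>)"
  using assms ker_T_extend[where \<iota> = \<iota>, OF hom_one, of \<mu> \<kappa> N x] ker_T_not_contained[of \<mu> \<kappa> N \<iota> x]
  by (cases "\<mu> \<subseteq>\<^sub>p \<kappa>") (simp_all add: T_poly_def peval_ker_T)

lemma (in Rq_hom) peval_U_poly:
  assumes "plength \<kappa> \<le> N" "plength \<mu> \<le> N"
  shows "peval x (U_poly \<kappa> \<mu>) = ker_U N q x (part \<kappa>) (part \<mu>)"
  using assms ker_U_extend[of \<mu> \<kappa> N q x] ker_U_not_contained[of \<mu> \<kappa> N q x]
  by (cases "\<mu> \<subseteq>\<^sub>p \<kappa>") (simp_all add: U_poly_def peval_ker_U)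

interpretation scalar: Rq_hom "\<lambda>c. c"
  by (rule Rq_hom.intro) (rule refl)+

interpretation fps: Rq_hom "fps_const"
  by (rule Rq_hom.intro) (simp_all only: fps_const_add fps_const_mult fps_const_1_eq_1)

lemma scalar_peval: "scalar.peval x p = poly p x"
  by (simp add: scalar.peval_def)

lemma U_poly_commute:
  "(\<Sum>\<nu> | \<nu> \<subseteq>\<^sub>p \<kappa>. poly (U_poly \<kappa> \<nu>) v * poly (U_poly \<nu> \<mu>) w) =
   (\<Sum>\<nu> | \<nu> \<subseteq>\<^sub>p \<kappa>. poly (U_poly \<kappa> \<nu>) w * poly (U_poly \<nu> \<mu>) v)"
proof -
  let ?N = "max (plength \<kappa>) (plength \<mu>)"
  have e: "poly (U_poly \<kappa> \<nu>) v * poly (U_poly \<nu> \<mu>) w =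
      ker_U ?N q_ind v (part \<kappa>) (part \<nu>) * ker_U ?N q_ind w (part \<nu>) (part \<mu>)" if "\<nu> \<subseteq>\<^sub>p \<kappa>" for \<nu> v w
  proof -
    have "plength \<nu> \<le> ?N" using contained_plength[OF that] by simp
    then show ?thesis
      using scalar.peval_U_poly[of \<kappa> ?N \<nu> v] scalar.peval_U_poly[of \<nu> ?N \<mu> w]
      by (simp add: scalar_peval)
  qed
  show ?thesis using ker_U_commute[of \<kappa> ?N q_ind v w \<mu>] by (simp add: e)
qed

text \<open>Over the infinite field \<open>Rq\<close> a polynomial is determined by its values, so
  the commutation at all v and w can be compared coefficientwise, first in v and then in w.\<close>

lemma U_coeff_commute:
  "(\<Sum>\<nu> | \<nu> \<subseteq>\<^sub>p \<kappa>. U_coeff j \<kappa> \<nu> * U_coeff k \<nu> \<mu>) = (\<Sum>\<nu> | \<nu> \<subseteq>\<^sub>p \<kappa>. U_coeff k \<kappa> \<nu> * U_coeff j \<nu> \<mu>)"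
proof -
  have 1: "(\<Sum>\<nu> | \<nu> \<subseteq>\<^sub>p \<kappa>. U_coeff j \<kappa> \<nu> * poly (U_poly \<nu> \<mu>) w) =
      (\<Sum>\<nu> | \<nu> \<subseteq>\<^sub>p \<kappa>. poly (U_poly \<kappa> \<nu>) w * U_coeff j \<nu> \<mu>)" for w
  proof -
    let ?P = "\<Sum>\<nu> | \<nu> \<subseteq>\<^sub>p \<kappa>. smult (poly (U_poly \<nu> \<mu>) w) (U_poly \<kappa> \<nu>)"
    let ?R = "\<Sum>\<nu> | \<nu> \<subseteq>\<^sub>p \<kappa>. smult (poly (U_poly \<kappa> \<nu>) w) (U_poly \<nu> \<mu>)"
    have "poly ?P v = poly ?R v" for v
      using U_poly_commute[of \<kappa> v \<mu> w] by (simp add: poly_sum mult.commute)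
    then have "poly ?P = poly ?R" by (rule ext)
    then have "coeff ?P j = coeff ?R j" by (simp only: poly_eq_poly_eq_iff)
    then show ?thesis by (simp add: coeff_sum U_coeff_def mult.commute)
  qed
  let ?P = "\<Sum>\<nu> | \<nu> \<subseteq>\<^sub>p \<kappa>. smult (U_coeff j \<kappa> \<nu>) (U_poly \<nu> \<mu>)"
  let ?R = "\<Sum>\<nu> | \<nu> \<subseteq>\<^sub>p \<kappa>. smult (U_coeff j \<nu> \<mu>) (U_poly \<kappa> \<nu>)"
  have "poly ?P w = poly ?R w" for w using 1[of w] by (simp add: poly_sum mult.commute)
  then have "poly ?P = poly ?R" by (rule ext)
  then have "coeff ?P k = coeff ?R k" by (simp only: poly_eq_poly_eq_iff)
  then show ?thesis by (simp add: coeff_sum U_coeff_def mult.commute)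
qed

text \<open>The series \<open>v / (1 + v)\<close>, which inverts \<open>v = x / (1 - x)\<close>.\<close>
definition x_of_v :: "Rq fps"
  where "x_of_v = fps_X * inverse (1 + fps_X)"

text \<open>The matrix that rewrites power series in x as power series in v. By
  \<open>sub_coeff_eq_0\<close> and \<open>sub_coeff_self\<close> it is unitriangular.\<close>

definition sub_coeff :: "nat \<Rightarrow> nat \<Rightarrow> Rq"
  where "sub_coeff k i = fps_nth (x_of_v ^ i) k"

lemma x_of_v: "(1 + fps_X) * (1 - x_of_v) = 1"
proof -
  have "fps_nth (1 + fps_X :: Rq fps) 0 \<noteq> 0" by simp
  then have "(1 + fps_X) * inverse (1 + fps_X :: Rq fps) = 1" by (simp add: inverse_mult_eq_1')
  then have "(1 + fps_X) * x_of_v = fps_X" unfolding x_of_v_def by (simp add: mult.left_commute)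
  then show ?thesis by (simp add: right_diff_distrib)
qed

lemma sub_coeff_eq_0: "k < i \<Longrightarrow> sub_coeff k i = 0"
  unfolding sub_coeff_def x_of_v_def power_mult_distrib by (simp add: fps_X_power_mult_nth)

lemma sub_coeff_self: "sub_coeff k k = 1"
proof -
  have "fps_nth (inverse (1 + fps_X :: Rq fps)) 0 = 1" by simp
  then show ?thesis
    unfolding sub_coeff_def x_of_v_def power_mult_distrib by (simp add: fps_X_power_mult_nth fps_power_zeroth)
qed

lemma sub_coeff_add: "(\<Sum>j\<le>k. sub_coeff j i * sub_coeff (k - j) i') = sub_coeff k (i + i')"
  by (simp add: sub_coeff_def power_add fps_mult_nth atLeast0AtMost)

lemma fps_nth_peval:
  "fps_nth (fps.peval (fps_const c * x_of_v) p) k = (\<Sum>i\<le>k. c ^ i * sub_coeff k i * coeff p i)"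
proof -
  let ?n = "max k (degree p)"
  have "fps_nth (fps.peval (fps_const c * x_of_v) p) k =
      (\<Sum>i\<le>?n. fps_nth (fps_const (coeff p i) * (fps_const c * x_of_v) ^ i) k)"
    by (subst fps.peval_eq_sum[of p ?n]) (simp_all add: fps_sum_nth)
  also have "\<dots> = (\<Sum>i\<le>?n. c ^ i * sub_coeff k i * coeff p i)"
    by (intro sum.cong refl) (simp add: power_mult_distrib fps_const_power sub_coeff_def mult_ac)
  also have "\<dots> = (\<Sum>i\<le>k. c ^ i * sub_coeff k i * coeff p i)"
    by (intro sum.mono_neutral_right) (auto simp: sub_coeff_eq_0)
  finally show ?thesis .
qed

lemma fps_nth_peval_X: "fps_nth (fps.peval fps_X p) k = coeff p k"
proof -
  let ?n = "max k (degree p)"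
  have "fps_nth (fps.peval fps_X p) k = (\<Sum>i\<le>?n. fps_nth (fps_const (coeff p i) * fps_X ^ i) k)"
    by (subst fps.peval_eq_sum[of p ?n]) (simp_all add: fps_sum_nth)
  also have "\<dots> = (\<Sum>i\<le>?n. if k = i then coeff p i else 0)"
    by (intro sum.cong refl) (simp add: fps_X_power_nth)
  also have "\<dots> = coeff p k" by simp
  finally show ?thesis .
qed

lemma sum_swap3: "(\<Sum>j\<in>J. \<Sum>i\<in>I j. \<Sum>\<nu>\<in>A. g j i \<nu>) = (\<Sum>\<nu>\<in>A. \<Sum>j\<in>J. \<Sum>i\<in>I j. g j i \<nu>)"
  (is "?L = ?R")
proof -
  have "?L = (\<Sum>j\<in>J. \<Sum>\<nu>\<in>A. \<Sum>i\<in>I j. g j i \<nu>)" by (intro sum.cong refl sum.swap)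
  also have "\<dots> = ?R" by (rule sum.swap)
  finally show ?thesis .
qed

text \<open>The order \<open>v^k\<close> of T(q x) = U(v) T(x). Taking v as the free variable keeps
  U polynomial in it, and the condition (1 + v) (1 - x) = 1 is met in formal power series by
  \<open>x_of_v\<close>.\<close>

lemma U_T_coeff:
  "(\<Sum>j\<le>k. \<Sum>i\<le>k - j. sub_coeff (k - j) i * (\<Sum>\<nu> | \<nu> \<subseteq>\<^sub>p \<kappa>. U_coeff j \<kappa> \<nu> * T_coeff i \<nu> \<mu>)) =
   (\<Sum>i\<le>k. q_ind ^ i * sub_coeff k i * T_coeff i \<kappa> \<mu>)"
proof -
  let ?N = "max (plength \<kappa>) (plength \<mu>)"
  have "(\<Sum>\<nu> | \<nu> \<subseteq>\<^sub>p \<kappa>. fps.peval fps_X (U_poly \<kappa> \<nu>) * fps.peval x_of_v (T_poly \<nu> \<mu>)) =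
    (\<Sum>\<nu> | \<nu> \<subseteq>\<^sub>p \<kappa>. ker_U ?N (fps_const q_ind) fps_X (part \<kappa>) (part \<nu>) *
      ker_T ?N fps_const x_of_v (part \<nu>) (part \<mu>))"
  proof (intro sum.cong refl)
    fix \<nu> assume "\<nu> \<in> {\<nu>. \<nu> \<subseteq>\<^sub>p \<kappa>}"
    then have "plength \<nu> \<le> ?N" using contained_plength[of \<nu> \<kappa>] by simp
    then show "fps.peval fps_X (U_poly \<kappa> \<nu>) * fps.peval x_of_v (T_poly \<nu> \<mu>) =
      ker_U ?N (fps_const q_ind) fps_X (part \<kappa>) (part \<nu>) * ker_T ?N fps_const x_of_v (part \<nu>) (part \<mu>)"
      by (simp add: fps.peval_U_poly[of _ ?N] fps.peval_T_poly[of _ ?N])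
  qed
  also have "\<dots> = ker_T ?N fps_const (fps_const q_ind * x_of_v) (part \<kappa>) (part \<mu>)"
    by (rule fps.ker_U_ker_T[OF x_of_v]) simp
  also have "\<dots> = fps.peval (fps_const q_ind * x_of_v) (T_poly \<kappa> \<mu>)"
    by (simp add: fps.peval_T_poly[of _ ?N])
  \<comment> \<open>The factor \<open>fps_const 1\<close> brings both sides to the form of
    \<open>fps_nth_peval\<close>, with constants 1 and q.\<close>
  finally have "fps_nth (\<Sum>\<nu> | \<nu> \<subseteq>\<^sub>p \<kappa>. fps.peval fps_X (U_poly \<kappa> \<nu>) * fps.peval (fps_const 1 * x_of_v) (T_poly \<nu> \<mu>)) k =
    fps_nth (fps.peval (fps_const q_ind * x_of_v) (T_poly \<kappa> \<mu>)) k" by simp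
  then have "(\<Sum>\<nu> | \<nu> \<subseteq>\<^sub>p \<kappa>. \<Sum>j\<le>k. U_coeff j \<kappa> \<nu> * (\<Sum>i\<le>k - j. sub_coeff (k - j) i * T_coeff i \<nu> \<mu>)) =
    (\<Sum>i\<le>k. q_ind ^ i * sub_coeff k i * T_coeff i \<kappa> \<mu>)"
    unfolding fps_sum_nth fps_mult_nth fps_nth_peval fps_nth_peval_X
    by (simp add: T_coeff_def U_coeff_def atLeast0AtMost)
  then show ?thesis
    by (simp only: sum_distrib_left sum_swap3) (simp only: mult_ac)
qed

section \<open>Commuting operators on functions of partitions\<close>

definition kop :: "(partition \<Rightarrow> partition \<Rightarrow> Rq) \<Rightarrow> (partition \<Rightarrow> Rq) \<Rightarrow> partition \<Rightarrow> Rq"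
  where "kop K f \<kappa> = (\<Sum>\<mu> | \<mu> \<subseteq>\<^sub>p \<kappa>. K \<kappa> \<mu> * f \<mu>)"

definition triangular :: "(partition \<Rightarrow> partition \<Rightarrow> Rq) \<Rightarrow> bool"
  where "triangular K \<longleftrightarrow> (\<forall>\<kappa> \<mu>. \<not> \<mu> \<subseteq>\<^sub>p \<kappa> \<longrightarrow> K \<kappa> \<mu> = 0)"

text \<open>Triangularity lets the inner sum run over everything inside \<kappa> instead of inside
  \<nu>; with independent ranges the two sums can be exchanged.\<close>

lemma kop_kop:
  assumes "triangular L"
  shows "kop K (kop L f) \<kappa> = (\<Sum>\<mu> | \<mu> \<subseteq>\<^sub>p \<kappa>. (\<Sum>\<nu> | \<nu> \<subseteq>\<^sub>p \<kappa>. K \<kappa> \<nu> * L \<nu> \<mu>) * f \<mu>)"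
proof -
  have L: "kop L f \<nu> = (\<Sum>\<mu> | \<mu> \<subseteq>\<^sub>p \<kappa>. L \<nu> \<mu> * f \<mu>)" if "\<nu> \<subseteq>\<^sub>p \<kappa>" for \<nu>
    unfolding kop_def using that contained_trans assms
    by (intro sum.mono_neutral_left finite_contained) (auto simp: triangular_def)
  have "kop K (kop L f) \<kappa> = (\<Sum>\<nu> | \<nu> \<subseteq>\<^sub>p \<kappa>. K \<kappa> \<nu> * (\<Sum>\<mu> | \<mu> \<subseteq>\<^sub>p \<kappa>. L \<nu> \<mu> * f \<mu>))"
    unfolding kop_def[of K] by (intro sum.cong refl) (simp add: L)
  also have "\<dots> = (\<Sum>\<nu> | \<nu> \<subseteq>\<^sub>p \<kappa>. \<Sum>\<mu> | \<mu> \<subseteq>\<^sub>p \<kappa>. K \<kappa> \<nu> * L \<nu> \<mu> * f \<mu>)"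
    by (simp add: sum_distrib_left mult.assoc)
  also have "\<dots> = (\<Sum>\<mu> | \<mu> \<subseteq>\<^sub>p \<kappa>. (\<Sum>\<nu> | \<nu> \<subseteq>\<^sub>p \<kappa>. K \<kappa> \<nu> * L \<nu> \<mu>) * f \<mu>)"
    by (subst sum.swap) (simp add: sum_distrib_right)
  finally show ?thesis .
qed

lemma kop_sum: "kop K (\<lambda>\<mu>. \<Sum>i\<in>I. c i * f i \<mu>) \<kappa> = (\<Sum>i\<in>I. c i * kop K (f i) \<kappa>)"
proof -
  have "kop K (\<lambda>\<mu>. \<Sum>i\<in>I. c i * f i \<mu>) \<kappa> = (\<Sum>\<mu> | \<mu> \<subseteq>\<^sub>p \<kappa>. \<Sum>i\<in>I. c i * (K \<kappa> \<mu> * f i \<mu>))"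
    by (simp add: kop_def sum_distrib_left mult_ac)
  also have "\<dots> = (\<Sum>i\<in>I. c i * kop K (f i) \<kappa>)"
    by (subst sum.swap) (simp add: kop_def sum_distrib_left)
  finally show ?thesis .
qed

abbreviation "Top k \<equiv> kop (T_coeff k)"
abbreviation "Uop k \<equiv> kop (U_coeff k)"

lemma triangular_T [simp]: "triangular (T_coeff k)" and triangular_U [simp]: "triangular (U_coeff k)"
  by (simp_all add: triangular_def T_coeff_def U_coeff_def T_poly_def U_poly_def)

lemma Uop_commute: "Uop j (Uop k f) = Uop k (Uop j f)"
  by (rule ext) (simp add: kop_kop U_coeff_commute)

lemma Uop_Top:
  "(\<Sum>j\<le>k. \<Sum>i\<le>k - j. sub_coeff (k - j) i * Uop j (Top i f) \<kappa>) =
   (\<Sum>i\<le>k. q_ind ^ i * sub_coeff k i * Top i f \<kappa>)"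
proof -
  have "(\<Sum>j\<le>k. \<Sum>i\<le>k - j. sub_coeff (k - j) i * Uop j (Top i f) \<kappa>) =
    (\<Sum>j\<le>k. \<Sum>i\<le>k - j. \<Sum>\<mu> | \<mu> \<subseteq>\<^sub>p \<kappa>. sub_coeff (k - j) i *
      (\<Sum>\<nu> | \<nu> \<subseteq>\<^sub>p \<kappa>. U_coeff j \<kappa> \<nu> * T_coeff i \<nu> \<mu>) * f \<mu>)"
    unfolding kop_kop[OF triangular_T]
    by (intro sum.cong refl) (subst sum_distrib_left, simp only: mult.assoc)
  also have "\<dots> = (\<Sum>\<mu> | \<mu> \<subseteq>\<^sub>p \<kappa>. (\<Sum>j\<le>k. \<Sum>i\<le>k - j. sub_coeff (k - j) i *
      (\<Sum>\<nu> | \<nu> \<subseteq>\<^sub>p \<kappa>. U_coeff j \<kappa> \<nu> * T_coeff i \<nu> \<mu>)) * f \<mu>)"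
    by (simp only: sum_swap3 sum_distrib_right)
  also have "\<dots> = (\<Sum>i\<le>k. q_ind ^ i * sub_coeff k i * Top i f \<kappa>)"
    unfolding U_T_coeff unfolding kop_def sum_distrib_left sum_distrib_right
    by (subst sum.swap) (simp add: mult.assoc)
  finally show ?thesis .
qed


section \<open>Constant coefficients and the recursion for T\<close>

lemma U_coeff_0: "U_coeff 0 \<kappa> \<mu> = (if \<mu> = \<kappa> then 1 else 0)"
proof -
  let ?N = "max (plength \<kappa>) (plength \<mu>)"
  have s: "site_U q_ind 0 l l' n n' = (if n = l \<and> (n' = l' \<or> Suc n' = l') then 1 else 0)" for l l' n n'
    by (simp add: site_U_def)
  have "U_coeff 0 \<kappa> \<mu> = poly (U_poly \<kappa> \<mu>) 0" by (simp add: U_coeff_def poly_0_coeff_0)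
  also have "\<dots> = ker_U ?N q_ind 0 (part \<kappa>) (part \<mu>)"
    using scalar.peval_U_poly[of \<kappa> ?N \<mu> 0] by (simp add: scalar_peval)
  also have "\<dots> = (if \<mu> = \<kappa> then 1 else 0)"
  proof (cases "\<mu> = \<kappa>")
    case False
    then obtain r where r: "part \<mu> r \<noteq> part \<kappa> r" by (metis ext part_inject)
    then have "r < ?N" using part_eq_0_iff[of \<mu> r] part_eq_0_iff[of \<kappa> r] by (metis max.bounded_iff not_less)
    then show ?thesis unfolding ker_U_def s using r False by (auto intro!: prod_zero)
  qed (simp add: ker_U_def s)
  finally show ?thesis .
qed

lemma T_coeff_0: "T_coeff 0 \<kappa> \<mu> = (if \<mu> = \<kappa> then 1 else 0)"
proof -
  let ?N = "max (plength \<kappa>) (plength \<mu>)"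
  have "qpoch 0 q_ind n = 1" for n by (simp add: qpoch_def)
  then have s: "site_T (\<lambda>c. c) 0 l l' m = (if l' \<le> m \<and> m = l then 1 else 0)" for l l' m
    by (auto simp: site_T_def power_0_left)
  have "T_coeff 0 \<kappa> \<mu> = poly (T_poly \<kappa> \<mu>) 0" by (simp add: T_coeff_def poly_0_coeff_0)
  also have "\<dots> = ker_T ?N (\<lambda>c. c) 0 (part \<kappa>) (part \<mu>)"
    using scalar.peval_T_poly[of \<kappa> ?N \<mu> 0] by (simp add: scalar_peval)
  also have "\<dots> = (if \<mu> = \<kappa> then 1 else 0)"
  proof (cases "\<mu> = \<kappa>")
    case True
    then show ?thesis by (simp add: ker_T_def s part_antimono)
  next
    case False
    then obtain r where r: "part \<mu> r \<noteq> part \<kappa> r" by (metis ext part_inject)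
    then have "r < ?N" using part_eq_0_iff[of \<mu> r] part_eq_0_iff[of \<kappa> r] by (metis max.bounded_iff not_less)
    then show ?thesis unfolding ker_T_def s using r False by (auto intro!: prod_zero)
  qed
  finally show ?thesis .
qed

lemma Uop_0 [simp]: "Uop 0 f = f" and Top_0 [simp]: "Top 0 f = f"
  by (rule ext; simp add: kop_def U_coeff_0 T_coeff_0 finite_contained if_distrib[of "\<lambda>c. c * _"] cong: if_cong)+

lemma kop_diff: "kop K (\<lambda>\<mu>. f \<mu> - g \<mu>) \<kappa> = kop K f \<kappa> - kop K g \<kappa>"
  by (simp add: kop_def right_diff_distrib sum_subtractf)

lemma kop_scale: "kop K (\<lambda>\<mu>. c * f \<mu>) \<kappa> = c * kop K f \<kappa>"
  by (simp add: kop_def sum_distrib_left mult_ac)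

lemma kop_sum1: "kop K (\<lambda>\<mu>. \<Sum>i\<in>I. f i \<mu>) \<kappa> = (\<Sum>i\<in>I. kop K (f i) \<kappa>)"
  using kop_sum[where c = "\<lambda>_. 1"] by simp

lemma q_power_neq_1: "0 < k \<Longrightarrow> q_ind ^ k - 1 \<noteq> 0"
  using one_minus_q_power_nonzero[of "k - 1"] by (cases k) auto

text \<open>The term \<open>j = 0\<close> of \<open>Uop_Top\<close> is T(x) itself, since U(0) is
  the identity; moving it across leaves the factors \<open>q^i - 1\<close>. On the right all T_i
  have i < k, because \<open>j\<close> is at least 1 in the double sum.\<close>

lemma Top_recursion:
  assumes "0 < k"
  shows "(q_ind ^ k - 1) * Top k f \<kappa> =
    (\<Sum>j=1..k. \<Sum>i\<le>k - j. sub_coeff (k - j) i * Uop j (Top i f) \<kappa>) -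
    (\<Sum>i<k. (q_ind ^ i - 1) * sub_coeff k i * Top i f \<kappa>)"
proof -
  have "(\<Sum>j\<le>k. \<Sum>i\<le>k - j. sub_coeff (k - j) i * Uop j (Top i f) \<kappa>) =
    (\<Sum>i\<le>k. sub_coeff k i * Top i f \<kappa>) +
    (\<Sum>j=1..k. \<Sum>i\<le>k - j. sub_coeff (k - j) i * Uop j (Top i f) \<kappa>)"
    unfolding atLeast0AtMost[symmetric] by (subst sum.atLeast_Suc_atMost) simp_all
  then have "(\<Sum>j=1..k. \<Sum>i\<le>k - j. sub_coeff (k - j) i * Uop j (Top i f) \<kappa>) =
    (\<Sum>i\<le>k. q_ind ^ i * sub_coeff k i * Top i f \<kappa>) - (\<Sum>i\<le>k. sub_coeff k i * Top i f \<kappa>)"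
    using Uop_Top[of k f \<kappa>] by (simp add: algebra_simps)
  also have "\<dots> = (\<Sum>i\<le>k. (q_ind ^ i - 1) * sub_coeff k i * Top i f \<kappa>)"
    by (simp add: sum_subtractf[symmetric] left_diff_distrib)
  also have "\<dots> = (\<Sum>i<k. (q_ind ^ i - 1) * sub_coeff k i * Top i f \<kappa>) + (q_ind ^ k - 1) * Top k f \<kappa>"
    by (simp add: lessThan_Suc_atMost[symmetric] sub_coeff_self)
  finally show ?thesis by simp
qed

text \<open>By the recursion T_k lies in the algebra generated by the U_j, so whatever commutes with
  these commutes with T_k. It is used twice: first with a U for \<open>B\<close>, then with a
  T.\<close>

lemma kop_Top_commute:
  assumes B: "\<And>j f. kop B (Uop j f) = Uop j (kop B f)"
  shows "kop B (Top k f) = Top k (kop B f)"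
proof (induction k rule: less_induct)
  case (less k)
  show ?case
  proof (cases "k = 0")
    case False
    then have k: "0 < k" by simp
    show ?thesis
    proof
      fix \<kappa>
      let ?R = "\<lambda>f \<kappa>. (\<Sum>j=1..k. \<Sum>i\<le>k - j. sub_coeff (k - j) i * Uop j (Top i f) \<kappa>) -
        (\<Sum>i<k. (q_ind ^ i - 1) * sub_coeff k i * Top i f \<kappa>)"
      have "(q_ind ^ k - 1) * kop B (Top k f) \<kappa> = kop B (\<lambda>\<kappa>. (q_ind ^ k - 1) * Top k f \<kappa>) \<kappa>"
        by (simp only: kop_scale)
      also have "\<dots> = kop B (?R f) \<kappa>" using Top_recursion[OF k, of f] by presburger
      also have "\<dots> = (\<Sum>j=1..k. \<Sum>i\<le>k - j. sub_coeff (k - j) i * kop B (Uop j (Top i f)) \<kappa>) -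
          (\<Sum>i<k. (q_ind ^ i - 1) * sub_coeff k i * kop B (Top i f) \<kappa>)"
        by (simp only: kop_diff kop_sum1 kop_scale)
      also have "\<dots> = ?R (kop B f) \<kappa>"
        by (intro arg_cong2[where f = minus] sum.cong refl) (use k in \<open>auto simp: B less.IH\<close>)
      also have "\<dots> = (q_ind ^ k - 1) * Top k (kop B f) \<kappa>" using Top_recursion[OF k] by simp
      finally show "kop B (Top k f) \<kappa> = Top k (kop B f) \<kappa>" using q_power_neq_1[OF k] by simp
    qed
  qed simp
qed

lemma Uop_Top_commute: "Uop j (Top k f) = Top k (Uop j f)"
  by (rule kop_Top_commute) (rule Uop_commute)

lemma Top_commute: "Top j (Top k f) = Top k (Top j f)"
  by (rule kop_Top_commute) (rule Uop_Top_commute[symmetric])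

section \<open>Support of the strip operators\<close>

text \<open>Splits off the exact power of x. The other factor has nonzero constant term by
  \<open>prod_qpoch_coeff_0\<close> and bounded degree by \<open>degree_prod_qpoch\<close>, which
  locates both ends of the polynomial.\<close>

lemma T_poly_factor:
  assumes "\<mu> \<prec>\<^sub>h \<kappa>"
  shows "T_poly \<kappa> \<mu> = monom 1 (psize \<kappa> - psize \<mu>) *
    (\<Prod>r<plength \<kappa>. qpoch [:0, 1:] [:q_ind:] (part \<mu> r - part \<kappa> (Suc r)) *
      [:gauss (part \<kappa> r - part \<kappa> (Suc r)) (part \<kappa> r - part \<mu> r):])"
proof -
  let ?N = "plength \<kappa>"
  have s: "part \<kappa> (Suc r) \<le> part \<mu> r" "part \<mu> r \<le> part \<kappa> r" for r
    using assms by (auto simp: horizontal_strip_iff)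
  then have c: "\<mu> \<subseteq>\<^sub>p \<kappa>" by (simp add: contained_iff)
  have "psize \<kappa> - psize \<mu> = (\<Sum>r<?N. part \<kappa> r - part \<mu> r)"
    using s contained_plength[OF c] by (simp add: psize_eq_sum[of _ ?N] sum_subtractf_nat)
  then have "monom 1 (psize \<kappa> - psize \<mu>) = (\<Prod>r<?N. [:0, 1 :: Rq:] ^ (part \<kappa> r - part \<mu> r))"
    by (simp only: monom_altdef smult_1_left power_sum)
  then show ?thesis using s c
    by (simp only: T_poly_def ker_T_def site_T_def prod.distrib if_True simp_thms mult.assoc)
qed

lemma prod_qpoch_coeff_0:
  "coeff (\<Prod>r<N::nat. qpoch [:0, 1:] [:q_ind:] (a r) * [:gauss (b r) (c r):]) 0 \<noteq> 0"
proof -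
  have "poly (qpoch [:0, 1:] [:q_ind:] n) 0 = 1" for n by (simp add: qpoch_def poly_prod)
  then have "poly (\<Prod>r<N. qpoch [:0, 1:] [:q_ind:] (a r) * [:gauss (b r) (c r):]) 0 = (\<Prod>r<N. gauss (b r) (c r))"
    by (simp only: poly_prod poly_mult) simp
  moreover have "(\<Prod>r<N. gauss (b r) (c r)) \<noteq> 0" by (induction N) (simp_all add: gauss_nonzero)
  ultimately show ?thesis unfolding poly_0_coeff_0[symmetric] by argo
qed

lemma degree_prod_qpoch:
  "degree (\<Prod>r<N::nat. qpoch [:0, 1:] [:q_ind:] (a r) * [:gauss (b r) (c r):]) \<le> (\<Sum>r<N. a r)"
proof -
  have "degree ([:0, 1:] * [:q_ind:] ^ i) \<le> 1" for i
    using degree_mult_le[of "[:0, 1:]" "[:q_ind:] ^ i"] degree_power_le[of "[:q_ind:]" i] by simp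
  then have "degree (1 - [:0, 1:] * [:q_ind:] ^ i) \<le> 1" for i
    by (intro degree_diff_le) simp_all
  then have "sum (degree \<circ> (\<lambda>i. 1 - [:0, 1:] * [:q_ind:] ^ i)) {..<n} \<le> (\<Sum>i<n. 1)" for n
    by (intro sum_mono) (simp only: o_def)
  then have 1: "degree (qpoch [:0, 1:] [:q_ind:] n) \<le> n" for n
    unfolding qpoch_def by (intro order_trans[OF degree_prod_sum_le]) simp_all
  have "degree (qpoch [:0, 1:] [:q_ind:] (a r) * [:gauss (b r) (c r):]) \<le> a r" for r
    using degree_mult_le[of "qpoch [:0, 1:] [:q_ind:] (a r)" "[:gauss (b r) (c r):]"] 1[of "a r"] by simp
  then show ?thesis
    by (intro order_trans[OF degree_prod_sum_le[OF finite_lessThan]] sum_mono) (simp only: o_def)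
qed

lemma T_coeff_not_strip: "\<not> \<mu> \<prec>\<^sub>h \<kappa> \<Longrightarrow> T_coeff k \<kappa> \<mu> = 0"
proof (cases "\<mu> \<subseteq>\<^sub>p \<kappa>")
  case True
  assume "\<not> \<mu> \<prec>\<^sub>h \<kappa>"
  then obtain r where r: "part \<mu> r < part \<kappa> (Suc r)"
    using True by (metis horizontal_strip_iff contained_iff not_le)
  then have "part \<kappa> (Suc r) \<noteq> 0" by simp
  then have "r < plength \<kappa>" by (simp add: part_eq_0_iff)
  moreover have "site_T (\<lambda>c. [:c:]) [:0, 1:] (part \<kappa> r) (part \<kappa> (Suc r)) (part \<mu> r) = 0"
    using r by (simp add: site_T_def)
  ultimately have "ker_T (plength \<kappa>) (\<lambda>c. [:c:]) [:0, 1:] (part \<kappa>) (part \<mu>) = 0"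
    unfolding ker_T_def by (intro prod_zero) auto
  then show ?thesis by (simp add: T_coeff_def T_poly_def)
qed (simp add: T_coeff_def T_poly_def)

lemma T_coeff_nonzeroD:
  assumes "T_coeff k \<kappa> \<mu> \<noteq> 0"
  shows "\<mu> \<prec>\<^sub>h \<kappa>" "psize \<kappa> \<le> psize \<mu> + k" "k \<le> part \<kappa> 0"
proof -
  let ?N = "plength \<kappa>" and ?D = "psize \<kappa> - psize \<mu>"
  let ?R = "\<Prod>r<?N. qpoch [:0, 1:] [:q_ind:] (part \<mu> r - part \<kappa> (Suc r)) *
      [:gauss (part \<kappa> r - part \<kappa> (Suc r)) (part \<kappa> r - part \<mu> r):]"
  show h: "\<mu> \<prec>\<^sub>h \<kappa>" using assms T_coeff_not_strip by blast
  then have s: "part \<kappa> (Suc r) \<le> part \<mu> r" "part \<mu> r \<le> part \<kappa> r" for r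
    by (auto simp: horizontal_strip_iff)
  then have c: "\<mu> \<subseteq>\<^sub>p \<kappa>" by (simp add: contained_iff)
  have k: "T_coeff k \<kappa> \<mu> = (if k < ?D then 0 else coeff ?R (k - ?D))"
    unfolding T_coeff_def T_poly_factor[OF h] by (simp only: coeff_monom_mult) simp
  then have D: "?D \<le> k" using assms by (meson not_le)
  then show "psize \<kappa> \<le> psize \<mu> + k" by simp
  have "coeff ?R (k - ?D) \<noteq> 0" using k D assms by simp
  then have "k - ?D \<le> degree ?R" by (rule le_degree)
  also have "\<dots> \<le> (\<Sum>r<?N. part \<mu> r - part \<kappa> (Suc r))" by (rule degree_prod_qpoch)
  finally have "k \<le> ?D + (\<Sum>r<?N. part \<mu> r - part \<kappa> (Suc r))" by simp
  also have "?D = (\<Sum>r<?N. part \<kappa> r - part \<mu> r)"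
    using s contained_plength[OF c] by (simp add: psize_eq_sum[of _ ?N] sum_subtractf_nat)
  \<comment> \<open>Removed cells and Pochhammer lengths add up row by row to the differences of
    consecutive parts of \<kappa>, which telescope to the first part.\<close>
  also have "\<dots> + (\<Sum>r<?N. part \<mu> r - part \<kappa> (Suc r)) = (\<Sum>r<?N. part \<kappa> r - part \<kappa> (Suc r))"
    unfolding sum.distrib[symmetric] using s by (intro sum.cong refl) (simp add: diff_add_inverse add.commute)
  also have "\<dots> = part \<kappa> 0"
  proof -
    have "(\<Sum>r<n. part \<kappa> r - part \<kappa> (Suc r)) + part \<kappa> n = part \<kappa> 0" for n
    proof (induction n)
      case (Suc n)
      then show ?case using part_antimono[of n "Suc n" \<kappa>] by simp
    qed simp
    from this[of ?N] show ?thesis using part_eq_0_iff[of \<kappa> ?N] by simp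
  qed
  finally show "k \<le> part \<kappa> 0" .
qed

lemma T_coeff_lowest: "\<mu> \<prec>\<^sub>h \<kappa> \<Longrightarrow> T_coeff (psize \<kappa> - psize \<mu>) \<kappa> \<mu> \<noteq> 0"
  unfolding T_coeff_def T_poly_factor using prod_qpoch_coeff_0
  by (simp only: coeff_monom_mult) simp

text \<open>Each row that loses a cell contributes a factor v, which bounds \<open>k\<close> below
  by the number of lost cells. Each row has degree at most 1 in v, which bounds \<open>k\<close>
  above by the number of rows.\<close>

lemma U_coeff_nonzeroD:
  assumes "U_coeff k \<kappa> \<mu> \<noteq> 0"
  shows "\<mu> \<subseteq>\<^sub>p \<kappa>" "\<And>r. part \<mu> r = part \<kappa> r \<or> Suc (part \<mu> r) = part \<kappa> r"
    "psize \<kappa> \<le> psize \<mu> + k" "k \<le> plength \<kappa>"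
proof -
  let ?N = "plength \<kappa>"
  let ?S = "\<lambda>r. site_U [:q_ind:] [:0, 1:] (part \<kappa> r) (part \<kappa> (Suc r)) (part \<mu> r) (part \<mu> (Suc r))"
  show c: "\<mu> \<subseteq>\<^sub>p \<kappa>" using assms triangular_U by (auto simp: triangular_def)
  have U: "U_poly \<kappa> \<mu> = (\<Prod>r<?N. ?S r)" using c by (simp add: U_poly_def ker_U_def)
  then have nz: "(\<Prod>r<?N. ?S r) \<noteq> 0" using assms by (metis U_coeff_def coeff_0)
  have p: "part \<mu> r = part \<kappa> r \<or> Suc (part \<mu> r) = part \<kappa> r" for r
  proof (cases "r < ?N")
    case True
    then have "(\<Prod>r<?N. ?S r) = 0" if "?S r = 0" using that by (intro prod_zero) auto
    then have "?S r \<noteq> 0" using nz by blast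
    then show ?thesis
      using site_U_eq_0[of "part \<mu> r" "part \<kappa> r" "part \<mu> (Suc r)" "part \<kappa> (Suc r)" "[:q_ind:]" "[:0, 1:]"]
      by argo
  next
    case False
    then have "part \<kappa> r = 0" by (simp add: part_eq_0_iff)
    then show ?thesis using c by (metis contained_iff le_zero_eq)
  qed
  then show "\<And>r. part \<mu> r = part \<kappa> r \<or> Suc (part \<mu> r) = part \<kappa> r" .
  have dvd: "[:0, 1:] ^ (part \<kappa> r - part \<mu> r) dvd ?S r" for r
  proof (cases "part \<mu> r = part \<kappa> r")
    case False
    then have "part \<kappa> r = Suc (part \<mu> r)" using p[of r] by simp
    then show ?thesis by (auto simp: site_U_def simp del: mult_pCons_left minus_pCons)
  qed simp
  have "psize \<kappa> - psize \<mu> = (\<Sum>r<?N. part \<kappa> r - part \<mu> r)"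
    using c contained_plength[OF c] by (simp add: psize_eq_sum[of _ ?N] sum_subtractf_nat contained_iff)
  then have "[:0, 1:] ^ (psize \<kappa> - psize \<mu>) dvd U_poly \<kappa> \<mu>"
    unfolding U by (simp only: power_sum) (intro prod_dvd_prod dvd)
  then have "monom 1 (psize \<kappa> - psize \<mu>) dvd U_poly \<kappa> \<mu>" by (simp add: monom_altdef)
  then obtain R where R: "U_poly \<kappa> \<mu> = monom 1 (psize \<kappa> - psize \<mu>) * R" by (rule dvdE)
  have "psize \<kappa> - psize \<mu> \<le> k"
    using assms unfolding U_coeff_def R coeff_monom_mult by (meson not_le)
  then show "psize \<kappa> \<le> psize \<mu> + k" by simp
  have "degree (?S r) \<le> 1" for r
  proof -
    have 1: "degree ([:0, 1:] * (1 - [:q_ind:] ^ n)) \<le> 1" for n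
      using degree_mult_le[of "[:0, 1:]" "1 - [:q_ind:] ^ n"] degree_power_le[of "[:q_ind:]" n]
        degree_diff_le[of 1 0 "[:q_ind:] ^ n"] by simp
    then have "degree (1 + [:0, 1:] * (1 - [:q_ind:] ^ n)) \<le> 1" for n by (intro degree_add_le) simp_all
    moreover have "degree (1 + [:0, 1 :: Rq:]) \<le> 1" by (intro degree_add_le) simp_all
    ultimately show ?thesis using 1 by (auto simp: site_U_def simp del: mult_pCons_left)
  qed
  then have "degree (U_poly \<kappa> \<mu>) \<le> (\<Sum>r<?N. 1)"
    unfolding U by (intro order_trans[OF degree_prod_sum_le[OF finite_lessThan]] sum_mono) (simp only: o_def)
  moreover have "k \<le> degree (U_poly \<kappa> \<mu>)" using assms unfolding U_coeff_def by (rule le_degree)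
  ultimately show "k \<le> plength \<kappa>" by simp
qed

text \<open>All rows lose a cell, so each contributes a nonzero multiple of v: -v while the next row
  is nonempty, and -v (1 - \<open>q^l\<close>) in the last row, of length l. The upper bound in
  \<open>U_coeff_nonzeroD\<close> is thus attained.\<close>

lemma U_coeff_first_column:
  assumes "\<And>r. part \<mu> r = part \<kappa> r - 1"
  shows "U_coeff (plength \<kappa>) \<kappa> \<mu> \<noteq> 0"
proof -
  let ?N = "plength \<kappa>"
  let ?S = "\<lambda>r. site_U [:q_ind:] [:0, 1:] (part \<kappa> r) (part \<kappa> (Suc r)) (part \<mu> r) (part \<mu> (Suc r))"
  have c: "\<mu> \<subseteq>\<^sub>p \<kappa>" using assms by (simp add: contained_iff)
  have "\<exists>d. d \<noteq> 0 \<and> ?S r = monom d 1" if "r < ?N" for r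
  proof -
    have "part \<kappa> r \<noteq> 0" using that by (simp add: part_eq_0_iff)
    then obtain j where j: "part \<kappa> r = Suc j" "part \<mu> r = j" using assms by (cases "part \<kappa> r") auto
    show ?thesis
    proof (cases "part \<kappa> (Suc r)")
      case 0
      have "?S r = - ([:0, 1:] * (1 - [:q_ind:] ^ Suc j))"
        using j 0 assms by (simp add: site_U_def)
      also have "\<dots> = monom (q_ind ^ Suc j - 1) 1"
        by (simp add: monom_altdef poly_const_pow one_pCons)
      finally show ?thesis using q_power_neq_1[of "Suc j"] by blast
    next
      case (Suc i)
      then have "?S r = - [:0, 1:]" using j assms by (simp add: site_U_def)
      then have "?S r = monom (- 1) 1" by (simp add: monom_altdef)
      then show ?thesis by (metis neg_equal_0_iff_equal one_neq_zero)
    qed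
  qed
  then obtain d where d: "\<And>r. r < ?N \<Longrightarrow> d r \<noteq> 0 \<and> ?S r = monom (d r) 1" by metis
  have "U_poly \<kappa> \<mu> = (\<Prod>r<?N. monom (d r) 1)" using c d by (simp add: U_poly_def ker_U_def)
  also have "\<dots> = monom (\<Prod>r<n. d r) n" if "n = ?N" for n
  proof -
    have "(\<Prod>r<n. monom (d r) 1) = monom (\<Prod>r<n. d r) n" for n
      by (induction n) (simp_all add: mult_monom mult.commute)
    then show ?thesis using that by simp
  qed
  finally show ?thesis using d by (simp add: U_coeff_def)
qed

section \<open>Coefficients of the inhomogeneous q-Whittaker functions\<close>

lemma pscale_mult_left: "pscale c f * g = pscale c (f * g)"
  for f g :: "('m::fin_decomp, 'k::comm_ring_1) pseries"
  by (rule pseries_eqI) (simp add: pcoeff_mult sum_distrib_left case_prod_unfold mult.assoc)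

lemma pscale_mult_right: "f * pscale c g = pscale c (f * g)"
  for f g :: "('m::fin_decomp, 'k::comm_ring_1) pseries"
  by (metis mult.commute pscale_mult_left)

lemma pconst_mult: "pconst c * f = pscale c f"
  by (simp add: pconst_def pscale_mult_left)

interpretation series: Rq_hom "pconst :: Rq \<Rightarrow> series"
proof (rule Rq_hom.intro)
  show "pconst (a + b) = pconst a + (pconst b :: series)" for a b
    by (rule pseries_eqI) (simp add: pconst_def distrib_right)
  show "pconst (a * b) = pconst a * (pconst b :: series)" for a b
    unfolding pconst_mult by (rule pseries_eqI) (simp add: pconst_def mult.assoc)
qed (rule pconst_one)

text \<open>Links the given one-variable formula to the kernel of T(x): its quotient of q-Pochhammer
  symbols is a Gaussian binomial because (l - l') - (l - m) = m - l' under interlacing.\<close>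

lemma FF_one_eq_peval: "FF_one \<kappa> \<mu> x = series.peval x (T_poly \<kappa> \<mu>)"
proof (cases "\<mu> \<prec>\<^sub>h \<kappa>")
  case True
  let ?N = "plength \<kappa>"
  have s: "part \<kappa> (Suc r) \<le> part \<mu> r" "part \<mu> r \<le> part \<kappa> r" for r
    using True by (auto simp: horizontal_strip_iff)
  have g: "gauss (part \<kappa> r - part \<kappa> (Suc r)) (part \<kappa> r - part \<mu> r) =
      qpoch q_ind q_ind (part \<kappa> r - part \<kappa> (Suc r)) /
      (qpoch q_ind q_ind (part \<kappa> r - part \<mu> r) * qpoch q_ind q_ind (part \<mu> r - part \<kappa> (Suc r)))" for r
  proof -
    have "part \<kappa> r - part \<kappa> (Suc r) - (part \<kappa> r - part \<mu> r) = part \<mu> r - part \<kappa> (Suc r)"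
      using s[of r] by linarith
    then show ?thesis by (simp only: gauss_def)
  qed
  have X: "series.peval x (monom 1 n) = x ^ n" for n
    by (simp only: monom_altdef smult_1_left series.peval_power series.peval_X)
  have Q: "series.peval x (qpoch [:0, 1:] [:q_ind:] n) = qpoch x (pconst q_ind) n" for n
    by (simp only: qpoch_def series.peval_prod series.peval_diff series.peval_one series.peval_mult
        series.peval_power series.peval_X series.peval_const)
  show ?thesis unfolding T_poly_factor[OF True] FF_one_def
    using True by (simp only: series.peval_mult series.peval_prod X Q series.peval_const g if_True)
next
  case False
  then have "T_poly \<kappa> \<mu> = 0"
    using T_coeff_not_strip[OF False] by (intro poly_eqI) (simp add: T_coeff_def)
  then show ?thesis using False by (simp add: FF_one_def)
qed

section \<open>Monomial coefficients as matrix entries of operator products\<close>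

lemma pcoeff_pvar_power: "pcoeff (pvar n ^ i :: ('v \<Rightarrow>\<^sub>0 nat, 'k::comm_ring_1) pseries) m =
    (if m = Poly_Mapping.single n i then 1 else 0)"
proof (induction i arbitrary: m)
  case 0
  then show ?case by (simp add: pcoeff_one)
next
  case (Suc i)
  have v: "pcoeff (pvar n :: ('v \<Rightarrow>\<^sub>0 nat, 'k) pseries) m = (if m = Poly_Mapping.single n 1 then 1 else 0)" for m
    by transfer simp
  have "pcoeff (pvar n ^ Suc i :: ('v \<Rightarrow>\<^sub>0 nat, 'k) pseries) m = (\<Sum>(a, b) | a + b = m.
      (if a = Poly_Mapping.single n 1 then 1 else 0) * (if b = Poly_Mapping.single n i then 1 else 0))"
    by (simp add: pcoeff_mult v Suc.IH)
  also have "\<dots> = (\<Sum>(a, b)\<in>{(a, b). a + b = m} \<inter> {(Poly_Mapping.single n 1, Poly_Mapping.single n i)}. 1)"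
    by (intro sum.mono_neutral_cong_right) (auto simp: finite_decomp split: if_splits)
  also have "\<dots> = (if m = Poly_Mapping.single n (Suc i) then 1 else 0)"
    by (auto simp: single_add[symmetric])
  finally show ?case .
qed

text \<open>The condition \<open>pkill n f = f\<close> says that \<open>f\<close> does not involve
  variable \<open>n\<close>, so its exponent can only come from the power.\<close>

lemma pcoeff_mult_pvar_power:
  fixes f :: "('v \<Rightarrow>\<^sub>0 nat, 'k::comm_ring_1) pseries"
  assumes "pkill n f = f" "Poly_Mapping.lookup m n = 0"
  shows "pcoeff (f * pvar n ^ i) (m + Poly_Mapping.single n k) = (if i = k then pcoeff f m else 0)"
proof -
  have 0: "pcoeff f a = 0" if "Poly_Mapping.lookup a n \<noteq> 0" for a
  proof -
    have "pcoeff (pkill n f) a = 0" using that by transfer (simp add: in_keys_iff)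
    then show ?thesis using assms(1) by simp
  qed
  have "pcoeff (f * pvar n ^ i) (m + Poly_Mapping.single n k) =
    (\<Sum>(a, b) | a + b = m + Poly_Mapping.single n k. pcoeff f a * (if b = Poly_Mapping.single n i then 1 else 0))"
    by (simp add: pcoeff_mult pcoeff_pvar_power)
  also have "\<dots> = (\<Sum>(a, b)\<in>(if i = k then {(m, Poly_Mapping.single n k)} else {}). pcoeff f a)"
  proof (intro sum.mono_neutral_cong_right finite_decomp ballI)
    fix p assume p: "p \<in> {(a, b). a + b = m + Poly_Mapping.single n k} -
        (if i = k then {(m, Poly_Mapping.single n k)} else {})"
    obtain a b where ab: "p = (a, b)" by (cases p)
    have s: "a + b = m + Poly_Mapping.single n k" using p ab by auto
    have "pcoeff f a = 0" if b: "b = Poly_Mapping.single n i"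
    proof (rule 0)
      have "Poly_Mapping.lookup a n + i = k"
        using arg_cong[OF s, of "\<lambda>x. Poly_Mapping.lookup x n"] assms(2) b by (simp add: lookup_add)
      moreover have "i \<noteq> k"
        using p ab s b by (auto split: if_splits)
      ultimately show "Poly_Mapping.lookup a n \<noteq> 0" by auto
    qed
    then show "(case p of (a, b) \<Rightarrow> pcoeff f a * (if b = Poly_Mapping.single n i then 1 else 0)) = 0"
      using ab by auto
  qed (auto split: if_splits)
  also have "\<dots> = (if i = k then pcoeff f m else 0)" by simp
  finally show ?thesis .
qed

lemma pcoeff_mult_peval:
  assumes "pkill n f = f" "Poly_Mapping.lookup m n = 0"
  shows "pcoeff (f * series.peval (pvar n) p) (m + Poly_Mapping.single n k) = coeff p k * pcoeff f m"
proof -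
  let ?n = "max k (degree p)"
  have "f * series.peval (pvar n) p = (\<Sum>i\<le>?n. pscale (coeff p i) (f * pvar n ^ i))"
    by (subst series.peval_eq_sum[of p ?n]) (simp_all add: sum_distrib_left pconst_mult pscale_mult_right)
  then have "pcoeff (f * series.peval (pvar n) p) (m + Poly_Mapping.single n k) =
    (\<Sum>i\<le>?n. coeff p i * (if i = k then pcoeff f m else 0))"
    by (simp only: pcoeff_sum pcoeff_scale pcoeff_mult_pvar_power[OF assms])
  also have "\<dots> = (\<Sum>i\<le>?n. if i = k then coeff p k * pcoeff f m else 0)"
    by (intro sum.cong refl) simp
  also have "\<dots> = coeff p k * pcoeff f m" by simp
  finally show ?thesis .
qed

definition dirac :: "partition \<Rightarrow> partition \<Rightarrow> Rq"
  where "dirac \<mu> \<kappa> = (if \<kappa> = \<mu> then 1 else 0)"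

text \<open>Since \<open>fold\<close> applies the head first, the last exponent is the outermost
  operator, just as the last variable is the outermost factor in the branching rule.\<close>

definition Tlist :: "nat list \<Rightarrow> partition \<Rightarrow> partition \<Rightarrow> Rq"
  where "Tlist ks \<kappa> \<mu> = fold Top ks (dirac \<mu>) \<kappa>"

definition expl :: "nat \<Rightarrow> (nat \<Rightarrow>\<^sub>0 nat) \<Rightarrow> nat list"
  where "expl n m = map (Poly_Mapping.lookup m) [0..<n]"

lemma pcoeff_FF_n:
  "Poly_Mapping.keys m \<subseteq> {..<n} \<Longrightarrow> pcoeff (FF_n n \<kappa> \<mu>) m = Tlist (expl n m) \<kappa> \<mu>"
proof (induction n arbitrary: m \<kappa>)
  case 0
  then have "m = 0" by simp
  then show ?case by (simp add: Tlist_def expl_def dirac_def pcoeff_one)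
next
  case (Suc n)
  define k where "k = Poly_Mapping.lookup m n"
  define m' where "m' = Poly_Mapping.update n 0 m"
  have m: "m = m' + Poly_Mapping.single n k"
    by (rule poly_mapping_eqI) (auto simp: m'_def k_def lookup_add lookup_update lookup_single when_def)
  have m'n: "Poly_Mapping.lookup m' n = 0" by (simp add: m'_def lookup_update)
  have m'i: "Poly_Mapping.lookup m' i = Poly_Mapping.lookup m i" if "i \<noteq> n" for i
    using that by (simp add: m'_def lookup_update)
  have km': "Poly_Mapping.keys m' \<subseteq> {..<n}"
  proof
    fix i assume i: "i \<in> Poly_Mapping.keys m'"
    then have "i \<noteq> n" using m'n by (auto simp: in_keys_iff)
    moreover have "i \<in> Poly_Mapping.keys m" using i m'i[OF \<open>i \<noteq> n\<close>] by (simp add: in_keys_iff)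
    ultimately show "i \<in> {..<n}" using Suc.prems by auto
  qed
  have e: "expl (Suc n) m = expl n m' @ [k]" using m'i by (simp add: expl_def k_def)
  have "pcoeff (FF_n (Suc n) \<kappa> \<mu>) m =
      (\<Sum>\<nu> | \<mu> \<subseteq>\<^sub>p \<nu> \<and> \<nu> \<prec>\<^sub>h \<kappa>. T_coeff k \<kappa> \<nu> * pcoeff (FF_n n \<nu> \<mu>) m')"
    by (subst m) (simp add: FF_one_eq_peval pcoeff_mult_peval[OF pkill_FF_n m'n] T_coeff_def)
  also have "\<dots> = (\<Sum>\<nu> | \<nu> \<subseteq>\<^sub>p \<kappa>. T_coeff k \<kappa> \<nu> * pcoeff (FF_n n \<nu> \<mu>) m')"
  proof (intro sum.mono_neutral_left finite_contained ballI)
    fix \<nu> assume "\<nu> \<in> {\<nu>. \<nu> \<subseteq>\<^sub>p \<kappa>} - {\<nu>. \<mu> \<subseteq>\<^sub>p \<nu> \<and> \<nu> \<prec>\<^sub>h \<kappa>}"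
    then have "\<not> \<mu> \<subseteq>\<^sub>p \<nu> \<or> \<not> \<nu> \<prec>\<^sub>h \<kappa>" by simp
    then show "T_coeff k \<kappa> \<nu> * pcoeff (FF_n n \<nu> \<mu>) m' = 0"
      using T_coeff_not_strip[of \<nu> \<kappa> k] FF_n_not_contained[of \<mu> \<nu> n] by auto
  qed (auto simp: horizontal_strip_def)
  also have "\<dots> = Top k (\<lambda>\<nu>. Tlist (expl n m') \<nu> \<mu>) \<kappa>"
    by (simp add: kop_def Suc.IH[OF km'])
  also have "\<dots> = Tlist (expl (Suc n) m) \<kappa> \<mu>" by (simp add: e Tlist_def)
  finally show ?case .
qed

lemma pcoeff_FF_skew_Tlist:
  "Poly_Mapping.keys m \<subseteq> {..<n} \<Longrightarrow> pcoeff (FF_skew \<kappa> \<mu>) m = Tlist (expl n m) \<kappa> \<mu>"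
  by (simp add: pcoeff_FF_skew pcoeff_FF_n)

lemma ex_keys_bound: "\<exists>n. Poly_Mapping.keys m \<subseteq> {..<n :: nat}"
  using finite_keys[of m] by (simp add: finite_nat_iff_bounded)

lemma Tlist_snoc: "Tlist (ks @ [k]) \<kappa> \<mu> = (\<Sum>\<nu> | \<nu> \<subseteq>\<^sub>p \<kappa>. T_coeff k \<kappa> \<nu> * Tlist ks \<nu> \<mu>)"
  by (simp add: Tlist_def kop_def)

lemma triangular_Tlist: "triangular (Tlist ks)"
proof (induction ks rule: rev_induct)
  case Nil
  then show ?case by (auto simp: triangular_def Tlist_def dirac_def)
next
  case (snoc k ks)
  then show ?case unfolding triangular_def Tlist_snoc using contained_trans
    by (auto intro!: sum.neutral) blast
qed

lemma fold_Top: "fold Top ks f = kop (Tlist ks) f"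
proof (induction ks rule: rev_induct)
  case Nil
  show ?case
    by (rule ext) (simp add: kop_def Tlist_def dirac_def finite_contained if_distrib[of "\<lambda>c. c * _"] cong: if_cong)
next
  case (snoc k ks)
  show ?case
    by (rule ext) (simp add: snoc kop_kop[OF triangular_Tlist], simp add: kop_def Tlist_snoc)
qed

lemma Tlist_append: "Tlist (ks @ ls) \<kappa> \<mu> = (\<Sum>\<nu> | \<nu> \<subseteq>\<^sub>p \<kappa>. Tlist ls \<kappa> \<nu> * Tlist ks \<nu> \<mu>)"
  unfolding Tlist_def[of "ks @ ls"] by (simp add: fold_Top[of ls] kop_def Tlist_def[of ks])

text \<open>The source of all symmetry below: commuting operators make a coefficient depend only on
  the multiset of exponents.\<close>

lemma Tlist_perm: "mset ks = mset ls \<Longrightarrow> Tlist ks = Tlist ls"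
proof -
  assume "mset ks = mset ls"
  then have "fold Top ks = fold Top ls"
    by (intro fold_multiset_equiv) (auto simp: fun_eq_iff Top_commute)
  then show ?thesis by (simp add: Tlist_def fun_eq_iff)
qed

section \<open>Triangularity\<close>

text \<open>The classical statistic n(\<kappa>). Among partitions of equal size it strictly
  decreases as the dominance order increases, so it can stand in for dominance as a numerical
  order.\<close>

definition npart :: "partition \<Rightarrow> nat"
  where "npart \<kappa> = (\<Sum>i<plength \<kappa>. i * part \<kappa> i)"

lemma npart_eq_sum: "plength \<kappa> \<le> N \<Longrightarrow> npart \<kappa> = (\<Sum>i<N. i * part \<kappa> i)"
  unfolding npart_def by (rule sum.mono_neutral_left) (auto simp: part_eq_0_iff)

lemma strip_plength: "\<mu> \<prec>\<^sub>h \<kappa> \<Longrightarrow> plength \<kappa> \<le> Suc (plength \<mu>)"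
  using part_eq_0_iff[of \<mu> "plength \<mu>"] part_eq_0_iff[of \<kappa> "Suc (plength \<mu>)"]
  by (metis horizontal_strip_iff le_refl le_zero_eq)

lemma plength_empty [simp]: "plength empty_partition = 0" and psize_empty [simp]: "psize empty_partition = 0"
  and part_empty [simp]: "part empty_partition i = 0"
  by (simp_all add: plength_def psize_def empty_partition.rep_eq)

text \<open>A nonzero entry comes from a chain of horizontal strips starting at the empty partition.
  As in a semistandard tableau, step \<open>i\<close> adds cells in rows 0 to \<open>i\<close> only,
  and at most \<open>ks ! i\<close> of them. When the sizes are attained, weighting each cell by its
  row index gives the bound on \<open>npart\<close>.\<close>

lemma Tlist_nonzeroD:
  assumes "Tlist ks \<kappa> empty_partition \<noteq> 0"
  shows "plength \<kappa> \<le> length ks \<and> psize \<kappa> \<le> sum_list ks \<and>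
    (psize \<kappa> = sum_list ks \<longrightarrow> npart \<kappa> \<le> (\<Sum>i<length ks. i * ks ! i) \<and>
      (npart \<kappa> = (\<Sum>i<length ks. i * ks ! i) \<longrightarrow> (\<forall>i<length ks. part \<kappa> i = ks ! i)))"
  using assms
proof (induction ks arbitrary: \<kappa> rule: rev_induct)
  case Nil
  then have "\<kappa> = empty_partition" by (simp add: Tlist_def dirac_def split: if_splits)
  then show ?case by (simp add: npart_def)
next
  case (snoc k ks)
  let ?n = "length ks"
  obtain \<nu> where "T_coeff k \<kappa> \<nu> * Tlist ks \<nu> empty_partition \<noteq> 0"
    using snoc.prems unfolding Tlist_snoc by (meson sum.not_neutral_contains_not_neutral)
  then have T: "T_coeff k \<kappa> \<nu> \<noteq> 0" and \<nu>: "Tlist ks \<nu> empty_partition \<noteq> 0" by auto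
  note h = T_coeff_nonzeroD(1,2)[OF T]
  note IH = snoc.IH[OF \<nu>]
  have s: "part \<kappa> (Suc r) \<le> part \<nu> r" "part \<nu> r \<le> part \<kappa> r" for r
    using h(1) by (auto simp: horizontal_strip_iff)
  have l\<nu>: "plength \<nu> \<le> ?n" using IH by simp
  then have l: "plength \<kappa> \<le> Suc ?n" using strip_plength[OF h(1)] by simp
  have \<nu>n: "part \<nu> ?n = 0" using l\<nu> by (simp add: part_eq_0_iff)
  have eq: "npart \<kappa> \<le> (\<Sum>i<Suc ?n. i * (ks @ [k]) ! i) \<and>
      (npart \<kappa> = (\<Sum>i<Suc ?n. i * (ks @ [k]) ! i) \<longrightarrow> (\<forall>i<Suc ?n. part \<kappa> i = (ks @ [k]) ! i))"
    if sz: "psize \<kappa> = sum_list ks + k"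
  proof -
    have sz\<nu>: "psize \<nu> = sum_list ks" using sz h(2) IH by simp
    have "psize \<kappa> = psize \<nu> + k" using sz sz\<nu> by simp
    then have "(\<Sum>i<Suc ?n. part \<kappa> i) = (\<Sum>i<Suc ?n. part \<nu> i) + k"
      using l l\<nu> by (simp add: psize_eq_sum[of _ "Suc ?n"])
    then have d: "(\<Sum>i<?n. part \<kappa> i - part \<nu> i) + part \<kappa> ?n = k"
      using s(2) \<nu>n sum_mono[of "{..<?n}" "part \<nu>" "part \<kappa>"] by (simp add: sum_subtractf_nat)
    have nk: "npart \<kappa> = npart \<nu> + (\<Sum>i<?n. i * (part \<kappa> i - part \<nu> i)) + ?n * part \<kappa> ?n"
    proof -
      have "npart \<kappa> = (\<Sum>i<?n. i * part \<kappa> i) + ?n * part \<kappa> ?n" using npart_eq_sum[OF l] by simp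
      also have "(\<Sum>i<?n. i * part \<kappa> i) = (\<Sum>i<?n. i * part \<nu> i + i * (part \<kappa> i - part \<nu> i))"
        using s(2) by (intro sum.cong refl) (simp add: distrib_left[symmetric])
      finally show ?thesis using npart_eq_sum[OF l\<nu>] by (simp add: sum.distrib)
    qed
    have le: "(\<Sum>i<?n. i * (part \<kappa> i - part \<nu> i)) \<le> (\<Sum>i<?n. ?n * (part \<kappa> i - part \<nu> i))"
      by (intro sum_mono) simp
    have nd: "?n * k = (\<Sum>i<?n. ?n * (part \<kappa> i - part \<nu> i)) + ?n * part \<kappa> ?n"
      unfolding d[symmetric] by (simp add: distrib_left sum_distrib_left)
    have S: "(\<Sum>i<Suc ?n. i * (ks @ [k]) ! i) = (\<Sum>i<?n. i * ks ! i) + ?n * k"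
      by (simp add: nth_append)
    have IH': "npart \<nu> \<le> (\<Sum>i<?n. i * ks ! i)" using IH sz\<nu> by simp
    show ?thesis
    proof (intro conjI impI)
      show "npart \<kappa> \<le> (\<Sum>i<Suc ?n. i * (ks @ [k]) ! i)" unfolding S using nk le nd IH' by linarith
      \<comment> \<open>Equality leaves no slack: every cell added in the last step lies in the
        lowest possible row, and the same holds for the earlier steps by induction.\<close>
      assume E: "npart \<kappa> = (\<Sum>i<Suc ?n. i * (ks @ [k]) ! i)"
      then have E1: "npart \<nu> = (\<Sum>i<?n. i * ks ! i)"
        and E2: "(\<Sum>i<?n. i * (part \<kappa> i - part \<nu> i)) = (\<Sum>i<?n. ?n * (part \<kappa> i - part \<nu> i))"
        unfolding S using nk le nd IH' by linarith+
      have k\<nu>: "part \<kappa> i = part \<nu> i" if "i < ?n" for i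
      proof (rule ccontr)
        assume "part \<kappa> i \<noteq> part \<nu> i"
        then have "i * (part \<kappa> i - part \<nu> i) < ?n * (part \<kappa> i - part \<nu> i)"
          using s(2)[of i] that by simp
        then have "(\<Sum>i<?n. i * (part \<kappa> i - part \<nu> i)) < (\<Sum>i<?n. ?n * (part \<kappa> i - part \<nu> i))"
          using that by (intro sum_strict_mono_ex1) auto
        then show False using E2 by simp
      qed
      moreover have "part \<nu> i = ks ! i" if "i < ?n" for i using IH sz\<nu> E1 that by simp
      moreover have "part \<kappa> ?n = k" using d k\<nu> by simp
      ultimately show "\<forall>i<Suc ?n. part \<kappa> i = (ks @ [k]) ! i"
        by (auto simp: less_Suc_eq nth_append)
    qed
  qed
  have "psize \<kappa> \<le> sum_list ks + k" using h(2) IH by linarith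
  then show ?case using l eq by simp
qed

lift_definition truncate :: "nat \<Rightarrow> partition \<Rightarrow> partition" is "\<lambda>n f i. if i < n then f i else 0"
proof -
  fix n and f :: "nat \<Rightarrow> nat" assume f: "antimono f \<and> finite {i. f i \<noteq> 0}"
  have "finite {i. (if i < n then f i else 0) \<noteq> 0}" by (rule finite_subset[of _ "{..<n}"]) auto
  moreover have "antimono (\<lambda>i. if i < n then f i else 0)"
    using f by (auto simp: antimono_def)
  ultimately show "antimono (\<lambda>i. if i < n then f i else 0) \<and> finite {i. (if i < n then f i else 0) \<noteq> 0}"
    by simp
qed

lemma plength_le_iff: "plength \<kappa> \<le> n \<longleftrightarrow> part \<kappa> n = 0"
  by (simp add: part_eq_0_iff)

text \<open>Only one chain contributes, the one that adds row \<open>i\<close> as a whole at step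
  \<open>i\<close>, and its factors are lowest coefficients of T, which do not vanish.\<close>

lemma Tlist_diagonal: "plength \<kappa> \<le> n \<Longrightarrow> Tlist (map (part \<kappa>) [0..<n]) \<kappa> empty_partition \<noteq> 0"
proof (induction n arbitrary: \<kappa>)
  case 0
  then have "part \<kappa> i = 0" for i by (simp add: part_eq_0_iff)
  then have "\<kappa> = empty_partition" by (simp add: part_inject[symmetric] fun_eq_iff)
  then show ?case by (simp add: Tlist_def dirac_def)
next
  case (Suc n)
  let ?ks = "map (part \<kappa>) [0..<n]" and ?k = "part \<kappa> n"
  define \<tau> where "\<tau> = truncate n \<kappa>"
  have \<tau>: "part \<tau> i = (if i < n then part \<kappa> i else 0)" for i by (simp add: \<tau>_def truncate.rep_eq)
  have l\<tau>: "plength \<tau> \<le> n" by (simp add: plength_le_iff \<tau>)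
  have ks: "sum_list ?ks = (\<Sum>i<n. part \<kappa> i)"
    by (simp add: interv_sum_list_conv_sum_set_nat atLeast0LessThan)
  have s\<kappa>: "psize \<kappa> = (\<Sum>i<n. part \<kappa> i) + ?k" using psize_eq_sum[OF Suc.prems] by simp
  have s\<tau>: "psize \<tau> = (\<Sum>i<n. part \<kappa> i)" using psize_eq_sum[OF l\<tau>] by (simp add: \<tau>)
  have 0: "part \<kappa> i = 0" if "Suc n \<le> i" for i using that Suc.prems by (simp add: part_eq_0_iff)
  have h: "\<tau> \<prec>\<^sub>h \<kappa>" unfolding horizontal_strip_iff \<tau> using 0 by (auto simp: part_antimono not_less)
  \<comment> \<open>The length leaves \<nu> only the first \<open>n\<close> rows of \<kappa>, and
    its size must be that of these rows: the last step adds at most \<open>part \<kappa> n\<close>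
    cells.\<close>
  have uniq: "\<nu> = \<tau>" if nz: "T_coeff ?k \<kappa> \<nu> * Tlist ?ks \<nu> empty_partition \<noteq> 0" for \<nu>
  proof -
    from nz have T: "T_coeff ?k \<kappa> \<nu> \<noteq> 0" and "Tlist ?ks \<nu> empty_partition \<noteq> 0" by auto
    from Tlist_nonzeroD[OF this(2)] have l: "plength \<nu> \<le> n" and sz: "psize \<nu> \<le> (\<Sum>i<n. part \<kappa> i)"
      by (simp_all add: ks)
    note hT = T_coeff_nonzeroD(1,2)[OF T]
    have le: "part \<nu> i \<le> part \<kappa> i" for i using hT(1) by (auto simp: horizontal_strip_iff)
    have "(\<Sum>i<n. part \<nu> i) = (\<Sum>i<n. part \<kappa> i)"
      using hT(2) sz s\<kappa> psize_eq_sum[OF l] by simp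
    then have "part \<nu> i = part \<kappa> i" if "i < n" for i
      using that le sum_mono_inv[of "part \<nu>" "{..<n}" "part \<kappa>" i] by auto
    moreover have "part \<nu> i = 0" if "n \<le> i" for i using that l by (simp add: part_eq_0_iff)
    ultimately show ?thesis by (simp add: part_inject[symmetric] fun_eq_iff \<tau>)
  qed
  have "Tlist (map (part \<kappa>) [0..<Suc n]) \<kappa> empty_partition =
      (\<Sum>\<nu> | \<nu> \<subseteq>\<^sub>p \<kappa>. T_coeff ?k \<kappa> \<nu> * Tlist ?ks \<nu> empty_partition)"
    by (simp add: Tlist_snoc)
  also have "\<dots> = (\<Sum>\<nu>\<in>{\<tau>}. T_coeff ?k \<kappa> \<nu> * Tlist ?ks \<nu> empty_partition)"
  proof (intro sum.mono_neutral_right finite_contained ballI)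
    show "{\<tau>} \<subseteq> {\<nu>. \<nu> \<subseteq>\<^sub>p \<kappa>}" using h by (simp add: horizontal_strip_def)
    fix \<nu> assume "\<nu> \<in> {\<nu>. \<nu> \<subseteq>\<^sub>p \<kappa>} - {\<tau>}"
    then show "T_coeff ?k \<kappa> \<nu> * Tlist ?ks \<nu> empty_partition = 0" using uniq[of \<nu>] by blast
  qed
  also have "\<dots> \<noteq> 0"
  proof -
    have "map (part \<tau>) [0..<n] = ?ks" by (simp add: \<tau>)
    then have "Tlist ?ks \<tau> empty_partition \<noteq> 0" using Suc.IH[OF l\<tau>] by argo
    moreover have "T_coeff ?k \<kappa> \<tau> \<noteq> 0" using T_coeff_lowest[OF h] s\<kappa> s\<tau> by simp
    ultimately show ?thesis by simp
  qed
  finally show ?case .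
qed

section \<open>Symmetric series and their expansions\<close>

definition mdeg :: "(nat \<Rightarrow>\<^sub>0 nat) \<Rightarrow> nat"
  where "mdeg m = (\<Sum>i\<in>Poly_Mapping.keys m. Poly_Mapping.lookup m i)"

lemma mdeg_eq_sum: "Poly_Mapping.keys m \<subseteq> {..<n} \<Longrightarrow> mdeg m = (\<Sum>i<n. Poly_Mapping.lookup m i)"
  unfolding mdeg_def by (rule sum.mono_neutral_left) (auto simp: in_keys_iff)

lemma sum_list_expl: "Poly_Mapping.keys m \<subseteq> {..<n} \<Longrightarrow> sum_list (expl n m) = mdeg m"
  by (simp add: expl_def interv_sum_list_conv_sum_set_nat atLeast0LessThan mdeg_eq_sum)

lift_definition mono_of :: "partition \<Rightarrow> (nat \<Rightarrow>\<^sub>0 nat)" is "\<lambda>f. f"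
  by simp

lemma lookup_mono_of: "Poly_Mapping.lookup (mono_of \<kappa>) = part \<kappa>"
  by transfer simp

lemma keys_mono_of: "Poly_Mapping.keys (mono_of \<kappa>) = {..<plength \<kappa>}"
  by (auto simp: in_keys_iff lookup_mono_of part_eq_0_iff)

lemma mdeg_mono_of: "mdeg (mono_of \<kappa>) = psize \<kappa>"
  by (simp add: mdeg_def keys_mono_of lookup_mono_of psize_eq_sum[of \<kappa> "plength \<kappa>"])

lemma FF_coeff_size: "pcoeff (FF \<kappa>) m \<noteq> 0 \<Longrightarrow> psize \<kappa> \<le> mdeg m"
proof -
  assume nz: "pcoeff (FF \<kappa>) m \<noteq> 0"
  obtain n where n: "Poly_Mapping.keys m \<subseteq> {..<n}" using ex_keys_bound by blast
  have "Tlist (expl n m) \<kappa> empty_partition \<noteq> 0"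
    using nz by (simp add: FF_def pcoeff_FF_skew_Tlist[OF n])
  from Tlist_nonzeroD[OF this] show ?thesis by (simp add: sum_list_expl[OF n])
qed

definition prec :: "partition \<Rightarrow> partition \<Rightarrow> bool"
  where "prec \<mu> \<kappa> \<longleftrightarrow> psize \<mu> < psize \<kappa> \<or> psize \<mu> = psize \<kappa> \<and> npart \<mu> < npart \<kappa>"

lemma wf_prec: "wf {(\<mu>, \<kappa>). prec \<mu> \<kappa>}"
  by (rule wf_subset[of "measures [psize, npart]"]) (auto simp: prec_def)

lemma expl_mono_of: "expl n (mono_of \<kappa>) = map (part \<kappa>) [0..<n]"
  by (simp add: expl_def lookup_mono_of)

text \<open>At equal size and equal \<open>npart\<close> this is the extremal case of
  \<open>Tlist_nonzeroD\<close>. With \<open>FF_coeff_diagonal\<close> it makes the matrix of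
  coefficients at partition monomials triangular with respect to \<open>prec\<close>.\<close>

lemma FF_coeff_mono_of:
  assumes "pcoeff (FF \<mu>) (mono_of \<kappa>) \<noteq> 0"
  shows "\<mu> = \<kappa> \<or> prec \<mu> \<kappa>"
proof -
  let ?n = "plength \<kappa>" and ?ks = "map (part \<kappa>) [0..<plength \<kappa>]"
  have k: "Poly_Mapping.keys (mono_of \<kappa>) \<subseteq> {..<?n}" by (simp add: keys_mono_of)
  have "Tlist ?ks \<mu> empty_partition \<noteq> 0"
    using assms by (simp add: FF_def pcoeff_FF_skew_Tlist[OF k] expl_mono_of)
  note T = Tlist_nonzeroD[OF this]
  have s: "sum_list ?ks = psize \<kappa>"
    using sum_list_expl[OF k] by (simp add: expl_mono_of mdeg_mono_of)
  have n: "(\<Sum>i<length ?ks. i * ?ks ! i) = npart \<kappa>" by (simp add: npart_def)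
  show ?thesis
  proof (cases "prec \<mu> \<kappa>")
    case False
    then have e: "psize \<mu> = psize \<kappa>" "npart \<mu> = npart \<kappa>" using T s n by (auto simp: prec_def)
    then have "part \<mu> i = part \<kappa> i" if "i < ?n" for i using T s n that by simp
    moreover have "part \<mu> i = part \<kappa> i" if "\<not> i < ?n" for i
    proof -
      have "plength \<mu> \<le> i" "plength \<kappa> \<le> i" using T that by simp_all
      then show ?thesis using part_eq_0_iff[of \<mu> i] part_eq_0_iff[of \<kappa> i] by simp
    qed
    ultimately have "part \<mu> = part \<kappa>" by blast
    then show ?thesis by (simp add: part_inject)
  qed simp
qed

lemma FF_coeff_diagonal: "pcoeff (FF \<kappa>) (mono_of \<kappa>) \<noteq> 0"
  using Tlist_diagonal[of \<kappa> "plength \<kappa>"]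
  by (simp add: FF_def pcoeff_FF_skew_Tlist[of _ "plength \<kappa>"] keys_mono_of expl_mono_of)

section \<open>Finite index sets and uniqueness of expansions\<close>

lift_definition rectangle :: "nat \<Rightarrow> nat \<Rightarrow> partition" is "\<lambda>a b i. if i < a then b else 0"
proof -
  fix a b :: nat
  have "finite {i. (if i < a then b else 0) \<noteq> 0}" by (rule finite_subset[of _ "{..<a}"]) auto
  then show "antimono (\<lambda>i. if i < a then b else 0) \<and> finite {i. (if i < a then b else 0) \<noteq> 0}"
    by (auto simp: antimono_def)
qed

lemma finite_bounded_partitions: "finite {\<kappa>. plength \<kappa> \<le> a \<and> part \<kappa> 0 \<le> b}"
proof (rule finite_subset[OF _ finite_contained[of "rectangle a b"]])
  show "{\<kappa>. plength \<kappa> \<le> a \<and> part \<kappa> 0 \<le> b} \<subseteq> {\<mu>. \<mu> \<subseteq>\<^sub>p rectangle a b}"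
  proof clarify
    fix \<kappa> assume H: "plength \<kappa> \<le> a" "part \<kappa> 0 \<le> b"
    have "part \<kappa> i \<le> part (rectangle a b) i" for i
      using H part_antimono[of 0 i \<kappa>] part_eq_0_iff[of \<kappa> i] by (simp add: rectangle.rep_eq)
    then show "\<kappa> \<subseteq>\<^sub>p rectangle a b" by (simp add: contained_iff)
  qed
qed

lemma plength_le_psize: "plength \<kappa> \<le> psize \<kappa>"
proof -
  have "(\<Sum>i<plength \<kappa>. 1) \<le> (\<Sum>i<plength \<kappa>. part \<kappa> i)"
  proof (rule sum_mono)
    fix i assume "i \<in> {..<plength \<kappa>}"
    then show "1 \<le> part \<kappa> i" using part_eq_0_iff[of \<kappa> i] by (cases "part \<kappa> i") auto
  qed
  then show ?thesis by (simp add: psize_eq_sum[of \<kappa> "plength \<kappa>"])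
qed

lemma part_0_le_psize: "part \<kappa> 0 \<le> psize \<kappa>"
proof (cases "plength \<kappa> = 0")
  case True
  then show ?thesis using part_eq_0_iff[of \<kappa> 0] by simp
next
  case False
  then show ?thesis
    unfolding psize_eq_sum[of \<kappa> "plength \<kappa>", OF order_refl] by (intro member_le_sum) auto
qed

lemma finite_psize_le: "finite {\<kappa>. psize \<kappa> \<le> d}"
  by (rule finite_subset[OF _ finite_bounded_partitions[of d d]])
    (auto intro: order_trans[OF plength_le_psize] order_trans[OF part_0_le_psize])

text \<open>The defining sum runs over a set that depends on \<open>c\<close>. Replacing it by the
  finite set given by the degree of the monomial makes the condition visibly linear in
  \<open>c\<close>.\<close>

lemma FF_expansion_iff:
  "FF_expansion f c \<longleftrightarrow> (\<forall>m. pcoeff f m = (\<Sum>\<kappa> | psize \<kappa> \<le> mdeg m. c \<kappa> * pcoeff (FF \<kappa>) m))"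
proof -
  have sub: "{\<kappa>. c \<kappa> * pcoeff (FF \<kappa>) m \<noteq> 0} \<subseteq> {\<kappa>. psize \<kappa> \<le> mdeg m}" for m
    using FF_coeff_size by auto
  have fin: "finite {\<kappa>. c \<kappa> * pcoeff (FF \<kappa>) m \<noteq> 0}" for m
    using sub finite_psize_le by (rule finite_subset)
  have "(\<Sum>\<kappa> | c \<kappa> * pcoeff (FF \<kappa>) m \<noteq> 0. c \<kappa> * pcoeff (FF \<kappa>) m) =
      (\<Sum>\<kappa> | psize \<kappa> \<le> mdeg m. c \<kappa> * pcoeff (FF \<kappa>) m)" for m
    by (rule sum.mono_neutral_left[OF finite_psize_le sub]) simp
  then show ?thesis unfolding FF_expansion_def using fin by simp
qed

lemma FF_expansion_bound:
  assumes "FF_expansion f c" "mdeg m \<le> D"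
  shows "pcoeff f m = (\<Sum>\<kappa> | psize \<kappa> \<le> D. c \<kappa> * pcoeff (FF \<kappa>) m)"
proof -
  have "pcoeff f m = (\<Sum>\<kappa> | psize \<kappa> \<le> mdeg m. c \<kappa> * pcoeff (FF \<kappa>) m)"
    using assms(1) by (simp add: FF_expansion_iff)
  also have "\<dots> = (\<Sum>\<kappa> | psize \<kappa> \<le> D. c \<kappa> * pcoeff (FF \<kappa>) m)"
    using assms(2) FF_coeff_size by (intro sum.mono_neutral_left finite_psize_le) auto
  finally show ?thesis .
qed

lemma sum_FF_coeff_mono_of:
  "(\<Sum>\<mu> | psize \<mu> \<le> psize \<kappa>. c \<mu> * pcoeff (FF \<mu>) (mono_of \<kappa>)) =
   c \<kappa> * pcoeff (FF \<kappa>) (mono_of \<kappa>) + (\<Sum>\<mu> | prec \<mu> \<kappa>. c \<mu> * pcoeff (FF \<mu>) (mono_of \<kappa>))"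
proof -
  have fin: "finite {\<mu>. prec \<mu> \<kappa>}"
    by (rule finite_subset[OF _ finite_psize_le[of "psize \<kappa>"]]) (auto simp: prec_def)
  have "(\<Sum>\<mu> | psize \<mu> \<le> psize \<kappa>. c \<mu> * pcoeff (FF \<mu>) (mono_of \<kappa>)) =
      (\<Sum>\<mu>\<in>insert \<kappa> {\<mu>. prec \<mu> \<kappa>}. c \<mu> * pcoeff (FF \<mu>) (mono_of \<kappa>))"
    using FF_coeff_mono_of by (intro sum.mono_neutral_right finite_psize_le) (auto simp: prec_def)
  also have "\<dots> = c \<kappa> * pcoeff (FF \<kappa>) (mono_of \<kappa>) + (\<Sum>\<mu> | prec \<mu> \<kappa>. c \<mu> * pcoeff (FF \<mu>) (mono_of \<kappa>))"
    using fin by (subst sum.insert) (auto simp: prec_def)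
  finally show ?thesis .
qed

lemma FF_expansion_zero:
  assumes "FF_expansion 0 c"
  shows "c \<kappa> = 0"
proof (induction \<kappa> rule: wf_induct_rule[OF wf_prec])
  case (1 \<kappa>)
  have "0 = (\<Sum>\<mu> | psize \<mu> \<le> psize \<kappa>. c \<mu> * pcoeff (FF \<mu>) (mono_of \<kappa>))"
    using FF_expansion_bound[OF assms, of "mono_of \<kappa>" "psize \<kappa>"] by (simp add: mdeg_mono_of)
  also have "\<dots> = c \<kappa> * pcoeff (FF \<kappa>) (mono_of \<kappa>)"
    unfolding sum_FF_coeff_mono_of using 1 by simp
  finally show ?case using FF_coeff_diagonal[of \<kappa>] by simp
qed

lemma FF_expansion_diff: "FF_expansion f c \<Longrightarrow> FF_expansion g d \<Longrightarrow> FF_expansion (f - g) (\<lambda>\<kappa>. c \<kappa> - d \<kappa>)"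
  by (simp add: FF_expansion_iff sum_subtractf left_diff_distrib)

lemma FF_expansion_unique: "FF_expansion f c \<Longrightarrow> FF_expansion f d \<Longrightarrow> c = d"
  using FF_expansion_zero[of "\<lambda>\<kappa>. c \<kappa> - d \<kappa>"] FF_expansion_diff[of f c f d] by (simp add: fun_eq_iff)

section \<open>Symmetric series and existence of expansions\<close>

definition adj :: "nat \<Rightarrow> nat \<Rightarrow> nat"
  where "adj i j = (if j = i then Suc i else if j = Suc i then i else j)"

lemma adj_adj [simp]: "adj i (adj i j) = j"
  by (auto simp: adj_def)

lemma inj_adj: "inj (adj i)"
  by (rule injI) (metis adj_adj)

lift_definition mswap :: "nat \<Rightarrow> (nat \<Rightarrow>\<^sub>0 nat) \<Rightarrow> (nat \<Rightarrow>\<^sub>0 nat)" is "\<lambda>i m j. m (adj i j)"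
proof -
  fix i and m :: "nat \<Rightarrow> nat" assume "finite {j. m j \<noteq> 0}"
  then have "finite (adj i -` {j. m j \<noteq> 0})" using inj_adj by (rule finite_vimageI)
  then show "finite {j. m (adj i j) \<noteq> 0}" by (simp add: vimage_def)
qed

lemma mswap_mswap [simp]: "mswap i (mswap i m) = m"
  by transfer simp

lemma mswap_add: "mswap i (a + b) = mswap i a + mswap i b"
  by (rule poly_mapping_eqI) (simp add: mswap.rep_eq lookup_add)

text \<open>Adjacent transpositions generate the finitary permutations. They are also what sorting
  an exponent vector requires.\<close>

definition symmetric :: "series \<Rightarrow> bool"
  where "symmetric f \<longleftrightarrow> (\<forall>i m. pcoeff f (mswap i m) = pcoeff f m)"

lemma symmetric_mult:
  assumes "symmetric f" "symmetric g"
  shows "symmetric (f * g)"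
  unfolding symmetric_def
proof (intro allI)
  fix i m
  have "pcoeff (f * g) (mswap i m) = (\<Sum>(a, b) | a + b = mswap i m. pcoeff f a * pcoeff g b)"
    by (rule pcoeff_mult)
  also have "\<dots> = (\<Sum>(a, b) | a + b = m. pcoeff f a * pcoeff g b)"
    using assms unfolding symmetric_def
    by (intro sum.reindex_bij_witness[of _ "\<lambda>(a, b). (mswap i a, mswap i b)" "\<lambda>(a, b). (mswap i a, mswap i b)"])
      (auto simp: mswap_add[symmetric])
  finally show "pcoeff (f * g) (mswap i m) = pcoeff (f * g) m" by (simp add: pcoeff_mult)
qed

lemma adj_image: "Suc i < n \<Longrightarrow> adj i ` {..<n} = {..<n}"
proof
  assume i: "Suc i < n"
  show sub: "adj i ` {..<n} \<subseteq> {..<n}" using i by (auto simp: adj_def)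
  have "x \<in> adj i ` {..<n}" if "x \<in> {..<n}" for x
    using sub that by (intro image_eqI[of _ _ "adj i x"]) auto
  then show "{..<n} \<subseteq> adj i ` {..<n}" by blast
qed

lemma keys_mswap:
  assumes "Poly_Mapping.keys m \<subseteq> {..<n}" "Suc i < n"
  shows "Poly_Mapping.keys (mswap i m) \<subseteq> {..<n}"
proof
  fix j assume "j \<in> Poly_Mapping.keys (mswap i m)"
  then have "adj i j \<in> Poly_Mapping.keys m" by (simp add: in_keys_iff mswap.rep_eq)
  then have "adj i j \<in> {..<n}" using assms(1) by blast
  then have "adj i (adj i j) \<in> {..<n}" using adj_image[OF assms(2)] by blast
  then show "j \<in> {..<n}" by simp
qed

lemma mset_expl_mswap: "Suc i < n \<Longrightarrow> mset (expl n (mswap i m)) = mset (expl n m)"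
proof -
  assume i: "Suc i < n"
  have "mset (expl n (mswap i m)) = image_mset (Poly_Mapping.lookup m) (image_mset (adj i) (mset_set {..<n}))"
    by (simp add: expl_def mswap.rep_eq atLeast0LessThan multiset.map_comp o_def)
  also have "image_mset (adj i) (mset_set {..<n}) = mset_set {..<n}"
    using image_mset_mset_set[OF inj_on_subset[OF inj_adj subset_UNIV], of i "{..<n}"] adj_image[OF i] by simp
  finally show ?thesis by (simp add: expl_def atLeast0LessThan)
qed

lemma symmetric_FF_skew: "symmetric (FF_skew \<kappa> \<mu>)"
  unfolding symmetric_def
proof (intro allI)
  fix i and m :: "nat \<Rightarrow>\<^sub>0 nat"
  obtain n0 where n0: "Poly_Mapping.keys m \<subseteq> {..<n0}" using ex_keys_bound by blast
  \<comment> \<open>The window must contain both swapped positions, even if \<open>m\<close> does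
    not involve them.\<close>
  define n where "n = max n0 (Suc (Suc i))"
  have n: "Poly_Mapping.keys m \<subseteq> {..<n}" "Suc i < n" using n0 by (auto simp: n_def)
  then show "pcoeff (FF_skew \<kappa> \<mu>) (mswap i m) = pcoeff (FF_skew \<kappa> \<mu>) m"
    using Tlist_perm[OF mset_expl_mswap[of i n m]] keys_mswap[of m n i]
    by (simp add: pcoeff_FF_skew_Tlist[of _ n])
qed

lemma symmetric_FF: "symmetric (FF \<kappa>)"
  by (simp add: FF_def symmetric_FF_skew)

lemma mdeg_mswap: "mdeg (mswap i m) = mdeg m"
proof -
  obtain n0 where n0: "Poly_Mapping.keys m \<subseteq> {..<n0}" using ex_keys_bound by blast
  define n where "n = max n0 (Suc (Suc i))"
  have n: "Poly_Mapping.keys m \<subseteq> {..<n}" "Suc i < n" using n0 by (auto simp: n_def)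
  have "sum_list (expl n (mswap i m)) = sum_list (expl n m)"
    using mset_expl_mswap[OF n(2), of m] by (metis sum_mset_sum_list)
  then show ?thesis using sum_list_expl[OF n(1)] sum_list_expl[OF keys_mswap[OF n]] by simp
qed

text \<open>Bubble sort: a swap of an ascent lowers the weight \<open>\<Sum>\<^sub>i i m\<^sub>i\<close>.\<close>
lemma symmetric_zero:
  assumes f: "symmetric f" and 0: "\<And>\<kappa>. pcoeff f (mono_of \<kappa>) = 0"
  shows "f = 0"
proof -
  define w where "w m = (\<Sum>i\<in>Poly_Mapping.keys m. i * Poly_Mapping.lookup m i)" for m :: "nat \<Rightarrow>\<^sub>0 nat"
  have w: "w m = (\<Sum>i<n. i * Poly_Mapping.lookup m i)" if "Poly_Mapping.keys m \<subseteq> {..<n}" for m n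
    unfolding w_def using that by (intro sum.mono_neutral_left) (auto simp: in_keys_iff)
  have "pcoeff f m = 0" for m
  proof (induction "w m" arbitrary: m rule: less_induct)
    case less
    let ?l = "Poly_Mapping.lookup m"
    show ?case
    proof (cases "antimono ?l")
      case True
      then have "part (Partition ?l) = ?l" by (intro Partition_inverse) simp
      then have "mono_of (Partition ?l) = m" by (intro poly_mapping_eqI) (simp add: lookup_mono_of)
      then show ?thesis using 0 by metis
    next
      case False
      then obtain i where i: "?l i < ?l (Suc i)" using not_antimonoD by blast
      obtain n0 where n0: "Poly_Mapping.keys m \<subseteq> {..<n0}" using ex_keys_bound by blast
      define n where "n = max n0 (Suc (Suc i))"
      have n: "Poly_Mapping.keys m \<subseteq> {..<n}" "Suc i < n" using n0 by (auto simp: n_def)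
      have split: "sum h {..<n} = sum h ({..<n} - {i, Suc i}) + h i + h (Suc i)" for h :: "nat \<Rightarrow> nat"
      proof -
        have "sum h {..<n} = sum h ({..<n} - {i, Suc i}) + sum h {i, Suc i}"
          using n(2) by (intro sum.subset_diff) auto
        then show ?thesis by simp
      qed
      have rest: "(\<Sum>j\<in>{..<n} - {i, Suc i}. j * Poly_Mapping.lookup (mswap i m) j) = (\<Sum>j\<in>{..<n} - {i, Suc i}. j * ?l j)"
        by (intro sum.cong refl) (simp add: mswap.rep_eq adj_def)
      have "w (mswap i m) = (\<Sum>j\<in>{..<n} - {i, Suc i}. j * ?l j) + i * ?l (Suc i) + Suc i * ?l i"
        unfolding w[OF keys_mswap[OF n]] split rest by (simp add: mswap.rep_eq adj_def)
      moreover have "w m = (\<Sum>j\<in>{..<n} - {i, Suc i}. j * ?l j) + i * ?l i + Suc i * ?l (Suc i)"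
        unfolding w[OF n(1)] split by simp
      ultimately have "w (mswap i m) < w m" using i by simp
      then have "pcoeff f (mswap i m) = 0" by (rule less)
      then show ?thesis using f by (simp add: symmetric_def)
    qed
  qed
  then show ?thesis by (intro pseries_eqI) simp
qed

text \<open>Forward substitution in the triangular system of \<open>sum_FF_coeff_mono_of\<close>,
  solved at the partition monomials only.\<close>

function expand_coeff :: "series \<Rightarrow> partition \<Rightarrow> Rq" where
  "expand_coeff f \<kappa> = (pcoeff f (mono_of \<kappa>) -
     (\<Sum>\<mu> | prec \<mu> \<kappa>. expand_coeff f \<mu> * pcoeff (FF \<mu>) (mono_of \<kappa>))) / pcoeff (FF \<kappa>) (mono_of \<kappa>)"
  by auto
termination
  by (relation "inv_image {(\<mu>, \<kappa>). prec \<mu> \<kappa>} snd") (auto intro: wf_prec)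

declare expand_coeff.simps [simp del]

text \<open>The coefficients are chosen to match \<open>f\<close> at partition monomials; the
  candidate \<open>g\<close> is symmetric, and a symmetric series is determined by its coefficients
  there.\<close>

lemma symmetric_expansion:
  assumes f: "symmetric f"
  shows "FF_expansion f (expand_coeff f)"
proof -
  let ?c = "expand_coeff f"
  define g where "g = PSeries (\<lambda>m. \<Sum>\<kappa> | psize \<kappa> \<le> mdeg m. ?c \<kappa> * pcoeff (FF \<kappa>) m)"
  have g: "pcoeff g m = (\<Sum>\<kappa> | psize \<kappa> \<le> mdeg m. ?c \<kappa> * pcoeff (FF \<kappa>) m)" for m
    by (simp add: g_def PSeries_inverse)
  have "f - g = 0"
  proof (rule symmetric_zero)
    show "symmetric (f - g)"
      using f symmetric_FF by (simp add: symmetric_def g mdeg_mswap)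
    show "pcoeff (f - g) (mono_of \<kappa>) = 0" for \<kappa>
    proof -
      have "?c \<kappa> * pcoeff (FF \<kappa>) (mono_of \<kappa>) =
          pcoeff f (mono_of \<kappa>) - (\<Sum>\<mu> | prec \<mu> \<kappa>. ?c \<mu> * pcoeff (FF \<mu>) (mono_of \<kappa>))"
        using FF_coeff_diagonal[of \<kappa>] by (subst expand_coeff.simps) simp
      then show ?thesis by (simp add: g mdeg_mono_of sum_FF_coeff_mono_of)
    qed
  qed
  then show ?thesis using g by (simp add: FF_expansion_iff)
qed

section \<open>Inserting a variable\<close>

text \<open>In an infinite alphabet every index is taken, so the new variable gets position 0 and
  the old ones are shifted.\<close>

lift_definition minsert :: "nat \<Rightarrow> (nat \<Rightarrow>\<^sub>0 nat) \<Rightarrow> (nat \<Rightarrow>\<^sub>0 nat)" is "\<lambda>k m i. case i of 0 \<Rightarrow> k | Suc j \<Rightarrow> m j"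
proof -
  fix k and m :: "nat \<Rightarrow> nat" assume "finite {j. m j \<noteq> 0}"
  then have "finite (insert 0 (Suc ` {j. m j \<noteq> 0}))" by simp
  then show "finite {i. (case i of 0 \<Rightarrow> k | Suc j \<Rightarrow> m j) \<noteq> 0}"
  proof (rule finite_subset[rotated])
    show "{i. (case i of 0 \<Rightarrow> k | Suc j \<Rightarrow> m j) \<noteq> 0} \<subseteq> insert 0 (Suc ` {j. m j \<noteq> 0})"
    proof
      fix i assume "i \<in> {i. (case i of 0 \<Rightarrow> k | Suc j \<Rightarrow> m j) \<noteq> 0}"
      then show "i \<in> insert 0 (Suc ` {j. m j \<noteq> 0})" by (cases i) auto
    qed
  qed
qed

lift_definition mtail :: "(nat \<Rightarrow>\<^sub>0 nat) \<Rightarrow> (nat \<Rightarrow>\<^sub>0 nat)" is "\<lambda>m i. m (Suc i)"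
proof -
  fix m :: "nat \<Rightarrow> nat" assume "finite {j. m j \<noteq> 0}"
  then have "finite (Suc -` {j. m j \<noteq> 0})" by (rule finite_vimageI) simp
  then show "finite {i. m (Suc i) \<noteq> 0}" by (simp add: vimage_def)
qed

lemma lookup_minsert [simp]:
  "Poly_Mapping.lookup (minsert k m) 0 = k" "Poly_Mapping.lookup (minsert k m) (Suc i) = Poly_Mapping.lookup m i"
  by (transfer; simp)+

lemma mtail_minsert [simp]: "mtail (minsert k m) = m"
  by (rule poly_mapping_eqI) (simp add: mtail.rep_eq)

lemma minsert_mtail [simp]: "minsert (Poly_Mapping.lookup m 0) (mtail m) = m"
proof (rule poly_mapping_eqI)
  fix i
  show "Poly_Mapping.lookup (minsert (Poly_Mapping.lookup m 0) (mtail m)) i = Poly_Mapping.lookup m i"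
    by (cases i) (simp_all add: mtail.rep_eq)
qed

lemma minsert_add: "minsert i a + minsert j b = minsert (i + j) (a + b)"
proof (rule poly_mapping_eqI)
  fix l
  show "Poly_Mapping.lookup (minsert i a + minsert j b) l = Poly_Mapping.lookup (minsert (i + j) (a + b)) l"
    by (cases l) (simp_all add: lookup_add)
qed

lemma mtail_add: "mtail (a + b) = mtail a + mtail b"
  by (rule poly_mapping_eqI) (simp add: mtail.rep_eq lookup_add)

lemma keys_minsert: "Poly_Mapping.keys m \<subseteq> {..<n} \<Longrightarrow> Poly_Mapping.keys (minsert k m) \<subseteq> {..<Suc n}"
proof
  fix i assume "Poly_Mapping.keys m \<subseteq> {..<n}" "i \<in> Poly_Mapping.keys (minsert k m)"
  then show "i \<in> {..<Suc n}" by (cases i) (auto simp: in_keys_iff dest!: subsetD)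
qed

lemma expl_minsert: "expl (Suc n) (minsert k m) = k # expl n m"
  by (simp add: expl_def upt_conv_Cons map_Suc_upt[symmetric] del: upt_Suc)

lemma mdeg_minsert: "mdeg (minsert k m) = k + mdeg m"
proof -
  obtain n where n: "Poly_Mapping.keys m \<subseteq> {..<n}" using ex_keys_bound by blast
  show ?thesis
    using sum_list_expl[OF n] sum_list_expl[OF keys_minsert[OF n, of k]] by (simp add: expl_minsert)
qed

lemma mswap_minsert: "mswap (Suc i) (minsert k m) = minsert k (mswap i m)"
proof (rule poly_mapping_eqI)
  fix l
  show "Poly_Mapping.lookup (mswap (Suc i) (minsert k m)) l = Poly_Mapping.lookup (minsert k (mswap i m)) l"
    by (cases l) (auto simp: mswap.rep_eq adj_def)
qed

definition rho :: "nat \<Rightarrow> series \<Rightarrow> series"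
  where "rho k f = PSeries (\<lambda>m. pcoeff f (minsert k m))"

lemma pcoeff_rho [simp]: "pcoeff (rho k f) m = pcoeff f (minsert k m)"
  by (simp add: rho_def PSeries_inverse)

lemma rho_mult: "rho k (f * g) = (\<Sum>i\<le>k. rho i f * rho (k - i) g)"
proof (rule pseries_eqI)
  fix m
  have "pcoeff (rho k (f * g)) m = (\<Sum>(a, b) | a + b = minsert k m. pcoeff f a * pcoeff g b)"
    by (simp add: pcoeff_mult)
  also have "\<dots> = (\<Sum>(i, p)\<in>{..k} \<times> {(a, b). a + b = m}.
      pcoeff f (minsert i (fst p)) * pcoeff g (minsert (k - i) (snd p)))"
  proof (rule sum.reindex_bij_witness[of _ "\<lambda>(i, (a, b)). (minsert i a, minsert (k - i) b)"
        "\<lambda>(a, b). (Poly_Mapping.lookup a 0, (mtail a, mtail b))"])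
    fix p assume "p \<in> {(a, b). a + b = minsert k m}"
    then obtain a b where p: "p = (a, b)" and ab: "a + b = minsert k m" by auto
    have k: "Poly_Mapping.lookup a 0 + Poly_Mapping.lookup b 0 = k"
      using arg_cong[OF ab, of "\<lambda>x. Poly_Mapping.lookup x 0"] by (simp add: lookup_add)
    then have kb: "k - Poly_Mapping.lookup a 0 = Poly_Mapping.lookup b 0" "Poly_Mapping.lookup a 0 \<le> k" by simp_all
    have m: "mtail a + mtail b = m" using arg_cong[OF ab, of mtail] by (simp add: mtail_add)
    show "(\<lambda>(i, (a, b)). (minsert i a, minsert (k - i) b)) ((\<lambda>(a, b). (Poly_Mapping.lookup a 0, (mtail a, mtail b))) p) = p"
      by (simp add: p kb)
    show "(\<lambda>(a, b). (Poly_Mapping.lookup a 0, (mtail a, mtail b))) p \<in> {..k} \<times> {(a, b). a + b = m}"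
      using kb m by (simp add: p)
    show "(case (\<lambda>(a, b). (Poly_Mapping.lookup a 0, (mtail a, mtail b))) p of
        (i, p) \<Rightarrow> pcoeff f (minsert i (fst p)) * pcoeff g (minsert (k - i) (snd p))) =
      (case p of (a, b) \<Rightarrow> pcoeff f a * pcoeff g b)"
      by (simp add: p kb)
  qed (auto simp: minsert_add)
  also have "\<dots> = (\<Sum>i\<le>k. \<Sum>p\<in>{(a, b). a + b = m}.
      pcoeff f (minsert i (fst p)) * pcoeff g (minsert (k - i) (snd p)))"
    by (simp add: sum.cartesian_product)
  also have "\<dots> = pcoeff (\<Sum>i\<le>k. rho i f * rho (k - i) g) m"
    by (simp add: pcoeff_mult case_prod_unfold)
  finally show "pcoeff (rho k (f * g)) m = pcoeff (\<Sum>i\<le>k. rho i f * rho (k - i) g) m" .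
qed

text \<open>The inserted exponent stands first and so belongs to the innermost operator. Symmetry
  moves it to the outermost place, where T_k acts on the index \<kappa>.\<close>

lemma pcoeff_rho_FF: "pcoeff (rho k (FF \<kappa>)) m = Top k (\<lambda>\<nu>. pcoeff (FF \<nu>) m) \<kappa>"
proof -
  obtain n where n: "Poly_Mapping.keys m \<subseteq> {..<n}" using ex_keys_bound by blast
  have "pcoeff (rho k (FF \<kappa>)) m = Tlist (k # expl n m) \<kappa> empty_partition"
    by (simp add: FF_def pcoeff_FF_skew_Tlist[OF keys_minsert[OF n]] expl_minsert)
  also have "\<dots> = Tlist (expl n m @ [k]) \<kappa> empty_partition"
    by (subst Tlist_perm[of "k # expl n m" "expl n m @ [k]"]) simp_all
  finally show ?thesis
    by (simp add: Tlist_snoc kop_def FF_def pcoeff_FF_skew_Tlist[OF n])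
qed

lemma symmetric_rho: "symmetric f \<Longrightarrow> symmetric (rho k f)"
  by (simp add: symmetric_def mswap_minsert[symmetric])

text \<open>Setting the inserted variable to 0 still leaves the alphabet shifted, so symmetry is
  essential; on each F the claim is that T_0 is the identity.\<close>

lemma rho_0: "symmetric f \<Longrightarrow> rho 0 f = f"
proof (rule pseries_eqI)
  fix m assume "symmetric f"
  then have e: "FF_expansion f (expand_coeff f)" by (rule symmetric_expansion)
  have "pcoeff (FF \<kappa>) (minsert 0 m) = pcoeff (FF \<kappa>) m" for \<kappa>
    using pcoeff_rho_FF[of 0 \<kappa> m] by simp
  then show "pcoeff (rho 0 f) m = pcoeff f m"
    using e by (simp add: FF_expansion_iff mdeg_minsert)
qed

text \<open>
  \<open>rho1\<close> and \<open>rho2\<close> collect the coefficients of \<open>v\<^sup>k\<close> when the inserted variable is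
  \<open>x = v / (1 + v)\<close> and \<open>q x\<close>, and \<open>omega\<close> those of the quotient of the two insertions.
\<close>
definition rho1 :: "nat \<Rightarrow> series \<Rightarrow> series"
  where "rho1 k f = (\<Sum>i\<le>k. pscale (sub_coeff k i) (rho i f))"

definition rho2 :: "nat \<Rightarrow> series \<Rightarrow> series"
  where "rho2 k f = (\<Sum>i\<le>k. pscale (q_ind ^ i * sub_coeff k i) (rho i f))"

function omega :: "nat \<Rightarrow> series \<Rightarrow> series" where
  "omega k f = rho2 k f - (\<Sum>j<k. omega j (rho1 (k - j) f))"
  by auto
termination by (relation "measure fst") auto

declare omega.simps [simp del]

lemma rho_sum: "rho k (\<Sum>i\<in>I. pscale (c i) (f i)) = (\<Sum>i\<in>I. pscale (c i) (rho k (f i)))"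
  by (rule pseries_eqI) simp

lemma rho_diff: "rho k (f - g) = rho k f - rho k g"
  by (rule pseries_eqI) simp

lemma rho1_sum: "rho1 k (\<Sum>i\<in>I. pscale (c i) (f i)) = (\<Sum>i\<in>I. pscale (c i) (rho1 k (f i)))"
  by (rule pseries_eqI) (simp add: rho1_def sum_distrib_left mult_ac, subst sum.swap, simp)

lemma rho2_sum: "rho2 k (\<Sum>i\<in>I. pscale (c i) (f i)) = (\<Sum>i\<in>I. pscale (c i) (rho2 k (f i)))"
  by (rule pseries_eqI) (simp add: rho2_def sum_distrib_left mult_ac, subst sum.swap, simp)

lemma rho1_diff: "rho1 k (f - g) = rho1 k f - rho1 k g" and rho2_diff: "rho2 k (f - g) = rho2 k f - rho2 k g"
  by (simp_all add: rho1_def rho2_def rho_diff pseries.scale_right_diff_distrib sum_subtractf)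

lemma omega_sum: "omega k (\<Sum>i\<in>I. pscale (c i) (f i)) = (\<Sum>i\<in>I. pscale (c i) (omega k (f i)))"
proof (induction k arbitrary: f rule: less_induct)
  case (less k)
  have "(\<Sum>j<k. omega j (rho1 (k - j) (\<Sum>i\<in>I. pscale (c i) (f i)))) =
      (\<Sum>j<k. \<Sum>i\<in>I. pscale (c i) (omega j (rho1 (k - j) (f i))))"
    using less by (intro sum.cong refl) (simp add: rho1_sum)
  also have "\<dots> = (\<Sum>i\<in>I. pscale (c i) (\<Sum>j<k. omega j (rho1 (k - j) (f i))))"
    by (subst sum.swap) (simp add: pseries.scale_sum_right)
  finally show ?case
    by (simp add: omega.simps[of k] rho2_sum pseries.scale_right_diff_distrib sum_subtractf)
qed

lemma omega_diff: "omega k (f - g) = omega k f - omega k g"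
proof (induction k arbitrary: f g rule: less_induct)
  case (less k)
  then show ?case by (simp add: omega.simps[of k] rho1_diff rho2_diff sum_subtractf)
qed

lemma rho1_0: "symmetric f \<Longrightarrow> rho1 0 f = f"
  by (simp add: rho1_def sub_coeff_self rho_0)

lemma symmetric_sum_pscale: "(\<And>i. i \<in> I \<Longrightarrow> symmetric (f i)) \<Longrightarrow> symmetric (\<Sum>i\<in>I. pscale (c i) (f i))"
  by (simp add: symmetric_def)

lemma symmetric_rho1: "symmetric f \<Longrightarrow> symmetric (rho1 k f)"
  unfolding rho1_def by (intro symmetric_sum_pscale symmetric_rho)

text \<open>On symmetric series \<open>rho1\<close> starts with the identity, so the recursion for
  \<open>omega\<close> is exactly the convolution equation that defines the quotient.\<close>

lemma omega_rho1: "symmetric f \<Longrightarrow> (\<Sum>j\<le>k. omega j (rho1 (k - j) f)) = rho2 k f"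
  by (simp add: lessThan_Suc_atMost[symmetric] rho1_0 omega.simps[of k])

text \<open>Both sides sum \<open>H j c i d\<close> over j + c + i + d = k. The left groups the
  first and third arguments in \<open>s\<close>, the right groups the first and second in
  \<open>a\<close>.\<close>

lemma sum_antidiagonal3:
  fixes H :: "nat \<Rightarrow> nat \<Rightarrow> nat \<Rightarrow> nat \<Rightarrow> 'a::comm_monoid_add"
  shows "(\<Sum>s\<le>k. \<Sum>c\<le>k - s. \<Sum>j\<le>s. H j c (s - j) (k - s - c)) =
    (\<Sum>a\<le>k. \<Sum>j\<le>a. \<Sum>i\<le>k - a. H j (a - j) i (k - a - i))"
proof -
  have "(\<Sum>s\<le>k. \<Sum>c\<le>k - s. \<Sum>j\<le>s. H j c (s - j) (k - s - c)) =
      (\<Sum>(s, c, j)\<in>(SIGMA s:{..k}. {..k - s} \<times> {..s}). H j c (s - j) (k - s - c))"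
    by (simp add: sum.Sigma sum.cartesian_product)
  also have "\<dots> = (\<Sum>(a, j, i)\<in>(SIGMA a:{..k}. {..a} \<times> {..k - a}). H j (a - j) i (k - a - i))"
    by (rule sum.reindex_bij_witness[of _ "\<lambda>(a, j, i). (j + i, a - j, j)" "\<lambda>(s, c, j). (j + c, j, s - j)"])
      (auto intro!: arg_cong2[where f = "H _ _"])
  also have "\<dots> = (\<Sum>a\<le>k. \<Sum>j\<le>a. \<Sum>i\<le>k - a. H j (a - j) i (k - a - i))"
    by (simp add: sum.Sigma sum.cartesian_product)
  finally show ?thesis .
qed

text \<open>Substituting a multiple of x(v) for the inserted variable preserves products. The
  multiplicative weight \<open>e\<close> covers both cases: 1 for \<open>rho1\<close> and
  \<open>q^i\<close> for \<open>rho2\<close>.\<close>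

lemma sub_rho_mult:
  assumes e: "\<And>i j. e (i + j) = e i * e j"
  shows "(\<Sum>i\<le>k. pscale (e i * sub_coeff k i) (rho i (f * g))) =
    (\<Sum>a\<le>k. (\<Sum>i\<le>a. pscale (e i * sub_coeff a i) (rho i f)) *
      (\<Sum>i\<le>k - a. pscale (e i * sub_coeff (k - a) i) (rho i g)))"
proof -
  let ?R = "\<lambda>i j. rho i f * rho j g"
  \<comment> \<open>Terms with \<open>i > a\<close> vanish, so all sums may run up to
    \<open>k\<close>; with ranges independent of \<open>a\<close>, the sum over \<open>a\<close> can
    be done first.\<close>
  have ext: "(\<Sum>i\<le>a. pscale (e i * sub_coeff a i) (rho i h)) = (\<Sum>i\<le>k. pscale (e i * sub_coeff a i) (rho i h))"
    if "a \<le> k" for a h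
    using that by (intro sum.mono_neutral_left) (auto simp: sub_coeff_eq_0)
  have "(\<Sum>a\<le>k. (\<Sum>i\<le>a. pscale (e i * sub_coeff a i) (rho i f)) *
      (\<Sum>i\<le>k - a. pscale (e i * sub_coeff (k - a) i) (rho i g))) =
    (\<Sum>a\<le>k. \<Sum>i\<le>k. \<Sum>j\<le>k. pscale (e (i + j) * (sub_coeff a i * sub_coeff (k - a) j)) (?R i j))"
    by (intro sum.cong refl)
      (simp add: ext sum_product pscale_mult_left pscale_mult_right e mult_ac)
  also have "\<dots> = (\<Sum>i\<le>k. \<Sum>j\<le>k. \<Sum>a\<le>k. pscale (e (i + j) * (sub_coeff a i * sub_coeff (k - a) j)) (?R i j))"
    by (subst sum.swap) (intro sum.cong refl sum.swap)
  also have "\<dots> = (\<Sum>i\<le>k. \<Sum>j\<le>k. pscale (e (i + j) * sub_coeff k (i + j)) (?R i j))"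
    by (intro sum.cong refl)
      (simp only: pseries.scale_sum_left[symmetric] sum_distrib_left[symmetric] sub_coeff_add)
  also have "\<dots> = (\<Sum>i\<le>k. \<Sum>j\<le>k - i. pscale (e (i + j) * sub_coeff k (i + j)) (?R i j))"
    by (intro sum.cong refl sum.mono_neutral_right) (auto simp: sub_coeff_eq_0)
  also have "\<dots> = (\<Sum>(i, j)\<in>(SIGMA i:{..k}. {..k - i}). pscale (e (i + j) * sub_coeff k (i + j)) (?R i j))"
    by (simp add: sum.Sigma)
  also have "\<dots> = (\<Sum>(n, i)\<in>(SIGMA n:{..k}. {..n}). pscale (e n * sub_coeff k n) (?R i (n - i)))"
    by (rule sum.reindex_bij_witness[of _ "\<lambda>(n, i). (i, n - i)" "\<lambda>(i, j). (i + j, i)"]) auto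
  also have "\<dots> = (\<Sum>n\<le>k. \<Sum>i\<le>n. pscale (e n * sub_coeff k n) (?R i (n - i)))"
    by (simp add: sum.Sigma)
  also have "\<dots> = (\<Sum>i\<le>k. pscale (e i * sub_coeff k i) (rho i (f * g)))"
    by (simp add: rho_mult pseries.scale_sum_right)
  finally show ?thesis by simp
qed

lemma rho1_mult: "rho1 k (f * g) = (\<Sum>a\<le>k. rho1 a f * rho1 (k - a) g)"
  using sub_rho_mult[of "\<lambda>_. 1" k f g] by (simp add: rho1_def)

lemma rho2_mult: "rho2 k (f * g) = (\<Sum>a\<le>k. rho2 a f * rho2 (k - a) g)"
  using sub_rho_mult[of "\<lambda>i. q_ind ^ i" k f g] by (simp add: rho2_def power_add)

lemma omega_sum1: "omega k (\<Sum>i\<in>I. f i) = (\<Sum>i\<in>I. omega k (f i))"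
  using omega_sum[where c = "\<lambda>_. 1"] by simp

text \<open>The convolution equation for the product is compared with the product of the equations
  for \<open>f\<close> and \<open>g\<close>. By induction all terms of order \<open>s < k\<close>
  match; the term \<open>s = k\<close>, where \<open>rho1\<close> acts as the identity, is the
  claim.\<close>

lemma omega_mult:
  "symmetric f \<Longrightarrow> symmetric g \<Longrightarrow> omega k (f * g) = (\<Sum>i\<le>k. omega i f * omega (k - i) g)"
proof (induction k arbitrary: f g rule: less_induct)
  case (less k)
  let ?H = "\<lambda>j c i d. omega j (rho1 c f) * omega i (rho1 d g)"
  let ?S = "\<lambda>s. \<Sum>c\<le>k - s. \<Sum>j\<le>s. ?H j c (s - j) (k - s - c)"
  have "(\<Sum>s<k. omega s (rho1 (k - s) (f * g))) + omega k (f * g) = rho2 k (f * g)"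
    using omega_rho1[OF symmetric_mult[OF less.prems], of k]
    by (simp add: lessThan_Suc_atMost[symmetric] rho1_0 symmetric_mult less.prems)
  also have "\<dots> = (\<Sum>a\<le>k. rho2 a f * rho2 (k - a) g)" by (rule rho2_mult)
  also have "\<dots> = (\<Sum>a\<le>k. \<Sum>j\<le>a. \<Sum>i\<le>k - a. ?H j (a - j) i (k - a - i))"
    by (simp add: omega_rho1[symmetric] less.prems sum_product)
  also have "\<dots> = (\<Sum>s\<le>k. ?S s)" by (rule sum_antidiagonal3[symmetric])
  also have "\<dots> = (\<Sum>s<k. ?S s) + ?S k" by (simp only: lessThan_Suc_atMost[symmetric] sum.lessThan_Suc)
  also have "(\<Sum>s<k. ?S s) = (\<Sum>s<k. omega s (rho1 (k - s) (f * g)))"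
  proof (intro sum.cong refl)
    fix s assume "s \<in> {..<k}"
    then show "?S s = omega s (rho1 (k - s) (f * g))"
      using less.IH[of s] less.prems by (simp add: rho1_mult omega_sum1 symmetric_rho1)
  qed
  also have "?S k = (\<Sum>i\<le>k. omega i f * omega (k - i) g)" by (simp add: rho1_0 less.prems)
  finally show ?case by simp
qed

text \<open>Operators on series act on the index of F in the opposite order, so \<open>omega\<close>
  after \<open>rho1\<close> gives T U, whereas \<open>Uop_Top\<close> concerns U T. Commutation of
  the two families closes the gap.\<close>

lemma pcoeff_omega_FF: "pcoeff (omega k (FF \<kappa>)) m = Uop k (\<lambda>\<nu>. pcoeff (FF \<nu>) m) \<kappa>"
proof (induction k arbitrary: \<kappa> rule: less_induct)
  case (less k)
  let ?\<phi> = "\<lambda>\<nu>. pcoeff (FF \<nu>) m"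
  have rho_FF: "rho i (FF \<kappa>) = (\<Sum>\<nu> | \<nu> \<subseteq>\<^sub>p \<kappa>. pscale (T_coeff i \<kappa> \<nu>) (FF \<nu>))" for i
    by (rule pseries_eqI) (simp only: pcoeff_rho_FF, simp add: kop_def)
  have "pcoeff (omega j (rho1 (k - j) (FF \<kappa>))) m = (\<Sum>i\<le>k - j. sub_coeff (k - j) i * Uop j (Top i ?\<phi>) \<kappa>)"
    if j: "j < k" for j
  proof -
    have "pcoeff (omega j (rho1 (k - j) (FF \<kappa>))) m = (\<Sum>i\<le>k - j. sub_coeff (k - j) i *
        (\<Sum>\<nu> | \<nu> \<subseteq>\<^sub>p \<kappa>. T_coeff i \<kappa> \<nu> * Uop j ?\<phi> \<nu>))"
      unfolding rho1_def rho_FF omega_sum by (simp add: less[OF j])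
    also have "\<dots> = (\<Sum>i\<le>k - j. sub_coeff (k - j) i * Top i (Uop j ?\<phi>) \<kappa>)" by (simp add: kop_def)
    finally show ?thesis by (simp only: Uop_Top_commute)
  qed
  then have "pcoeff (omega k (FF \<kappa>)) m = pcoeff (rho2 k (FF \<kappa>)) m -
      (\<Sum>j<k. \<Sum>i\<le>k - j. sub_coeff (k - j) i * Uop j (Top i ?\<phi>) \<kappa>)"
    by (simp add: omega.simps[of k])
  also have "pcoeff (rho2 k (FF \<kappa>)) m = (\<Sum>i\<le>k. q_ind ^ i * sub_coeff k i * Top i ?\<phi> \<kappa>)"
    using pcoeff_rho_FF[of _ \<kappa> m] by (simp add: rho2_def)
  also have "\<dots> = (\<Sum>j<k. \<Sum>i\<le>k - j. sub_coeff (k - j) i * Uop j (Top i ?\<phi>) \<kappa>) + Uop k ?\<phi> \<kappa>"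
    unfolding Uop_Top[symmetric] by (simp add: lessThan_Suc_atMost[symmetric] sub_coeff_self)
  finally show ?case by simp
qed

section \<open>Finiteness of products\<close>

text \<open>Measures how far an operator can be trusted on a truncated expansion: those of order
  \<open>k\<close> look at most \<open>k\<close> degrees ahead.\<close>

definition vanishes_to :: "nat \<Rightarrow> series \<Rightarrow> bool"
  where "vanishes_to D f \<longleftrightarrow> (\<forall>m. mdeg m \<le> D \<longrightarrow> pcoeff f m = 0)"

lemma rho_vanishes_to: "vanishes_to (D + k) f \<Longrightarrow> vanishes_to D (rho k f)"
  by (simp add: vanishes_to_def mdeg_minsert)

lemma sub_rho_vanishes_to:
  "vanishes_to (D + k) f \<Longrightarrow> vanishes_to D (rho1 k f)" "vanishes_to (D + k) f \<Longrightarrow> vanishes_to D (rho2 k f)"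
  by (auto simp: vanishes_to_def rho1_def rho2_def mdeg_minsert)

lemma omega_vanishes_to: "vanishes_to (D + k) f \<Longrightarrow> vanishes_to D (omega k f)"
proof (induction k arbitrary: f rule: less_induct)
  case (less k)
  have "vanishes_to D (omega j (rho1 (k - j) f))" if "j < k" for j
  proof (rule less.IH[OF that])
    show "vanishes_to (D + j) (rho1 (k - j) f)"
      using less.prems that by (intro sub_rho_vanishes_to) simp
  qed
  then show ?case
    using sub_rho_vanishes_to(2)[OF less.prems] by (simp add: omega.simps[of k] vanishes_to_def)
qed

text \<open>Applies an operator term by term to an infinite expansion and reads off the coefficient
  at \<kappa>, which must be 0 by uniqueness. Locality and the size bound on \<open>E\<close> keep
  all sums finite. It serves \<open>rho\<close> with the kernel of T and \<open>omega\<close> with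
  that of U.\<close>

lemma expansion_kernel_zero:
  assumes sum: "\<And>I c g. \<Omega> (\<Sum>i\<in>(I :: partition set). pscale (c i) (g i)) = (\<Sum>i\<in>I. pscale (c i) (\<Omega> (g i :: series)))"
    and diff: "\<And>f g. \<Omega> (f - g) = \<Omega> f - \<Omega> g"
    and loc: "\<And>D f. vanishes_to (D + k) f \<Longrightarrow> vanishes_to D (\<Omega> f)"
    and FF: "\<And>\<alpha> m. pcoeff (\<Omega> (FF \<alpha>)) m = kop E (\<lambda>\<nu>. pcoeff (FF \<nu>) m) \<alpha>"
    and tri: "triangular E" and E: "\<And>\<alpha> \<kappa>. E \<alpha> \<kappa> \<noteq> 0 \<Longrightarrow> psize \<alpha> \<le> psize \<kappa> + k"
    and c: "FF_expansion f c" and 0: "\<Omega> f = 0"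
  shows "(\<Sum>\<alpha> | psize \<alpha> \<le> psize \<kappa> + k. c \<alpha> * E \<alpha> \<kappa>) = 0"
proof -
  define d where "d \<kappa> = (\<Sum>\<alpha> | psize \<alpha> \<le> psize \<kappa> + k. c \<alpha> * E \<alpha> \<kappa>)" for \<kappa>
  have "FF_expansion 0 d"
    unfolding FF_expansion_iff
  proof
    fix m
    let ?D = "mdeg m + k" and ?\<phi> = "\<lambda>\<nu>. pcoeff (FF \<nu>) m"
    let ?A = "{\<alpha>. psize \<alpha> \<le> mdeg m + k}" and ?B = "{\<kappa>. psize \<kappa> \<le> mdeg m}"
    \<comment> \<open>The expansion is cut at degree \<open>mdeg m + k\<close>, so that the error
      still vanishes at \<open>m\<close> after the operator has used up \<open>k\<close>
      degrees.\<close>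
    define g where "g = (\<Sum>\<alpha>\<in>?A. pscale (c \<alpha>) (FF \<alpha>))"
    have "vanishes_to ?D (f - g)"
      unfolding vanishes_to_def g_def using FF_expansion_bound[OF c] by simp
    then have "vanishes_to (mdeg m) (\<Omega> (f - g))" by (rule loc)
    then have "pcoeff (\<Omega> (f - g)) m = 0" by (simp add: vanishes_to_def)
    then have "0 - pcoeff (\<Omega> g) m = 0" by (simp only: diff 0 pcoeff_minus pcoeff_zero)
    then have "pcoeff (\<Omega> g) m = 0" by simp
    moreover have "pcoeff (\<Omega> g) m = (\<Sum>\<alpha>\<in>?A. c \<alpha> * kop E ?\<phi> \<alpha>)"
      by (simp add: g_def sum FF)
    moreover have "kop E ?\<phi> \<alpha> = (\<Sum>\<kappa>\<in>?B. E \<alpha> \<kappa> * ?\<phi> \<kappa>)" for \<alpha>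
    proof -
      have "kop E ?\<phi> \<alpha> = (\<Sum>\<kappa>\<in>{\<kappa>. \<kappa> \<subseteq>\<^sub>p \<alpha>} \<union> ?B. E \<alpha> \<kappa> * ?\<phi> \<kappa>)"
        unfolding kop_def using tri
        by (intro sum.mono_neutral_left) (auto simp: finite_contained finite_psize_le triangular_def)
      also have "\<dots> = (\<Sum>\<kappa>\<in>?B. E \<alpha> \<kappa> * ?\<phi> \<kappa>)"
        using FF_coeff_size by (intro sum.mono_neutral_right) (auto simp: finite_contained finite_psize_le)
      finally show ?thesis .
    qed
    ultimately have "0 = (\<Sum>\<alpha>\<in>?A. \<Sum>\<kappa>\<in>?B. c \<alpha> * E \<alpha> \<kappa> * ?\<phi> \<kappa>)"
      by (simp add: sum_distrib_left mult.assoc)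
    also have "\<dots> = (\<Sum>\<kappa>\<in>?B. (\<Sum>\<alpha>\<in>?A. c \<alpha> * E \<alpha> \<kappa>) * ?\<phi> \<kappa>)"
      by (subst sum.swap) (simp add: sum_distrib_right)
    also have "\<dots> = (\<Sum>\<kappa>\<in>?B. d \<kappa> * ?\<phi> \<kappa>)"
    proof (intro sum.cong refl arg_cong2[where f = times])
      fix \<kappa> assume "\<kappa> \<in> ?B"
      then show "(\<Sum>\<alpha>\<in>?A. c \<alpha> * E \<alpha> \<kappa>) = d \<kappa>"
        unfolding d_def using E by (intro sum.mono_neutral_right finite_psize_le) auto
    qed
    finally show "pcoeff 0 m = (\<Sum>\<kappa> | psize \<kappa> \<le> mdeg m. d \<kappa> * pcoeff (FF \<kappa>) m)" by simp
  qed
  then show ?thesis using FF_expansion_zero[of d \<kappa>] by (simp add: d_def)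
qed

lift_definition drop_row :: "partition \<Rightarrow> partition" is "\<lambda>f i. f (Suc i)"
proof -
  fix f :: "nat \<Rightarrow> nat" assume f: "antimono f \<and> finite {i. f i \<noteq> 0}"
  then have "finite (Suc -` {i. f i \<noteq> 0})" by (intro finite_vimageI) simp_all
  then show "antimono (\<lambda>i. f (Suc i)) \<and> finite {i. f (Suc i) \<noteq> 0}"
    using f by (simp add: vimage_def antimono_def)
qed

lift_definition drop_column :: "partition \<Rightarrow> partition" is "\<lambda>f i. f i - 1"
proof -
  fix f :: "nat \<Rightarrow> nat" assume f: "antimono f \<and> finite {i. f i \<noteq> 0}"
  then have "finite {i. f i - 1 \<noteq> 0}" by (auto intro: finite_subset[of _ "{i. f i \<noteq> 0}"])
  then show "antimono (\<lambda>i. f i - 1) \<and> finite {i. f i - 1 \<noteq> 0}"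
    using f by (auto simp: antimono_def diff_le_mono)
qed

lemma psize_drop_row: "psize \<kappa> = psize (drop_row \<kappa>) + part \<kappa> 0"
proof -
  let ?N = "Suc (plength \<kappa>)"
  have "plength (drop_row \<kappa>) \<le> plength \<kappa>"
    using part_eq_0_iff[of "drop_row \<kappa>" "plength \<kappa>"] part_eq_0_iff[of \<kappa> "Suc (plength \<kappa>)"]
    by (simp add: drop_row.rep_eq)
  then have "psize (drop_row \<kappa>) = (\<Sum>i<plength \<kappa>. part \<kappa> (Suc i))"
    by (simp add: psize_eq_sum[of "drop_row \<kappa>" "plength \<kappa>"] drop_row.rep_eq)
  moreover have "psize \<kappa> = part \<kappa> 0 + (\<Sum>i<plength \<kappa>. part \<kappa> (Suc i))"
    by (simp only: psize_eq_sum[of \<kappa> ?N, OF le_SucI[OF order_refl]] sum.lessThan_Suc_shift)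
  ultimately show ?thesis by simp
qed

lemma psize_drop_column: "psize \<kappa> = psize (drop_column \<kappa>) + plength \<kappa>"
proof -
  let ?N = "plength \<kappa>"
  have c: "drop_column \<kappa> \<subseteq>\<^sub>p \<kappa>" by (simp add: contained_iff drop_column.rep_eq)
  have "psize \<kappa> = (\<Sum>i<?N. part \<kappa> i)" by (simp add: psize_eq_sum)
  also have "\<dots> = (\<Sum>i<?N. part (drop_column \<kappa>) i + 1)"
  proof (intro sum.cong refl)
    fix i assume "i \<in> {..<?N}"
    then have "part \<kappa> i \<noteq> 0" using part_eq_0_iff[of \<kappa> i] by simp
    then show "part \<kappa> i = part (drop_column \<kappa>) i + 1" by (simp add: drop_column.rep_eq)
  qed
  also have "\<dots> = psize (drop_column \<kappa>) + ?N"
    using contained_plength[OF c] by (simp only: sum.distrib psize_eq_sum[of "drop_column \<kappa>" ?N]) simp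
  finally show ?thesis .
qed

text \<open>Apply T_k with k the first part of \<kappa> and look at \<kappa> without its first row.
  Any other \<alpha> with a nonzero entry there has first part at least k, and is either smaller
  than \<kappa> or of the same size with a longer first row. By induction only \<kappa> remains, and
  its entry is nonzero.\<close>

lemma expansion_part_0_bound:
  assumes c: "FF_expansion f c" and 0: "\<And>k. K < k \<Longrightarrow> rho k f = 0"
  shows "K < part \<kappa> 0 \<Longrightarrow> c \<kappa> = 0"
\<comment> \<open>The second measure places longer first rows earlier among partitions of the same
  size.\<close>
proof (induction \<kappa> rule: wf_induct_rule[OF wf_measures[of "[psize, \<lambda>\<kappa>. psize \<kappa> - part \<kappa> 0]"]])
  case (1 \<kappa>)
  let ?k = "part \<kappa> 0" and ?\<mu> = "drop_row \<kappa>"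
  have h: "?\<mu> \<prec>\<^sub>h \<kappa>" by (simp add: horizontal_strip_iff drop_row.rep_eq part_antimono)
  have sz: "psize \<kappa> = psize ?\<mu> + ?k" by (rule psize_drop_row)
  have "c \<alpha> * T_coeff ?k \<alpha> ?\<mu> = 0" if "\<alpha> \<noteq> \<kappa>" for \<alpha>
  proof (cases "T_coeff ?k \<alpha> ?\<mu> = 0")
    case False
    note T = T_coeff_nonzeroD[OF False]
    have le: "psize \<alpha> \<le> psize \<kappa>" using T(2) sz by simp
    have r: "part \<alpha> (Suc r) \<le> part \<kappa> (Suc r)" for r
      using T(1) by (simp add: horizontal_strip_iff drop_row.rep_eq)
    have "psize \<alpha> < psize \<kappa> \<or> psize \<alpha> = psize \<kappa> \<and> ?k < part \<alpha> 0"
    proof (rule ccontr)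
      assume "\<not> ?thesis"
      then have e: "psize \<alpha> = psize \<kappa>" "part \<alpha> 0 = ?k" using le T(3) by auto
      have "part \<alpha> i \<le> part \<kappa> i" for i using r e(2) by (cases i) simp_all
      then have "\<alpha> = \<kappa>" using e(1) by (intro psize_mono_eq) (simp_all add: contained_iff)
      then show False using that by simp
    qed
    then have "(\<alpha>, \<kappa>) \<in> measures [psize, \<lambda>\<kappa>. psize \<kappa> - part \<kappa> 0]"
      using part_0_le_psize[of \<alpha>] by auto
    then show ?thesis using 1 T(3) by simp
  qed simp
  then have "(\<Sum>\<alpha> | psize \<alpha> \<le> psize ?\<mu> + ?k. c \<alpha> * T_coeff ?k \<alpha> ?\<mu>) =
      (\<Sum>\<alpha>\<in>{\<kappa>}. c \<alpha> * T_coeff ?k \<alpha> ?\<mu>)"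
    using sz by (intro sum.mono_neutral_right finite_psize_le) auto
  moreover have "(\<Sum>\<alpha> | psize \<alpha> \<le> psize ?\<mu> + ?k. c \<alpha> * T_coeff ?k \<alpha> ?\<mu>) = 0"
    by (rule expansion_kernel_zero[where \<Omega> = "rho ?k", OF rho_sum rho_diff rho_vanishes_to pcoeff_rho_FF
          triangular_T T_coeff_nonzeroD(2) c 0[OF 1(2)]])
  moreover have "T_coeff ?k \<kappa> ?\<mu> \<noteq> 0" using T_coeff_lowest[OF h] sz by simp
  ultimately show ?case by simp
qed

text \<open>The column analogue: U_k with k the length of \<kappa>, read at \<kappa> without its
  first column. Competing partitions of the same size have more rows.\<close>

lemma expansion_plength_bound:
  assumes c: "FF_expansion f c" and 0: "\<And>k. K < k \<Longrightarrow> omega k f = 0"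
  shows "K < plength \<kappa> \<Longrightarrow> c \<kappa> = 0"
proof (induction \<kappa> rule: wf_induct_rule[OF wf_measures[of "[psize, \<lambda>\<kappa>. psize \<kappa> - plength \<kappa>]"]])
  case (1 \<kappa>)
  let ?k = "plength \<kappa>" and ?\<mu> = "drop_column \<kappa>"
  have sz: "psize \<kappa> = psize ?\<mu> + ?k" by (rule psize_drop_column)
  have "c \<alpha> * U_coeff ?k \<alpha> ?\<mu> = 0" if "\<alpha> \<noteq> \<kappa>" for \<alpha>
  proof (cases "U_coeff ?k \<alpha> ?\<mu> = 0")
    case False
    note U = U_coeff_nonzeroD[OF False]
    have le: "psize \<alpha> \<le> psize \<kappa>" using U(3) sz by simp
    have "psize \<alpha> < psize \<kappa> \<or> psize \<alpha> = psize \<kappa> \<and> ?k < plength \<alpha>"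
    proof (rule ccontr)
      assume "\<not> ?thesis"
      then have e: "psize \<alpha> = psize \<kappa>" "plength \<alpha> = ?k" using le U(4) by auto
      have "part \<alpha> i \<le> part \<kappa> i" for i
      proof (cases "i < ?k")
        case True
        then have "part \<kappa> i \<noteq> 0" by (simp add: part_eq_0_iff)
        then show ?thesis using U(2)[of i] by (auto simp: drop_column.rep_eq)
      next
        case False
        then show ?thesis using e(2) part_eq_0_iff[of \<alpha> i] by simp
      qed
      then have "\<alpha> = \<kappa>" using e(1) by (intro psize_mono_eq) (simp_all add: contained_iff)
      then show False using that by simp
    qed
    then have "(\<alpha>, \<kappa>) \<in> measures [psize, \<lambda>\<kappa>. psize \<kappa> - plength \<kappa>]"
      using plength_le_psize[of \<alpha>] by auto
    then show ?thesis using 1 U(4) by simp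
  qed simp
  then have "(\<Sum>\<alpha> | psize \<alpha> \<le> psize ?\<mu> + ?k. c \<alpha> * U_coeff ?k \<alpha> ?\<mu>) =
      (\<Sum>\<alpha>\<in>{\<kappa>}. c \<alpha> * U_coeff ?k \<alpha> ?\<mu>)"
    using sz by (intro sum.mono_neutral_right finite_psize_le) auto
  moreover have "(\<Sum>\<alpha> | psize \<alpha> \<le> psize ?\<mu> + ?k. c \<alpha> * U_coeff ?k \<alpha> ?\<mu>) = 0"
    by (rule expansion_kernel_zero[where \<Omega> = "omega ?k", OF omega_sum omega_diff omega_vanishes_to pcoeff_omega_FF
          triangular_U U_coeff_nonzeroD(3) c 0[OF 1(2)]])
  moreover have "U_coeff ?k \<kappa> ?\<mu> \<noteq> 0"
    by (rule U_coeff_first_column) (simp add: drop_column.rep_eq)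
  ultimately show ?case by simp
qed

lemma rho_FF_eq_0: "part \<kappa> 0 < k \<Longrightarrow> rho k (FF \<kappa>) = 0"
proof (rule pseries_eqI)
  fix m assume "part \<kappa> 0 < k"
  then have "T_coeff k \<kappa> \<nu> = 0" for \<nu> using T_coeff_nonzeroD(3)[of k \<kappa> \<nu>] by (meson not_le)
  then show "pcoeff (rho k (FF \<kappa>)) m = pcoeff 0 m" by (simp only: pcoeff_rho_FF) (simp add: kop_def)
qed

lemma omega_FF_eq_0: "plength \<kappa> < k \<Longrightarrow> omega k (FF \<kappa>) = 0"
proof (rule pseries_eqI)
  fix m assume "plength \<kappa> < k"
  then have "U_coeff k \<kappa> \<nu> = 0" for \<nu> using U_coeff_nonzeroD(4)[of k \<kappa> \<nu>] by (meson not_le)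
  then show "pcoeff (omega k (FF \<kappa>)) m = pcoeff 0 m" by (simp add: pcoeff_omega_FF kop_def)
qed

lemma FF_mult_expansion: "FF_expansion (FF \<nu> * FF \<mu>) (expand_coeff (FF \<nu> * FF \<mu>))"
  by (intro symmetric_expansion symmetric_mult symmetric_FF)

text \<open>In a convolution of order above the sum of the two bounds, every term has a factor
  beyond its own bound. Bounded length and bounded first part leave finitely many
  partitions.\<close>

lemma FF_mult_finite:
  assumes c: "FF_expansion (FF \<nu> * FF \<mu>) c"
  shows "finite {\<kappa>. c \<kappa> \<noteq> 0}"
proof -
  let ?a = "plength \<nu> + plength \<mu>" and ?b = "part \<nu> 0 + part \<mu> 0"
  have "rho k (FF \<nu> * FF \<mu>) = 0" if "?b < k" for k
    unfolding rho_mult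
  proof (intro sum.neutral ballI)
    fix i
    show "rho i (FF \<nu>) * rho (k - i) (FF \<mu>) = 0"
      using that rho_FF_eq_0[of \<nu> i] rho_FF_eq_0[of \<mu> "k - i"] by (cases "part \<nu> 0 < i") auto
  qed
  then have 1: "part \<kappa> 0 \<le> ?b" if "c \<kappa> \<noteq> 0" for \<kappa>
    using expansion_part_0_bound[OF c, of ?b \<kappa>] that by (meson not_le)
  have "omega k (FF \<nu> * FF \<mu>) = 0" if "?a < k" for k
    unfolding omega_mult[OF symmetric_FF symmetric_FF]
  proof (intro sum.neutral ballI)
    fix i
    show "omega i (FF \<nu>) * omega (k - i) (FF \<mu>) = 0"
      using that omega_FF_eq_0[of \<nu> i] omega_FF_eq_0[of \<mu> "k - i"] by (cases "plength \<nu> < i") auto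
  qed
  then have 2: "plength \<kappa> \<le> ?a" if "c \<kappa> \<noteq> 0" for \<kappa>
    using expansion_plength_bound[OF c, of ?a \<kappa>] that by (meson not_le)
  show ?thesis
    by (rule finite_subset[OF _ finite_bounded_partitions[of ?a ?b]]) (use 1 2 in auto)
qed

section \<open>Finite expansions, linear independence and the unit\<close>

lemma FF_expansion_finite:
  assumes c: "FF_expansion f c" and fin: "finite {\<kappa>. c \<kappa> \<noteq> 0}"
  shows "f = (\<Sum>\<kappa> | c \<kappa> \<noteq> 0. pscale (c \<kappa>) (FF \<kappa>))"
proof (rule pseries_eqI)
  fix m
  have "pcoeff f m = (\<Sum>\<kappa> | c \<kappa> * pcoeff (FF \<kappa>) m \<noteq> 0. c \<kappa> * pcoeff (FF \<kappa>) m)"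
    using c by (simp add: FF_expansion_def)
  also have "\<dots> = (\<Sum>\<kappa> | c \<kappa> \<noteq> 0. c \<kappa> * pcoeff (FF \<kappa>) m)"
    using fin by (intro sum.mono_neutral_left) auto
  finally show "pcoeff f m = pcoeff (\<Sum>\<kappa> | c \<kappa> \<noteq> 0. pscale (c \<kappa>) (FF \<kappa>)) m" by simp
qed

lemma FF_mult_mem: "FF \<nu> * FF \<mu> \<in> Gamma_q"
  unfolding Gamma_q_def
  by (subst FF_expansion_finite[OF FF_mult_expansion FF_mult_finite[OF FF_mult_expansion]])
    (intro pseries.span_sum pseries.span_scale pseries.span_base rangeI)

lemma FF_expansion_sum:
  assumes "finite S"
  shows "FF_expansion (\<Sum>\<kappa>\<in>S. pscale (c \<kappa>) (FF \<kappa>)) (\<lambda>\<kappa>. if \<kappa> \<in> S then c \<kappa> else 0)"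
  unfolding FF_expansion_iff
proof
  fix m
  have "(\<Sum>\<kappa> | psize \<kappa> \<le> mdeg m. (if \<kappa> \<in> S then c \<kappa> else 0) * pcoeff (FF \<kappa>) m) =
      (\<Sum>\<kappa>\<in>{\<kappa>. psize \<kappa> \<le> mdeg m} \<union> S. (if \<kappa> \<in> S then c \<kappa> else 0) * pcoeff (FF \<kappa>) m)"
    using FF_coeff_size assms by (intro sum.mono_neutral_left) (auto simp: finite_psize_le)
  also have "\<dots> = (\<Sum>\<kappa>\<in>S. c \<kappa> * pcoeff (FF \<kappa>) m)"
    using assms by (intro sum.mono_neutral_cong_right) (auto simp: finite_psize_le)
  finally show "pcoeff (\<Sum>\<kappa>\<in>S. pscale (c \<kappa>) (FF \<kappa>)) m =
      (\<Sum>\<kappa> | psize \<kappa> \<le> mdeg m. (if \<kappa> \<in> S then c \<kappa> else 0) * pcoeff (FF \<kappa>) m)" by simp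
qed

lemma FF_sum_zero:
  assumes "finite S" "(\<Sum>\<kappa>\<in>S. pscale (c \<kappa>) (FF \<kappa>)) = 0" "\<kappa> \<in> S"
  shows "c \<kappa> = 0"
  using FF_expansion_zero[of "\<lambda>\<kappa>. if \<kappa> \<in> S then c \<kappa> else 0" \<kappa>] FF_expansion_sum[OF assms(1), of c] assms(2,3)
  by simp

lemma inj_FF: "inj FF"
proof (rule injI, rule ccontr)
  fix \<kappa> \<mu> assume e: "FF \<kappa> = FF \<mu>" and ne: "\<kappa> \<noteq> \<mu>"
  let ?c = "\<lambda>\<nu>. if \<nu> = \<kappa> then 1 else - 1 :: Rq"
  have "(\<Sum>\<nu>\<in>{\<kappa>, \<mu>}. pscale (?c \<nu>) (FF \<nu>)) = 0" using e ne by simp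
  then have "?c \<kappa> = 0" using FF_sum_zero[of "{\<kappa>, \<mu>}" ?c \<kappa>] by simp
  then show False by simp
qed

lemma independent_FF: "pseries.independent (range FF)"
  unfolding pseries.independent_explicit_module
proof (intro allI impI)
  fix t u v assume t: "finite t" "t \<subseteq> range FF" "(\<Sum>v\<in>t. pscale (u v) v) = 0" "v \<in> t"
  obtain S where S: "finite S" "t = FF ` S" using t(1,2) by (metis finite_subset_image)
  obtain \<kappa> where \<kappa>: "\<kappa> \<in> S" "v = FF \<kappa>" using t(4) S(2) by blast
  have "(\<Sum>\<nu>\<in>S. pscale (u (FF \<nu>)) (FF \<nu>)) = 0"
    using t(3) unfolding S(2) by (subst (asm) sum.reindex) (auto intro: inj_on_subset[OF inj_FF])
  then show "u v = 0" using FF_sum_zero[OF S(1) _ \<kappa>(1), of "\<lambda>\<nu>. u (FF \<nu>)"] \<kappa>(2) by simp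
qed

text \<open>Symmetry makes a positive exponent outermost, and T_k with k > 0 has no entries in the
  row of the empty partition.\<close>

lemma FF_empty: "FF empty_partition = 1"
proof (rule pseries_eqI)
  fix m :: "nat \<Rightarrow>\<^sub>0 nat"
  show "pcoeff (FF empty_partition) m = pcoeff 1 m"
  proof (cases "m = 0")
    case True
    then show ?thesis
      using pcoeff_FF_skew_Tlist[of m 0 empty_partition empty_partition]
      by (simp add: FF_def expl_def Tlist_def dirac_def pcoeff_one)
  next
    case False
    then obtain i where i: "Poly_Mapping.lookup m i \<noteq> 0" by (metis lookup_zero poly_mapping_eqI)
    obtain n where n: "Poly_Mapping.keys m \<subseteq> {..<n}" using ex_keys_bound by blast
    moreover have "i \<in> Poly_Mapping.keys m" using i by (simp add: in_keys_iff)
    ultimately have "i < n" by blast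
    then have "Poly_Mapping.lookup m i \<in> set (expl n m)" by (simp add: expl_def)
    then obtain as bs where e: "expl n m = as @ Poly_Mapping.lookup m i # bs" by (meson split_list)
    let ?k = "Poly_Mapping.lookup m i"
    have "pcoeff (FF empty_partition) m = Tlist (as @ ?k # bs) empty_partition empty_partition"
      using pcoeff_FF_skew_Tlist[OF n] by (simp add: FF_def e)
    also have "\<dots> = Tlist ((as @ bs) @ [?k]) empty_partition empty_partition"
      by (subst Tlist_perm[of "as @ ?k # bs" "(as @ bs) @ [?k]"]) simp_all
    also have "\<dots> = 0"
    proof -
      have "T_coeff ?k empty_partition \<nu> = 0" for \<nu>
        using T_coeff_nonzeroD(3)[of ?k empty_partition \<nu>] i by auto
      then show ?thesis by (simp only: Tlist_snoc) simp
    qed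
    finally show ?thesis using False by (simp add: pcoeff_one)
  qed
qed

section \<open>The bialgebra structure\<close>

text \<open>Two infinite alphabets must be merged into one. Interleaving by parity keeps finitely
  many variables of both inside an initial window, as the list description of coefficients
  requires.\<close>

lift_definition minter :: "(nat \<Rightarrow>\<^sub>0 nat) \<Rightarrow> (nat \<Rightarrow>\<^sub>0 nat) \<Rightarrow> (nat \<Rightarrow>\<^sub>0 nat)"
  is "\<lambda>a b i. if even i then a (i div 2) else b (i div 2)"
proof -
  fix a b :: "nat \<Rightarrow> nat" assume f: "finite {i. a i \<noteq> 0}" "finite {i. b i \<noteq> 0}"
  have "{i. (if even i then a (i div 2) else b (i div 2)) \<noteq> 0} \<subseteq>
      (\<lambda>i. 2 * i) ` {i. a i \<noteq> 0} \<union> (\<lambda>i. 2 * i + 1) ` {i. b i \<noteq> 0}"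
  proof
    fix i assume i: "i \<in> {i. (if even i then a (i div 2) else b (i div 2)) \<noteq> 0}"
    show "i \<in> (\<lambda>i. 2 * i) ` {i. a i \<noteq> 0} \<union> (\<lambda>i. 2 * i + 1) ` {i. b i \<noteq> 0}"
    proof (cases "even i")
      case True
      then have "i = 2 * (i div 2)" by simp
      then show ?thesis using i True by (intro UnI1 image_eqI[of _ _ "i div 2"]) simp_all
    next
      case False
      then have "i = 2 * (i div 2) + 1" by presburger
      then show ?thesis using i False by (intro UnI2 image_eqI[of _ _ "i div 2"]) simp_all
    qed
  qed
  then show "finite {i. (if even i then a (i div 2) else b (i div 2)) \<noteq> 0}"
    by (rule finite_subset) (use f in simp)
qed

lift_definition mevens :: "(nat \<Rightarrow>\<^sub>0 nat) \<Rightarrow> (nat \<Rightarrow>\<^sub>0 nat)" is "\<lambda>m i. m (2 * i)"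
proof -
  fix m :: "nat \<Rightarrow> nat" assume "finite {j. m j \<noteq> 0}"
  then have "finite ((\<lambda>i. 2 * i) -` {j. m j \<noteq> 0})" by (rule finite_vimageI) (simp add: inj_on_def)
  then show "finite {i. m (2 * i) \<noteq> 0}" by (simp add: vimage_def)
qed

lift_definition modds :: "(nat \<Rightarrow>\<^sub>0 nat) \<Rightarrow> (nat \<Rightarrow>\<^sub>0 nat)" is "\<lambda>m i. m (Suc (2 * i))"
proof -
  fix m :: "nat \<Rightarrow> nat" assume "finite {j. m j \<noteq> 0}"
  then have "finite ((\<lambda>i. Suc (2 * i)) -` {j. m j \<noteq> 0})" by (rule finite_vimageI) (simp add: inj_on_def)
  then show "finite {i. m (Suc (2 * i)) \<noteq> 0}" by (simp add: vimage_def)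
qed

lemma mevens_minter [simp]: "mevens (minter a b) = a" and modds_minter [simp]: "modds (minter a b) = b"
  by (rule poly_mapping_eqI; simp add: mevens.rep_eq modds.rep_eq minter.rep_eq)+

lemma minter_mevens_modds [simp]: "minter (mevens m) (modds m) = m"
proof (rule poly_mapping_eqI)
  fix i
  show "Poly_Mapping.lookup (minter (mevens m) (modds m)) i = Poly_Mapping.lookup m i"
    by (cases "even i") (simp_all add: mevens.rep_eq modds.rep_eq minter.rep_eq)
qed

lemma minter_add: "minter a b + minter c d = minter (a + c) (b + d)"
  by (rule poly_mapping_eqI) (simp add: minter.rep_eq lookup_add)

lemma mevens_add: "mevens (a + b) = mevens a + mevens b" and modds_add: "modds (a + b) = modds a + modds b"
  by (rule poly_mapping_eqI; simp add: mevens.rep_eq modds.rep_eq lookup_add)+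

section \<open>The coproduct as a splitting of the alphabet\<close>

definition Delta :: "series \<Rightarrow> ((nat \<Rightarrow>\<^sub>0 nat) \<times> (nat \<Rightarrow>\<^sub>0 nat), Rq) pseries"
  where "Delta f = PSeries (\<lambda>(a, b). pcoeff f (minter a b))"

lemma pcoeff_Delta [simp]: "pcoeff (Delta f) (a, b) = pcoeff f (minter a b)"
  by (simp add: Delta_def PSeries_inverse)

lemma pseries_eqI2: "(\<And>a b. pcoeff f (a, b) = pcoeff g (a, b)) \<Longrightarrow> f = g"
  by (rule pseries_eqI) auto

lemma Delta_mult: "Delta (f * g) = Delta f * Delta g"
proof (rule pseries_eqI2)
  fix a b
  have "pcoeff (Delta (f * g)) (a, b) = (\<Sum>(m, m') | m + m' = minter a b. pcoeff f m * pcoeff g m')"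
    by (simp add: pcoeff_mult)
  also have "\<dots> = (\<Sum>(p, r) | p + r = (a, b). pcoeff (Delta f) p * pcoeff (Delta g) r)"
  proof (rule sum.reindex_bij_witness[of _ "\<lambda>(p, r). (minter (fst p) (snd p), minter (fst r) (snd r))"
        "\<lambda>(m, m'). ((mevens m, modds m), (mevens m', modds m'))"])
    fix p assume "p \<in> {(m, m'). m + m' = minter a b}"
    then obtain m m' where p: "p = (m, m')" and e: "m + m' = minter a b" by auto
    have "mevens m + mevens m' = a" "modds m + modds m' = b"
      using arg_cong[OF e, of mevens] arg_cong[OF e, of modds] by (simp_all add: mevens_add modds_add)
    then show "(\<lambda>(m, m'). ((mevens m, modds m), (mevens m', modds m'))) p \<in> {(p, r). p + r = (a, b)}"
      by (simp add: p)
  qed (auto simp: minter_add)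
  finally show "pcoeff (Delta (f * g)) (a, b) = pcoeff (Delta f * Delta g) (a, b)" by (simp add: pcoeff_mult)
qed

lemma Delta_one: "Delta 1 = 1"
proof (rule pseries_eqI2)
  fix a b :: "nat \<Rightarrow>\<^sub>0 nat"
  have z: "minter 0 0 = 0" by (rule poly_mapping_eqI) (simp add: minter.rep_eq)
  have "minter a b = 0 \<longleftrightarrow> a = 0 \<and> b = 0"
    using z by (metis mevens_minter modds_minter)
  then show "pcoeff (Delta 1) (a, b) = pcoeff 1 (a, b)" by (simp add: pcoeff_one zero_prod_def)
qed

lemma expl_Suc: "expl (Suc n) m = expl n m @ [Poly_Mapping.lookup m n]"
  by (simp add: expl_def)

lemma mset_expl_minter: "mset (expl (2 * n) (minter a b)) = mset (expl n a) + mset (expl n b)"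
proof (induction n)
  case 0
  show ?case by (simp add: expl_def)
next
  case (Suc n)
  have "expl (2 * Suc n) (minter a b) =
      expl (2 * n) (minter a b) @ [Poly_Mapping.lookup a n, Poly_Mapping.lookup b n]"
    by (simp add: expl_Suc minter.rep_eq)
  then show ?case using Suc by (simp add: expl_Suc)
qed

lemma keys_minter:
  assumes "Poly_Mapping.keys a \<subseteq> {..<n}" "Poly_Mapping.keys b \<subseteq> {..<n}"
  shows "Poly_Mapping.keys (minter a b) \<subseteq> {..<2 * n}"
proof
  fix i assume "i \<in> Poly_Mapping.keys (minter a b)"
  then have "i div 2 \<in> Poly_Mapping.keys a \<or> i div 2 \<in> Poly_Mapping.keys b"
    by (cases "even i") (simp_all add: in_keys_iff minter.rep_eq)
  then have "i div 2 < n" using assms by blast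
  then show "i \<in> {..<2 * n}" by simp
qed

lemma ex_keys_bound2: "\<exists>n. Poly_Mapping.keys a \<subseteq> {..<n :: nat} \<and> Poly_Mapping.keys b \<subseteq> {..<n}"
proof -
  have "finite (Poly_Mapping.keys a \<union> Poly_Mapping.keys b)" by simp
  then obtain n where "Poly_Mapping.keys a \<union> Poly_Mapping.keys b \<subseteq> {..<n}"
    unfolding finite_nat_iff_bounded ..
  then show ?thesis by (intro exI[of _ n]) simp
qed

text \<open>The branching rule for whole alphabets. Sorting the interleaved exponents with those of
  \<open>b\<close> first makes the \<open>a\<close> operators outermost, and composing the two
  blocks gives the sum over \<nu>.\<close>

lemma FF_skew_split:
  "(\<Sum>\<nu> | \<nu> \<subseteq>\<^sub>p \<kappa>. pcoeff (FF_skew \<kappa> \<nu>) a * pcoeff (FF_skew \<nu> \<mu>) b) = pcoeff (FF_skew \<kappa> \<mu>) (minter a b)"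
proof -
  obtain n where n: "Poly_Mapping.keys a \<subseteq> {..<n}" "Poly_Mapping.keys b \<subseteq> {..<n}" using ex_keys_bound2 by blast
  have "pcoeff (FF_skew \<kappa> \<mu>) (minter a b) = Tlist (expl (2 * n) (minter a b)) \<kappa> \<mu>"
    by (rule pcoeff_FF_skew_Tlist[OF keys_minter[OF n]])
  also have "Tlist (expl (2 * n) (minter a b)) = Tlist (expl n b @ expl n a)"
    by (rule Tlist_perm) (simp add: mset_expl_minter)
  finally show ?thesis
    by (simp add: Tlist_append pcoeff_FF_skew_Tlist[OF n(1)] pcoeff_FF_skew_Tlist[OF n(2)])
qed

lemma FF_skew_minter_commute: "pcoeff (FF_skew \<kappa> \<mu>) (minter a b) = pcoeff (FF_skew \<kappa> \<mu>) (minter b a)"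
proof -
  obtain n where n: "Poly_Mapping.keys a \<subseteq> {..<n}" "Poly_Mapping.keys b \<subseteq> {..<n}" using ex_keys_bound2 by blast
  have "Tlist (expl (2 * n) (minter a b)) = Tlist (expl (2 * n) (minter b a))"
    by (rule Tlist_perm) (simp add: mset_expl_minter)
  then show ?thesis
    by (simp add: pcoeff_FF_skew_Tlist[OF keys_minter[OF n]] pcoeff_FF_skew_Tlist[OF keys_minter[OF n(2,1)]])
qed

lemma Delta_FF_skew: "Delta (FF_skew \<kappa> \<mu>) = (\<Sum>\<nu> | \<nu> \<subseteq>\<^sub>p \<kappa>. FF_skew \<kappa> \<nu> \<otimes> FF_skew \<nu> \<mu>)"
  by (rule pseries_eqI2) (simp add: FF_skew_split)

lemma subspace_Gamma: "pseries.subspace Gamma_q"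
  by (simp add: Gamma_q_def)

lemma FF_mem: "FF \<kappa> \<in> Gamma_q"
  by (simp add: Gamma_q_def pseries.span_base)

text \<open>Cocommutativity puts a combination of the skew functions
  \<open>FF_skew \<kappa> \<nu>\<close> into the span of the F. At the monomial of \<mu> the
  combination is triangular, so induction along \<open>prec\<close> isolates the term of
  \<mu>.\<close>

lemma FF_skew_mem: "FF_skew \<kappa> \<mu> \<in> Gamma_q"
proof (induction \<mu> rule: wf_induct_rule[OF wf_prec])
  case (1 \<mu>)
  show ?case
  proof (cases "\<mu> \<subseteq>\<^sub>p \<kappa>")
    case False
    then show ?thesis by (simp add: FF_skew_not_contained pseries.subspace_0[OF subspace_Gamma])
  next
    case True
    let ?b = "mono_of \<mu>" and ?A = "{\<nu>. \<nu> \<subseteq>\<^sub>p \<kappa>}"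
    have fin: "finite ?A" by (rule finite_contained)
    \<comment> \<open>The coefficient at monomial \<open>?b\<close> of one alphabet in the split of
      F_\<kappa>, read with the two alphabets in either role.\<close>
    have "(\<Sum>\<nu>\<in>?A. pscale (pcoeff (FF \<nu>) ?b) (FF_skew \<kappa> \<nu>)) =
        (\<Sum>\<nu>\<in>?A. pscale (pcoeff (FF_skew \<kappa> \<nu>) ?b) (FF \<nu>))"
    proof (rule pseries_eqI)
      fix a
      show "pcoeff (\<Sum>\<nu>\<in>?A. pscale (pcoeff (FF \<nu>) ?b) (FF_skew \<kappa> \<nu>)) a =
          pcoeff (\<Sum>\<nu>\<in>?A. pscale (pcoeff (FF_skew \<kappa> \<nu>) ?b) (FF \<nu>)) a"
        using FF_skew_split[of \<kappa> a empty_partition ?b] FF_skew_split[of \<kappa> ?b empty_partition a]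
          FF_skew_minter_commute[of \<kappa> empty_partition a ?b]
        by (simp add: FF_def mult.commute)
    qed
    also have "\<dots> \<in> Gamma_q"
      by (intro pseries.subspace_sum[OF subspace_Gamma] pseries.subspace_scale[OF subspace_Gamma] FF_mem)
    finally have S: "(\<Sum>\<nu>\<in>?A. pscale (pcoeff (FF \<nu>) ?b) (FF_skew \<kappa> \<nu>)) \<in> Gamma_q" .
    have split: "(\<Sum>\<nu>\<in>?A. pscale (pcoeff (FF \<nu>) ?b) (FF_skew \<kappa> \<nu>)) =
        pscale (pcoeff (FF \<mu>) ?b) (FF_skew \<kappa> \<mu>) +
        (\<Sum>\<nu>\<in>?A - {\<mu>}. pscale (pcoeff (FF \<nu>) ?b) (FF_skew \<kappa> \<nu>))"
      using fin True by (intro sum.remove) simp_all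
    have "(\<Sum>\<nu>\<in>?A - {\<mu>}. pscale (pcoeff (FF \<nu>) ?b) (FF_skew \<kappa> \<nu>)) \<in> Gamma_q"
    proof (rule pseries.subspace_sum[OF subspace_Gamma])
      fix \<nu> assume \<nu>: "\<nu> \<in> ?A - {\<mu>}"
      show "pscale (pcoeff (FF \<nu>) ?b) (FF_skew \<kappa> \<nu>) \<in> Gamma_q"
      proof (cases "pcoeff (FF \<nu>) ?b = 0")
        case True
        then show ?thesis by (simp add: pseries.subspace_0[OF subspace_Gamma])
      next
        case False
        then have "prec \<nu> \<mu>" using FF_coeff_mono_of[OF False] \<nu> by blast
        then have "FF_skew \<kappa> \<nu> \<in> Gamma_q" using 1 by simp
        then show ?thesis by (rule pseries.subspace_scale[OF subspace_Gamma])
      qed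
    qed
    from pseries.subspace_diff[OF subspace_Gamma S this]
    have "pscale (pcoeff (FF \<mu>) ?b) (FF_skew \<kappa> \<mu>) \<in> Gamma_q" unfolding split by simp
    then have "pscale (inverse (pcoeff (FF \<mu>) ?b)) (pscale (pcoeff (FF \<mu>) ?b) (FF_skew \<kappa> \<mu>)) \<in> Gamma_q"
      by (rule pseries.subspace_scale[OF subspace_Gamma])
    then show ?thesis using FF_coeff_diagonal[of \<mu>] by simp
  qed
qed

lemma Gamma_mult:
  assumes f: "f \<in> Gamma_q" and g: "g \<in> Gamma_q"
  shows "f * g \<in> Gamma_q"
proof -
  have 1: "FF \<nu> * g \<in> Gamma_q" for \<nu>
    using g[unfolded Gamma_q_def]
  proof (induction rule: pseries.span_induct_alt)
    case base
    show ?case by (simp add: pseries.subspace_0[OF subspace_Gamma])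
  next
    case (step c x y)
    then show ?case
      by (auto simp: distrib_left pscale_mult_right intro!: FF_mult_mem
          pseries.subspace_add[OF subspace_Gamma] pseries.subspace_scale[OF subspace_Gamma])
  qed
  show ?thesis using f[unfolded Gamma_q_def]
  proof (induction rule: pseries.span_induct_alt)
    case base
    show ?case by (simp add: pseries.subspace_0[OF subspace_Gamma])
  next
    case (step c x y)
    then show ?case
      by (auto simp: distrib_right pscale_mult_left intro!: 1
          pseries.subspace_add[OF subspace_Gamma] pseries.subspace_scale[OF subspace_Gamma])
  qed
qed

lemma commutative_subalgebra_Gamma: "commutative_subalgebra Gamma_q"
  using FF_mem[of empty_partition]
  by (simp add: commutative_subalgebra_def subspace_Gamma Gamma_mult FF_empty mult.commute)

section \<open>Coalgebra axioms, checked on the basis\<close>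

lemma linear_on_zero: "linear_on s1 s2 V L \<Longrightarrow> 0 \<in> V \<Longrightarrow> L 0 = 0"
  unfolding linear_on_def by (metis add_0 add_cancel_right_left)

lemma linear_on_sum:
  assumes "linear_on pscale s V L" "pseries.subspace V"
  shows "(\<And>i. i \<in> I \<Longrightarrow> x i \<in> V) \<Longrightarrow> L (\<Sum>i\<in>I. x i) = (\<Sum>i\<in>I. L (x i))"
proof (induction I rule: infinite_finite_induct)
  case (insert i I)
  then have "(\<Sum>i\<in>I. x i) \<in> V" by (intro pseries.subspace_sum[OF assms(2)]) simp
  then show ?case using insert assms(1) by (simp add: linear_on_def)
qed (simp_all add: linear_on_zero[OF assms(1)] pseries.subspace_0[OF assms(2)])

lemma linear_on_span_ext:
  assumes L: "linear_on pscale s (pseries.span B) L" and L': "linear_on pscale s (pseries.span B) L'"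
    and eq: "\<And>b. b \<in> B \<Longrightarrow> L b = L' b" and x: "x \<in> pseries.span B"
  shows "L x = L' x"
proof -
  have "x \<in> pseries.span B \<and> L x = L' x" using x
  proof (induction rule: pseries.span_induct_alt)
    case base
    show ?case using linear_on_zero[OF L] linear_on_zero[OF L'] by (simp add: pseries.span_zero)
  next
    case (step c b y)
    have "b \<in> pseries.span B" "pscale c b \<in> pseries.span B"
      using step by (auto intro: pseries.span_base pseries.span_scale)
    then show ?case using step L L' eq[of b] by (auto simp: linear_on_def pseries.span_add)
  qed
  then show ?thesis ..
qed

lemma linear_on_comp:
  assumes "linear_on s1 s2 V L" "linear_on s2 s3 W M" "L ` V \<subseteq> W"
  shows "linear_on s1 s3 V (\<lambda>x. M (L x))"
  using assms unfolding linear_on_def by (auto simp: image_subset_iff)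

lemma linear_on_Delta: "linear_on pscale pscale V Delta"
  unfolding linear_on_def by (auto intro!: pseries_eqI2)

lemma subspace_tensor_space: "pseries.subspace (tensor_space V W)"
  by (simp add: tensor_space_def)

lemma tensor_mem: "f \<in> V \<Longrightarrow> g \<in> W \<Longrightarrow> f \<otimes> g \<in> tensor_space V W"
  unfolding tensor_space_def by (auto intro: pseries.span_base)

lemma Delta_FF: "Delta (FF \<kappa>) = (\<Sum>\<nu> | \<nu> \<subseteq>\<^sub>p \<kappa>. FF_skew \<kappa> \<nu> \<otimes> FF \<nu>)"
  by (simp add: FF_def Delta_FF_skew)

lemma Delta_FF_mem: "Delta (FF \<kappa>) \<in> tensor_space Gamma_q Gamma_q"
  unfolding Delta_FF
  by (intro pseries.subspace_sum[OF subspace_tensor_space] tensor_mem FF_skew_mem FF_mem)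

lemma Delta_mem: "Delta ` Gamma_q \<subseteq> tensor_space Gamma_q Gamma_q"
proof clarify
  fix f assume "f \<in> Gamma_q"
  then show "Delta f \<in> tensor_space Gamma_q Gamma_q"
    unfolding Gamma_q_def
  proof (induction rule: pseries.span_induct_alt)
    case base
    show ?case using linear_on_zero[OF linear_on_Delta[of UNIV]]
      by (simp add: pseries.subspace_0[OF subspace_tensor_space])
  next
    case (step c x y)
    have "Delta (pscale c x + y) = pscale c (Delta x) + Delta y"
      using linear_on_Delta[of UNIV] by (simp add: linear_on_def)
    then show ?case
      using step Delta_FF_mem unfolding Gamma_q_def
      by (auto intro!: pseries.subspace_add[OF subspace_tensor_space]
          pseries.subspace_scale[OF subspace_tensor_space])
  qed
qed

lemma tensor_sum_left: "(\<Sum>i\<in>I. f i) \<otimes> g = (\<Sum>i\<in>I. f i \<otimes> g)"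
  and tensor_sum_right: "h \<otimes> (\<Sum>i\<in>I. g' i) = (\<Sum>i\<in>I. h \<otimes> g' i)"
  by (rule pseries_eqI2, simp add: sum_distrib_left sum_distrib_right)+

lemma tensor_zero [simp]: "0 \<otimes> g = 0" "f \<otimes> 0 = 0"
  by (rule pseries_eqI2, simp)+

lemma linear_on_id: "linear_on s s V id"
  by (simp add: linear_on_def)

lemma linear_on_tensor_assoc: "linear_on pscale pscale V tensor_assoc"
  unfolding linear_on_def by (transfer, auto simp: fun_eq_iff)

lemma linear_on_tensor_swap: "linear_on pscale pscale V tensor_swap"
  unfolding linear_on_def by (transfer, auto simp: fun_eq_iff)

text \<open>On F_\<kappa> both sides are the splitting into three alphabets, summed over chains
  \<nu> \<subseteq> \<rho> \<subseteq> \<kappa>.\<close>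

lemma Delta_coassoc:
  assumes "f \<in> Gamma_q"
  shows "tensor_assoc (tensor_map Gamma_q Gamma_q Delta id (Delta f)) = tensor_map Gamma_q Gamma_q id Delta (Delta f)"
proof (rule linear_on_span_ext[OF _ _ _ assms[unfolded Gamma_q_def]])
  note L1 = tensor_map_tensor[OF subspace_Gamma subspace_Gamma linear_on_Delta linear_on_id]
  note L2 = tensor_map_tensor[OF subspace_Gamma subspace_Gamma linear_on_id linear_on_Delta]
  show "linear_on pscale pscale (pseries.span (range FF))
      (\<lambda>f. tensor_assoc (tensor_map Gamma_q Gamma_q Delta id (Delta f)))"
    by (rule linear_on_comp[OF linear_on_comp[OF linear_on_Delta L1(1)] linear_on_tensor_assoc subset_UNIV])
      (use Delta_mem in \<open>simp add: Gamma_q_def\<close>)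
  show "linear_on pscale pscale (pseries.span (range FF)) (\<lambda>f. tensor_map Gamma_q Gamma_q id Delta (Delta f))"
    by (rule linear_on_comp[OF linear_on_Delta L2(1)]) (use Delta_mem in \<open>simp add: Gamma_q_def\<close>)
  fix g assume "g \<in> range FF"
  then obtain \<kappa> where g: "g = FF \<kappa>" by blast
  let ?A = "{\<nu>. \<nu> \<subseteq>\<^sub>p \<kappa>}"
  let ?t = "\<lambda>\<rho> \<nu>. FF_skew \<kappa> \<rho> \<otimes> FF_skew \<rho> \<nu> \<otimes> FF \<nu>"
  have "tensor_map Gamma_q Gamma_q Delta id (Delta g) = (\<Sum>\<nu>\<in>?A. Delta (FF_skew \<kappa> \<nu>) \<otimes> FF \<nu>)"
    unfolding g Delta_FF
    by (subst linear_on_sum[OF L1(1) subspace_tensor_space])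
      (auto simp: L1(2) tensor_mem FF_skew_mem FF_mem)
  also have "\<dots> = (\<Sum>\<nu>\<in>?A. \<Sum>\<rho>\<in>?A. (FF_skew \<kappa> \<rho> \<otimes> FF_skew \<rho> \<nu>) \<otimes> FF \<nu>)"
    by (simp add: Delta_FF_skew tensor_sum_left)
  finally have l: "tensor_assoc (tensor_map Gamma_q Gamma_q Delta id (Delta g)) = (\<Sum>\<nu>\<in>?A. \<Sum>\<rho>\<in>?A. ?t \<rho> \<nu>)"
    by (simp add: linear_on_sum[OF linear_on_tensor_assoc pseries.subspace_UNIV] tensor_assoc_tensor)
  have "tensor_map Gamma_q Gamma_q id Delta (Delta g) = (\<Sum>\<rho>\<in>?A. FF_skew \<kappa> \<rho> \<otimes> Delta (FF \<rho>))"
    unfolding g Delta_FF[of \<kappa>]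
    by (subst linear_on_sum[OF L2(1) subspace_tensor_space])
      (auto simp: L2(2) tensor_mem FF_skew_mem FF_mem)
  also have "\<dots> = (\<Sum>\<rho>\<in>?A. \<Sum>\<nu>\<in>?A. ?t \<rho> \<nu>)"
  proof (intro sum.cong refl)
    fix \<rho> assume \<rho>: "\<rho> \<in> ?A"
    have "FF_skew \<kappa> \<rho> \<otimes> Delta (FF \<rho>) = (\<Sum>\<nu> | \<nu> \<subseteq>\<^sub>p \<rho>. ?t \<rho> \<nu>)"
      by (simp add: Delta_FF tensor_sum_right)
    \<comment> \<open>Skew functions of shapes that are not contained vanish, so \<nu> may run over
      everything inside \<kappa> and the two sums can be exchanged.\<close>
    also have "\<dots> = (\<Sum>\<nu>\<in>?A. ?t \<rho> \<nu>)"
      using \<rho> contained_trans by (intro sum.mono_neutral_left finite_contained) (auto simp: FF_skew_not_contained)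
    finally show "FF_skew \<kappa> \<rho> \<otimes> Delta (FF \<rho>) = (\<Sum>\<nu>\<in>?A. ?t \<rho> \<nu>)" .
  qed
  also have "\<dots> = (\<Sum>\<nu>\<in>?A. \<Sum>\<rho>\<in>?A. ?t \<rho> \<nu>)" by (rule sum.swap)
  finally show "tensor_assoc (tensor_map Gamma_q Gamma_q Delta id (Delta g)) = tensor_map Gamma_q Gamma_q id Delta (Delta g)"
    using l by simp
qed

lemma pcoeff_FF_skew_0: "pcoeff (FF_skew \<kappa> \<mu>) 0 = (if \<mu> = \<kappa> then 1 else 0)"
  using pcoeff_FF_skew_Tlist[of 0 0 \<kappa> \<mu>] by (simp add: expl_def Tlist_def dirac_def)

text \<open>The counit is the constant term, which for a skew function is 1 if the two shapes agree
  and 0 otherwise. Only \<nu> = \<kappa> survives in the first sum, only the empty partition in the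
  second.\<close>

lemma Delta_counit:
  assumes "f \<in> Gamma_q"
  shows "tensor_lift pscale Gamma_q Gamma_q (\<lambda>g h. pscale (pcoeff g 0) h) (Delta f) = f"
    and "tensor_lift pscale Gamma_q Gamma_q (\<lambda>g h. pscale (pcoeff h 0) g) (Delta f) = f"
proof -
  have B1: "linear_on pscale pscale Gamma_q (\<lambda>f. pscale (pcoeff f 0) (g :: series))"
    "linear_on pscale pscale Gamma_q (pscale c :: series \<Rightarrow> series)" for g c
    by (auto simp: linear_on_def pseries.scale_left_distrib pseries.scale_right_distrib mult.commute)
  note L1 = tensor_universal[OF pseries.vector_space_axioms subspace_Gamma subspace_Gamma,
      of "\<lambda>g h. pscale (pcoeff g 0) h", OF B1(1) B1(2)]
  note L2 = tensor_universal[OF pseries.vector_space_axioms subspace_Gamma subspace_Gamma,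
      of "\<lambda>g h. pscale (pcoeff h 0) g", OF B1(2) B1(1)]
  have id: "linear_on pscale pscale (pseries.span (range FF)) (\<lambda>f. f)" by (simp add: linear_on_def)
  show "tensor_lift pscale Gamma_q Gamma_q (\<lambda>g h. pscale (pcoeff g 0) h) (Delta f) = f"
  proof (rule linear_on_span_ext[OF _ id _ assms[unfolded Gamma_q_def]])
    show "linear_on pscale pscale (pseries.span (range FF))
        (\<lambda>f. tensor_lift pscale Gamma_q Gamma_q (\<lambda>g h. pscale (pcoeff g 0) h) (Delta f))"
      by (rule linear_on_comp[OF linear_on_Delta L1(1)]) (use Delta_mem in \<open>simp add: Gamma_q_def\<close>)
    fix g assume "g \<in> range FF"
    then obtain \<kappa> where g: "g = FF \<kappa>" by blast
    have "tensor_lift pscale Gamma_q Gamma_q (\<lambda>g h. pscale (pcoeff g 0) h) (Delta g) =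
        (\<Sum>\<nu> | \<nu> \<subseteq>\<^sub>p \<kappa>. pscale (pcoeff (FF_skew \<kappa> \<nu>) 0) (FF \<nu>))"
      unfolding g Delta_FF
      by (subst linear_on_sum[OF L1(1) subspace_tensor_space]) (auto simp: L1(2) tensor_mem FF_skew_mem FF_mem)
    also have "\<dots> = (\<Sum>\<nu> | \<nu> \<subseteq>\<^sub>p \<kappa>. if \<nu> = \<kappa> then FF \<nu> else 0)"
      by (intro sum.cong refl) (simp add: pcoeff_FF_skew_0)
    also have "\<dots> = g" by (simp add: g finite_contained)
    finally show "tensor_lift pscale Gamma_q Gamma_q (\<lambda>g h. pscale (pcoeff g 0) h) (Delta g) = g" .
  qed
  show "tensor_lift pscale Gamma_q Gamma_q (\<lambda>g h. pscale (pcoeff h 0) g) (Delta f) = f"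
  proof (rule linear_on_span_ext[OF _ id _ assms[unfolded Gamma_q_def]])
    show "linear_on pscale pscale (pseries.span (range FF))
        (\<lambda>f. tensor_lift pscale Gamma_q Gamma_q (\<lambda>g h. pscale (pcoeff h 0) g) (Delta f))"
      by (rule linear_on_comp[OF linear_on_Delta L2(1)]) (use Delta_mem in \<open>simp add: Gamma_q_def\<close>)
    fix g assume "g \<in> range FF"
    then obtain \<kappa> where g: "g = FF \<kappa>" by blast
    have "tensor_lift pscale Gamma_q Gamma_q (\<lambda>g h. pscale (pcoeff h 0) g) (Delta g) =
        (\<Sum>\<nu> | \<nu> \<subseteq>\<^sub>p \<kappa>. pscale (pcoeff (FF \<nu>) 0) (FF_skew \<kappa> \<nu>))"
      unfolding g Delta_FF
      by (subst linear_on_sum[OF L2(1) subspace_tensor_space]) (auto simp: L2(2) tensor_mem FF_skew_mem FF_mem)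
    also have "\<dots> = (\<Sum>\<nu> | \<nu> \<subseteq>\<^sub>p \<kappa>. if \<nu> = empty_partition then FF_skew \<kappa> \<nu> else 0)"
      by (intro sum.cong refl) (simp add: FF_def pcoeff_FF_skew_0)
    also have "\<dots> = g"
    proof -
      have "empty_partition \<subseteq>\<^sub>p \<kappa>" by (simp add: contained_iff)
      then show ?thesis by (simp add: g FF_def finite_contained)
    qed
    finally show "tensor_lift pscale Gamma_q Gamma_q (\<lambda>g h. pscale (pcoeff h 0) g) (Delta g) = g" .
  qed
qed

text \<open>Natural exponents add up to 0 only if both are 0; this makes the counit
  multiplicative.\<close>

lemma pcoeff_mult_0: "pcoeff (f * g) 0 = pcoeff f 0 * pcoeff (g :: series) 0"
proof -
  have "{(a, b). a + b = (0 :: nat \<Rightarrow>\<^sub>0 nat)} = {(0, 0)}"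
    by (auto simp: poly_mapping_eq_iff fun_eq_iff lookup_add)
  then show ?thesis by (simp add: pcoeff_mult)
qed

lemma bialgebra_Gamma: "commutative_bialgebra_on Gamma_q Delta (\<lambda>f. pcoeff f 0)"
  unfolding commutative_bialgebra_on_def coalgebra_on_def
  using commutative_subalgebra_Gamma subspace_Gamma linear_on_Delta Delta_mem Delta_coassoc Delta_counit
    Delta_one Delta_mult pcoeff_mult_0
  by (simp add: linear_on_def pcoeff_one)

lemma Delta_cocommutative: "cocommutative_on Gamma_q Delta"
  unfolding cocommutative_on_def
proof
  fix f assume f: "f \<in> Gamma_q"
  show "tensor_swap (Delta f) = Delta f"
  proof (rule linear_on_span_ext[OF _ linear_on_Delta _ f[unfolded Gamma_q_def]])
    show "linear_on pscale pscale (pseries.span (range FF)) (\<lambda>f. tensor_swap (Delta f))"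
      by (rule linear_on_comp[OF linear_on_Delta linear_on_tensor_swap subset_UNIV])
    fix g assume "g \<in> range FF"
    then obtain \<kappa> where g: "g = FF \<kappa>" by blast
    have s: "pcoeff (tensor_swap F) (b, a) = pcoeff F (a, b)"
      for F :: "((nat \<Rightarrow>\<^sub>0 nat) \<times> (nat \<Rightarrow>\<^sub>0 nat), Rq) pseries" and a b
      by transfer simp
    show "tensor_swap (Delta g) = Delta g"
      by (rule pseries_eqI2) (simp add: s g FF_def FF_skew_minter_commute)
  qed
qed

theorem theorem3p1:
  shows
    "(\<forall>\<mu> \<nu>.
        (\<exists>!c. FF_expansion (FF \<nu> * FF \<mu>) c) \<and>
        finite {\<kappa>. struct_coeff \<mu> \<nu> \<kappa> \<noteq> 0} \<and>
        FF \<nu> * FF \<mu> =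
          (\<Sum>\<kappa> | struct_coeff \<mu> \<nu> \<kappa> \<noteq> 0. pscale (struct_coeff \<mu> \<nu> \<kappa>) (FF \<kappa>)))
     \<and>
     (commutative_subalgebra Gamma_q \<and>
      inj FF \<and> pseries.independent (range FF) \<and> pseries.span (range FF) = Gamma_q)
     \<and>
     (\<forall>\<kappa> \<mu>. \<mu> \<subseteq>\<^sub>p \<kappa> \<longrightarrow> FF_skew \<kappa> \<mu> \<in> Gamma_q)
     \<and>
     (\<exists>\<Delta> \<epsilon>. commutative_bialgebra_on Gamma_q \<Delta> \<epsilon> \<and> cocommutative_on Gamma_q \<Delta> \<and>
        (\<forall>\<kappa>. \<Delta> (FF \<kappa>) = (\<Sum>\<mu> | \<mu> \<subseteq>\<^sub>p \<kappa>. FF_skew \<kappa> \<mu> \<otimes> FF \<mu>)))"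
proof (intro conjI allI impI)
  fix \<mu> \<nu>
  show ex1: "\<exists>!c. FF_expansion (FF \<nu> * FF \<mu>) c"
    using FF_mult_expansion FF_expansion_unique by blast
  \<comment> \<open>\<open>struct_coeff\<close> is a definite description, so its defining property
    rests on the uniqueness just shown.\<close>
  have c: "FF_expansion (FF \<nu> * FF \<mu>) (struct_coeff \<mu> \<nu>)"
    unfolding struct_coeff_def using ex1 by (rule theI')
  then show fin: "finite {\<kappa>. struct_coeff \<mu> \<nu> \<kappa> \<noteq> 0}" by (rule FF_mult_finite)
  show "FF \<nu> * FF \<mu> = (\<Sum>\<kappa> | struct_coeff \<mu> \<nu> \<kappa> \<noteq> 0. pscale (struct_coeff \<mu> \<nu> \<kappa>) (FF \<kappa>))"
    using c fin by (rule FF_expansion_finite)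
next
  show "\<exists>\<Delta> \<epsilon>. commutative_bialgebra_on Gamma_q \<Delta> \<epsilon> \<and> cocommutative_on Gamma_q \<Delta> \<and>
      (\<forall>\<kappa>. \<Delta> (FF \<kappa>) = (\<Sum>\<mu> | \<mu> \<subseteq>\<^sub>p \<kappa>. FF_skew \<kappa> \<mu> \<otimes> FF \<mu>))"
    using bialgebra_Gamma Delta_cocommutative Delta_FF by blast
qed (simp_all add: commutative_subalgebra_Gamma inj_FF independent_FF FF_skew_mem Gamma_q_def[symmetric])

end
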